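(* Let $N\ge 2$, let $(X,d,\mathfrak m)$ be a Polish metric measure space, and let $\rho\mathfrak m$ be a Borel probability measure on $X$, absolutely continuous with respect to $\mathfrak m$ with density $\rho$, such that $\rho\log\rho\in L^1_{\mathfrak m}(X)$ and such that conditions (A) and (B) (see context) hold. Let $c(x_1,\dots,x_N)=\sum_{1\le i<j\le N}f(d(x_i,x_j))$ with $f$ satisfying (F1) and (F2) (see context). Let $(\tau_n)_{n\in\mathbb N}$ be any sequence of positive real numbers decreasing to zero. Define $\mathcal C_n,\mathcal C:\mathcal P^{\mathrm{sym}}(X^N)\to\mathbb R\cup\{+\infty\}$ by \[ \mathcal C_n[\gamma]=\begin{cases}C_0[\gamma]+\tau_n E[\gamma]&\text{if }\gamma\in\Pi_N(\rho),\\ +\infty&\text{otherwise,}\end{cases} \qquad \mathcal C[\gamma]=\begin{cases}C_0[\gamma]&\text{if }\gamma\in\Pi_N(\rho),\\ +\infty&\text{otherwise.}\end{cases} \] Then the sequence $(\mathcal C_n)_{n\in\mathbb N}$ $\Gamma$-converges to $\mathcal C$ in $\mathcal P^{\mathrm{sym}}(X^N)$ (with respect to narrow convergence). That is, for every $\gamma\in\mathcal P^{\mathrm{sym}}(X^N)$: (I) for each sequence $(\gamma_n)_{n\in\mathbb N}$ in $\mathcal P^{\mathrm{sym}}(X^N)$ converging narrowly to $\gamma$, $\liminf_{n\to\infty}\mathcal C_n[\gamma_n]\ge\mathcal C[\gamma]$; and (II) there exists a sequence $(\gamma_n)_{n\in\mathbb N}$ in $\mathcal P^{\mathrm{sym}}(X^N)$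 converging narrowly to $\gamma$ such that $\limsup_{n\to\infty}\mathcal C_n[\gamma_n]\le\mathcal C[\gamma]$.
   Context: $(X,d)$ is a complete separable metric space equipped with a ($\sigma$-finite, nonnegative) Borel reference measure $\mathfrak m$; $\mathfrak m_N=\mathfrak m\otimes\cdots\otimes\mathfrak m$ is the product measure on $X^N$. $\mathcal P(X^N)$ is the set of Borel probability measures on $X^N$. A measure $\gamma\in\mathcal P(X^N)$ is symmetric if it is invariant under all permutations of the $N$ coordinates; $\mathcal P^{\mathrm{sym}}(X^N)$ is the set of symmetric probability measures. $\Pi_N(\rho)$ is the set of $\gamma\in\mathcal P(X^N)$ all of whose $N$ one-coordinate marginals equal $\rho\mathfrak m$. By abuse of notation $\rho$ also denotes the measure $\rho\mathfrak m$. Narrow convergence means convergence of integrals against all bounded continuous functions. The function $f:[0,\infty)\to\mathbb R\cup\{+\infty\}$, with $f(0)=+\infty$, satisfies: (F1) $f|_{(0,\infty)}$ is real-valued, continuous and decreasing; (F2) $\lim_{t\to0+}f(t)=+\infty$. Conditions on $\rho$: (A) $\lim_{r\to0}\sup_{x\in X}\rho(B(x,r))<\frac1{N(N-1)^2}$; (B) $\int_{X\setminus B(o,r_0)}f(2d(x,o))\,\mathrm d\rho(x)>-\infty$ for some $o\in X$ and some $r_0>0$. Here $B(x,r)$ is the ball of radius $r$ around $x$. $C_0[\gamma]=\int_{X^N}c\,\mathrm d\gamma$. The entropy is $E[\gamma]=\int_{X^N}\rho_\gamma\log\rho_\gamma\,\mathrm d\mathfrak m_N$ if $\gamma\ll\mathfrak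 m_N$ with density $\rho_\gamma=\frac{\mathrm d\gamma}{\mathrm d\mathfrak m_N}$, and $E[\gamma]=+\infty$ otherwise. *)

theory Defs
  imports "HOL-Probability.Probability"
begin

text \<open>
  The base space is a type \<open>'a::polish_space\<close> with its distance \<open>dist\<close>. The product \<open>X\<^sup>N\<close> is
  the function type \<open>'n \<Rightarrow> 'a\<close> with \<open>N = CARD('n)\<close> and the product topology; the order on \<open>'n\<close>
  only serves to write sums over \<open>i < j\<close>. Since \<open>'a\<close> is second countable, the Borel
  \<open>\<sigma>\<close>-algebra of \<open>'n \<Rightarrow> 'a\<close> is the product \<open>\<sigma>\<close>-algebra.
\<close>

text \<open>
  Integral of an extended-real function as the integral of the positive part minus that of the
  negative part. The value is meaningful if one of the two is finite (otherwise the arithmetic of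
  \<open>ereal\<close> gives \<open>\<infinity> - \<infinity> = \<infinity>\<close>). The Bochner integral is not used, because it returns 0 where the
  value here is infinite.
\<close>

definition ereal_integral :: "'b measure \<Rightarrow> ('b \<Rightarrow> ereal) \<Rightarrow> ereal" where
  "ereal_integral M g =
     enn2ereal (\<integral>\<^sup>+x. e2ennreal (g x) \<partial>M) - enn2ereal (\<integral>\<^sup>+x. e2ennreal (- g x) \<partial>M)"

definition borel_prob_measures :: "'b::topological_space measure set" where
  "borel_prob_measures = {\<gamma>. sets \<gamma> = sets borel \<and> prob_space \<gamma>}"

definition sym_prob_measures :: "('n \<Rightarrow> 'a::topological_space) measure set" where
  "sym_prob_measures =
     {\<gamma> \<in> borel_prob_measures. \<forall>p. bij p \<longrightarrow> distr \<gamma> borel (\<lambda>x. x \<circ> p) = \<gamma>}"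

definition couplings :: "'a::topological_space measure \<Rightarrow> ('n \<Rightarrow> 'a) measure set" where
  "couplings \<mu> = {\<gamma> \<in> borel_prob_measures. \<forall>i. distr \<gamma> borel (\<lambda>x. x i) = \<mu>}"

definition narrowly_converges ::
    "(nat \<Rightarrow> 'b::topological_space measure) \<Rightarrow> 'b measure \<Rightarrow> bool" where
  "narrowly_converges \<gamma>s \<gamma> \<longleftrightarrow>
     (\<forall>g::'b \<Rightarrow> real. continuous_on UNIV g \<and> bounded (range g) \<longrightarrow>
        (\<lambda>n. \<integral>x. g x \<partial>\<gamma>s n) \<longlonglongrightarrow> (\<integral>x. g x \<partial>\<gamma>))"

definition Gamma_converges_on ::
    "'b::topological_space measure set \<Rightarrow> (nat \<Rightarrow> 'b measure \<Rightarrow> ereal)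
      \<Rightarrow> ('b measure \<Rightarrow> ereal) \<Rightarrow> bool" where
  "Gamma_converges_on S Fs F \<longleftrightarrow>
     (\<forall>\<gamma>\<in>S.
        (\<forall>\<gamma>s. (\<forall>n. \<gamma>s n \<in> S) \<and> narrowly_converges \<gamma>s \<gamma> \<longrightarrow>
            F \<gamma> \<le> liminf (\<lambda>n. Fs n (\<gamma>s n))) \<and>
        (\<exists>\<gamma>s. (\<forall>n. \<gamma>s n \<in> S) \<and> narrowly_converges \<gamma>s \<gamma> \<and>
            limsup (\<lambda>n. Fs n (\<gamma>s n)) \<le> F \<gamma>))"

definition pair_cost ::
    "(real \<Rightarrow> ereal) \<Rightarrow> ('n::{finite,linorder} \<Rightarrow> 'a::metric_space) \<Rightarrow> ereal" where
  "pair_cost f x = (\<Sum>(i, j)\<in>{(i, j). i < j}. f (dist (x i) (x j)))"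

definition transport_cost ::
    "(real \<Rightarrow> ereal) \<Rightarrow> ('n::{finite,linorder} \<Rightarrow> 'a::metric_space) measure \<Rightarrow> ereal" where
  "transport_cost f \<gamma> = ereal_integral \<gamma> (pair_cost f)"

text \<open>
  For a probability measure the Radon--Nikodym derivative is finite almost everywhere, so
  \<open>enn2real\<close> changes it only on a null set; \<open>t * ln t\<close> is 0 at \<open>t = 0\<close>.
\<close>

definition rel_entropy :: "'a::topological_space measure \<Rightarrow> ('n \<Rightarrow> 'a) measure \<Rightarrow> ereal" where
  "rel_entropy m \<gamma> =
     (let mN = Pi\<^sub>M UNIV (\<lambda>_. m)
      in if absolutely_continuous mN \<gamma>
         then ereal_integral mN
                (\<lambda>x. let t = enn2real (RN_deriv mN \<gamma> x) in ereal (t * ln t))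
         else \<infinity>)"

definition limit_functional ::
    "(real \<Rightarrow> ereal) \<Rightarrow> 'a::metric_space measure
      \<Rightarrow> ('n::{finite,linorder} \<Rightarrow> 'a) measure \<Rightarrow> ereal" where
  "limit_functional f \<mu> \<gamma> = (if \<gamma> \<in> couplings \<mu> then transport_cost f \<gamma> else \<infinity>)"

definition entropic_functional ::
    "(real \<Rightarrow> ereal) \<Rightarrow> 'a::metric_space measure \<Rightarrow> 'a measure \<Rightarrow> real
      \<Rightarrow> ('n::{finite,linorder} \<Rightarrow> 'a) measure \<Rightarrow> ereal" where
  "entropic_functional f m \<mu> \<tau> \<gamma> =
     (if \<gamma> \<in> couplings \<mu> then transport_cost f \<gamma> + ereal \<tau> * rel_entropy m \<gamma> else \<infinity>)"

definition repulsive_profile :: "(real \<Rightarrow> ereal) \<Rightarrow> bool" where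
  "repulsive_profile f \<longleftrightarrow>
     f 0 = \<infinity> \<and>
     (\<forall>t>0. \<bar>f t\<bar> \<noteq> \<infinity>) \<and> continuous_on {0<..} f \<and>
     (\<forall>s t. 0 < s \<and> s \<le> t \<longrightarrow> f t \<le> f s) \<and>
     (f \<longlongrightarrow> \<infinity>) (at_right 0)"

definition small_concentration :: "nat \<Rightarrow> 'a::metric_space measure \<Rightarrow> bool" where
  "small_concentration N \<mu> \<longleftrightarrow>
     (\<exists>L::real. ((\<lambda>r. SUP x. measure \<mu> (ball x r)) \<longlongrightarrow> L) (at_right 0) \<and>
        L < 1 / (real N * (real N - 1)\<^sup>2))"

definition controlled_tail :: "(real \<Rightarrow> ereal) \<Rightarrow> 'a::metric_space measure \<Rightarrow> bool" where
  "controlled_tail f \<mu> \<longleftrightarrow>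
     (\<exists>z. \<exists>r0>0. ereal_integral (restrict_space \<mu> (- ball z r0)) (\<lambda>x. f (2 * dist x z)) > -\<infinity>)"

end

theory Submission
  imports Defs
begin

text \<open>
  The lower bound: on couplings the entropy is bounded below by a constant, because
  \<open>t ln t \<ge> t ln h + t - h\<close> for the density \<open>h\<close> of the product of the marginals; and the cost, after adding
  a function of the single coordinates whose integral depends only on the marginal, is nonnegative
  and the supremum of bounded continuous functions.

  The upper bound: let \<open>\<gamma>\<close> be a symmetric coupling of finite cost. It gives full mass to the open set of
  points with distinct coordinates, which is covered by countably many small boxes on which the cost
  is almost constant. Restrict \<open>\<gamma>\<close> to finitely many of the resulting cells and replace each restriction
  by the product of its marginals. This keeps the marginals and almost keeps the cost. The small
  remaining mass is moved by a swap: a remaining point \<open>x\<close> and tuples \<open>y\<^sup>1, \<dots>, y\<^sup>N\<close> from \<open>N\<close> cells are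
  exchanged for the tuples \<open>y\<^sup>i\<close> with coordinate \<open>i\<close> replaced by \<open>x\<^sub>i\<close> and the tuple
  \<open>(y\<^sup>1\<^sub>1, \<dots>, y\<^sup>N\<^sub>N)\<close>. Condition (A) allows to choose the \<open>y\<^sup>i\<close> such that all new tuples have
  coordinates at a distance bounded below, so that the new cost is bounded. The result has a bounded
  density with respect to the product of the marginals and hence finite entropy. Symmetrize it, and
  run through the approximations slowly enough for \<open>\<tau>\<^sub>n\<close> times the entropy to vanish.
\<close>

section \<open>Narrow convergence\<close>

text \<open>The difficulty of the upper bound is that the competitor must have exactly the
  prescribed marginals, finite entropy and almost the same cost at once. Products over cells are
  harmless only inside boxes in which no two coordinates can meet. Such boxes accumulate at the
  diagonals, so infinitely many may be needed, with masses tending to zero in the denominators of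
  the product densities. Hence the cut to finitely many cells, and hence a remainder that may sit
  arbitrarily close to the diagonals. The swap has a bounded cost per unit of remaining mass, but
  that bound and the cells that donate tuples must not depend on the remainder: donors have index
  below \<open>K0\<close>, and \<open>K\<close> is taken so large afterwards that the remaining mass
  is small against the masses of the donors and against the cost bounds. As \<open>f\<close> may
  tend to minus infinity, the cost is unbounded below. Condition (B) supplies the one-coordinate
  function \<open>tail\<close>, which restores a lower bound and has the same integral under every
  coupling, so that it acts as a constant.\<close>

lemma borel_prob_measuresD:
  assumes "\<gamma> \<in> borel_prob_measures"
  shows "sets \<gamma> = sets borel" "space \<gamma> = UNIV" "prob_space \<gamma>"
  using assms sets_eq_imp_space_eq[of \<gamma> borel] by (auto simp: borel_prob_measures_def)

text \<open>Closed sets form an intersection-stable generator of the Borel sets, and the indicator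
  of a nonempty closed \<open>C\<close> is the decreasing limit of the bounded continuous functions
  \<open>g k\<close>. Needed to identify the marginals of a narrow limit.\<close>

lemma borel_prob_measure_eqI:
  fixes \<mu> \<nu> :: "'b::metric_space measure"
  assumes mu: "\<mu> \<in> borel_prob_measures" and nu: "\<nu> \<in> borel_prob_measures"
    and eq: "\<And>g::'b \<Rightarrow> real. continuous_on UNIV g \<Longrightarrow> bounded (range g) \<Longrightarrow> (\<integral>x. g x \<partial>\<mu>) = (\<integral>x. g x \<partial>\<nu>)"
  shows "\<mu> = \<nu>"
proof -
  note m = borel_prob_measuresD[OF mu] and n = borel_prob_measuresD[OF nu]
  interpret M: prob_space \<mu> by (rule m)
  interpret N: prob_space \<nu> by (rule n)
  have main: "measure \<mu> C = measure \<nu> C" if C: "closed C" for C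
  proof (cases "C = {}")
    case False
    define g where "g k x = max 0 (1 - real k * infdist x C)" for k x
    have cont: "continuous_on UNIV (g k)" for k
      unfolding g_def by (intro continuous_intros)
    have range: "0 \<le> g k x" "g k x \<le> 1" for k x
      by (auto simp: g_def infdist_nonneg)
    have bdd: "bounded (range (g k))" for k
      using range by (intro boundedI[of _ 1]) auto
    have lim: "(\<lambda>k. g k x) \<longlonglongrightarrow> indicator C x" for x
    proof (cases "x \<in> C")
      case True
      then have "g k x = 1" for k by (simp add: g_def)
      then show ?thesis using True by simp
    next
      case out: False
      then have pos: "infdist x C > 0"
        using C False infdist_pos_not_in_closed by blast
      obtain K where K: "real K * infdist x C > 1"
        using reals_Archimedean3[OF pos] by blast
      have "eventually (\<lambda>k. g k x = 0) sequentially"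
        using eventually_ge_at_top[of K]
      proof eventually_elim
        case (elim k)
        then have "real k * infdist x C \<ge> real K * infdist x C"
          using pos by simp
        then show ?case using K by (simp add: g_def)
      qed
      then show ?thesis using out by (auto intro: tendsto_eventually)
    qed
    have limint: "(\<lambda>k. \<integral>x. g k x \<partial>\<kappa>) \<longlonglongrightarrow> measure \<kappa> C"
      if k: "prob_space \<kappa>" "sets \<kappa> = sets borel" "space \<kappa> = UNIV" for \<kappa> :: "'b measure"
    proof -
      interpret prob_space \<kappa> by (rule k)
      have "(\<lambda>k. \<integral>x. g k x \<partial>\<kappa>) \<longlonglongrightarrow> (\<integral>x. indicator C x \<partial>\<kappa>)"
        using C cont lim range k(2)
        by (intro integral_dominated_convergence[where w="\<lambda>_. 1"])
          (auto simp: measurable_cong_sets[OF k(2) refl] intro!: borel_measurable_continuous_onI)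
      then show ?thesis using C k(2,3) by simp
    qed
    have "(\<lambda>k. \<integral>x. g k x \<partial>\<mu>) = (\<lambda>k. \<integral>x. g k x \<partial>\<nu>)"
      using eq[OF cont bdd] by auto
    with limint[OF m(3,1,2)] limint[OF n(3,1,2)] show ?thesis
      using LIMSEQ_unique by metis
  qed simp
  show ?thesis
  proof (rule measure_eqI_generator_eq[where E="{C. closed C}" and \<Omega>=UNIV and A="\<lambda>_. UNIV"])
    show "Int_stable {C::'b set. closed C}" by (auto simp: Int_stable_def)
    show "emeasure \<mu> X = emeasure \<nu> X" if "X \<in> {C. closed C}" for X
      using main[of X] that by (simp add: M.emeasure_eq_measure N.emeasure_eq_measure)
    show "sets \<mu> = sigma_sets UNIV {C. closed C}" "sets \<nu> = sigma_sets UNIV {C. closed C}"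
      using m n by (simp_all add: borel_eq_closed)
  qed auto
qed

text \<open>\<open>e\<close> is the largest \<open>k\<close>-Lipschitz function below
  \<open>g\<close>: an infimum of \<open>k\<close>-Lipschitz functions of \<open>x\<close> keeps the
  constant. The bound \<open>B\<close> makes the family bounded below, without which
  \<open>INF\<close> over the reals carries no information.\<close>

lemma pasch_envelope:
  fixes g :: "'b::metric_space \<Rightarrow> real" and k :: nat
  assumes bdd: "\<And>x. \<bar>g x\<bar> \<le> B"
  defines "e \<equiv> (\<lambda>x. INF y. g y + real k * dist x y)"
  shows "\<bar>e x\<bar> \<le> B" "\<bar>e x - e y\<bar> \<le> real k * dist x y" "e x \<le> g x"
proof -
  have bb: "bdd_below (range (\<lambda>y. g y + real k * dist x y))" for x
  proof (rule bdd_belowI2)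
    fix y show "- B \<le> g y + real k * dist x y"
      using bdd[of y] by (smt (verit) mult_nonneg_nonneg of_nat_0_le_iff zero_le_dist)
  qed
  have le: "e x \<le> g y + real k * dist x y" for x y
    unfolding e_def by (rule cINF_lower[OF bb]) simp
  show "e x \<le> g x" using le[of x x] by simp
  have ge: "- B \<le> e x" unfolding e_def
  proof (rule cINF_greatest)
    fix y show "- B \<le> g y + real k * dist x y"
      using bdd[of y] by (smt (verit) mult_nonneg_nonneg of_nat_0_le_iff zero_le_dist)
  qed simp
  show "\<bar>e x\<bar> \<le> B" using ge le[of x x] bdd[of x] by simp
  have "e x \<le> e y + real k * dist x y" for x y
  proof -
    have "e x - real k * dist x y \<le> e y"
      unfolding e_def
    proof (rule cINF_greatest)
      fix z
      have "real k * dist x z \<le> real k * dist x y + real k * dist y z"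
        using mult_left_mono[OF dist_triangle[of x z y], of "real k"] by (simp add: algebra_simps)
      then show "(INF y. g y + real k * dist x y) - real k * dist x y \<le> g z + real k * dist y z"
        using le[of x z] by (simp add: e_def)
    qed simp
    then show ?thesis by simp
  qed
  from this[of x y] this[of y x] show "\<bar>e x - e y\<bar> \<le> real k * dist x y"
    by (simp add: dist_commute abs_le_iff)
qed

text \<open>Only points near \<open>x\<close> can compete in the infimum: at distance
  \<open>d\<close> or more the penalty is at least \<open>k * d\<close>, which for large
  \<open>k\<close> exceeds the total oscillation \<open>2 * B\<close> of \<open>g\<close>.\<close>

lemma pasch_envelope_tendsto:
  fixes g :: "'b::metric_space \<Rightarrow> real"
  assumes bdd: "\<And>x. \<bar>g x\<bar> \<le> B" and cont: "continuous_on UNIV g"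
  shows "(\<lambda>k. INF y. g y + real k * dist x y) \<longlonglongrightarrow> g x"
proof (rule LIMSEQ_I)
  fix r :: real assume r: "r > 0"
  have "isCont g x" using cont by (simp add: continuous_on_eq_continuous_at)
  then obtain d where d: "d > 0" "\<And>y. dist y x < d \<Longrightarrow> dist (g y) (g x) < r/2"
    using r unfolding continuous_at_eps_delta by (meson half_gt_zero)
  obtain K where K: "real K * d > 2 * B" using reals_Archimedean3[OF d(1)] by blast
  have "norm ((INF y. g y + real k * dist x y) - g x) < r" if "k \<ge> K" for k
  proof -
    have "g x - r/2 \<le> (INF y. g y + real k * dist x y)"
    proof (rule cINF_greatest)
      fix y
      show "g x - r/2 \<le> g y + real k * dist x y"
      proof (cases "dist y x < d")
        case True
        from d(2)[OF this] have "g x - r/2 < g y" unfolding dist_real_def by linarith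
        moreover have "0 \<le> real k * dist x y" by simp
        ultimately show ?thesis by linarith
      next
        case False
        have "real K * d \<le> real k * dist x y"
          using that False d(1) by (intro mult_mono) (auto simp: dist_commute)
        then show ?thesis using K bdd[of x] bdd[of y] r by (simp add: abs_le_iff)
      qed
    qed simp
    then show ?thesis using pasch_envelope(3)[of g B k x, OF bdd] r by simp
  qed
  then show "\<exists>no. \<forall>n\<ge>no. norm ((INF y. g y + real n * dist x y) - g x) < r" by blast
qed

text \<open>A bounded continuous function is the pointwise increasing limit of its Lipschitz
  (Pasch--Hausdorff) envelopes, so that Lipschitz test functions give one half of narrow
  convergence, and the other half follows by applying this to \<open>- g\<close>.\<close>

lemma narrowly_converges_Lipschitz:
  fixes \<gamma> :: "'b::metric_space measure"
  assumes gn: "\<And>n. \<gamma>s n \<in> borel_prob_measures" and g: "\<gamma> \<in> borel_prob_measures"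
    and lip: "\<And>(g::'b \<Rightarrow> real) L B. (\<And>x y. \<bar>g x - g y\<bar> \<le> L * dist x y) \<Longrightarrow> (\<And>x. \<bar>g x\<bar> \<le> B) \<Longrightarrow>
       (\<lambda>n. \<integral>x. g x \<partial>\<gamma>s n) \<longlonglongrightarrow> (\<integral>x. g x \<partial>\<gamma>)"
  shows "narrowly_converges \<gamma>s \<gamma>"
  unfolding narrowly_converges_def
proof (intro allI impI)
  have integ: "integrable \<kappa> g" if "\<kappa> \<in> borel_prob_measures" "continuous_on UNIV g" "\<And>x. \<bar>g x\<bar> \<le> B"
    for \<kappa> and g :: "'b \<Rightarrow> real" and B
  proof -
    note k = borel_prob_measuresD[OF that(1)]
    interpret prob_space \<kappa> by (rule k)
    show ?thesis using that k
      by (intro integrable_const_bound[where B=B])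
        (auto simp: measurable_cong_sets[OF k(1) refl] intro!: borel_measurable_continuous_onI)
  qed
  have lower: "eventually (\<lambda>n. (\<integral>x. g x \<partial>\<gamma>) - r < (\<integral>x. g x \<partial>\<gamma>s n)) sequentially"
    if cont: "continuous_on UNIV g" and bd: "\<And>x. \<bar>g x\<bar> \<le> B" and r: "r > 0" for g :: "'b \<Rightarrow> real" and r B
  proof -
    define e where "e k x = (INF y. g y + real k * dist x y)" for k :: nat and x
    have e1: "\<bar>e k x\<bar> \<le> B" and e2: "\<bar>e k x - e k y\<bar> \<le> real k * dist x y" and e3: "e k x \<le> g x" for k x y
      using pasch_envelope[of g B, OF bd] unfolding e_def by auto
    have econt: "continuous_on UNIV (e k)" for k
      by (rule lipschitz_on_continuous_on[of "real k"], rule lipschitz_onI)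
        (use e2 in \<open>auto simp: dist_real_def\<close>)
    note k = borel_prob_measuresD[OF g]
    interpret prob_space \<gamma> by (rule k)
    have "(\<lambda>k. \<integral>x. e k x \<partial>\<gamma>) \<longlonglongrightarrow> (\<integral>x. g x \<partial>\<gamma>)"
    proof (intro integral_dominated_convergence[where w="\<lambda>_. B"])
      show "AE x in \<gamma>. (\<lambda>k. e k x) \<longlonglongrightarrow> g x"
        unfolding e_def using pasch_envelope_tendsto[of g B, OF bd cont] by auto
    qed (use econt cont e1 in \<open>auto simp: measurable_cong_sets[OF k(1) refl] intro!: borel_measurable_continuous_onI\<close>)
    then have "eventually (\<lambda>k. (\<integral>x. g x \<partial>\<gamma>) - r < (\<integral>x. e k x \<partial>\<gamma>)) sequentially"
      by (rule order_tendstoD) (use r in simp)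
    then obtain k where k: "(\<integral>x. g x \<partial>\<gamma>) - r < (\<integral>x. e k x \<partial>\<gamma>)"
      using eventually_happens by force
    have "(\<lambda>n. \<integral>x. e k x \<partial>\<gamma>s n) \<longlonglongrightarrow> (\<integral>x. e k x \<partial>\<gamma>)" by (rule lip[OF e2 e1])
    from order_tendstoD(1)[OF this k] show ?thesis
    proof eventually_elim
      case (elim n)
      have "(\<integral>x. e k x \<partial>\<gamma>s n) \<le> (\<integral>x. g x \<partial>\<gamma>s n)"
        by (intro integral_mono integ[OF gn econt e1] integ[OF gn cont bd] e3)
      with elim show ?case by simp
    qed
  qed
  fix g :: "'b \<Rightarrow> real" assume "continuous_on UNIV g \<and> bounded (range g)"
  then obtain B where cont: "continuous_on UNIV g" and B: "\<And>x. \<bar>g x\<bar> \<le> B"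
    by (auto simp: bounded_iff)
  show "(\<lambda>n. \<integral>x. g x \<partial>\<gamma>s n) \<longlonglongrightarrow> (\<integral>x. g x \<partial>\<gamma>)"
  proof (rule LIMSEQ_I)
    fix r :: real assume r: "r > 0"
    have "continuous_on UNIV (\<lambda>x. - g x)" "\<And>x. \<bar>- g x\<bar> \<le> B"
      using cont B by (auto intro: continuous_intros)
    from eventually_conj[OF lower[OF cont B r] lower[OF this r]]
    have "eventually (\<lambda>n. norm ((\<integral>x. g x \<partial>\<gamma>s n) - (\<integral>x. g x \<partial>\<gamma>)) < r) sequentially"
      by eventually_elim (simp add: abs_less_iff)
    then show "\<exists>no. \<forall>n\<ge>no. norm ((\<integral>x. g x \<partial>\<gamma>s n) - (\<integral>x. g x \<partial>\<gamma>)) < r"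
      by (simp add: eventually_sequentially)
  qed
qed

text \<open>No growth bound on \<open>e\<close> is available, so the index is slowed down:
  \<open>k n\<close> is the largest \<open>k \<le> n\<close> with
  \<open>\<tau> n * S k * k \<le> 1\<close>. Every fixed index is eventually admissible because
  \<open>\<tau>\<close> tends to zero, hence \<open>k\<close> tends to infinity; the constraint at
  \<open>k n\<close> itself bounds the product by \<open>1 / k n\<close>.\<close>

lemma slow_reparametrization:
  fixes \<tau> e :: "nat \<Rightarrow> real"
  assumes pos: "\<And>n. 0 < \<tau> n" and lim: "\<tau> \<longlonglongrightarrow> 0"
  obtains k where "filterlim k at_top sequentially" "(\<lambda>n. \<tau> n * e (k n)) \<longlonglongrightarrow> 0"
proof -
  define S where "S k = (\<Sum>i\<le>k. \<bar>e i\<bar>)" for k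
  have S: "\<bar>e k\<bar> \<le> S k" "0 \<le> S k" for k
    unfolding S_def by (auto intro!: sum_nonneg member_le_sum[of k "{..k}" "\<lambda>i. \<bar>e i\<bar>"])
  define A where "A n = {k. k \<le> n \<and> \<tau> n * S k * real k \<le> 1}" for n
  define k where "k n = Max (A n)" for n
  \<comment> \<open>Index 0 is always admissible, so the maximum exists.\<close>
  have fin: "finite (A n)" and ne: "A n \<noteq> {}" for n
    by (auto simp: A_def intro!: exI[of _ 0])
  have kA: "k n \<in> A n" for n unfolding k_def using fin ne by (rule Max_in)
  have top: "filterlim k at_top sequentially"
    unfolding filterlim_at_top
  proof
    fix K
    have "(\<lambda>n. \<tau> n * S K * real K) \<longlonglongrightarrow> 0 * S K * real K" by (intro tendsto_intros lim)
    then have "eventually (\<lambda>n. \<tau> n * S K * real K < 1) sequentially"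
      by (rule order_tendstoD) simp
    with eventually_ge_at_top[of K] show "eventually (\<lambda>n. K \<le> k n) sequentially"
      by eventually_elim (auto simp: k_def A_def intro!: Max_ge)
  qed
  have "(\<lambda>n. inverse (real (k n))) \<longlonglongrightarrow> 0"
    by (rule filterlim_compose[OF tendsto_inverse_0_at_top top, unfolded o_def], rule filterlim_real_sequentially)
  moreover have "eventually (\<lambda>n. norm (\<tau> n * e (k n)) \<le> inverse (real (k n))) sequentially"
    using top[unfolded filterlim_at_top, rule_format, of 1]
  proof eventually_elim
    case (elim n)
    then have "\<tau> n * S (k n) * real (k n) \<le> 1" "1 \<le> k n" using kA[of n] by (auto simp: A_def)
    then have bound: "\<tau> n * S (k n) \<le> inverse (real (k n))" by (simp add: field_simps)
    have "\<tau> n * \<bar>e (k n)\<bar> \<le> \<tau> n * S (k n)" using S pos[of n] by (intro mult_left_mono) auto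
    from order_trans[OF this bound] show ?case using pos[of n] by (simp add: abs_mult)
  qed
  ultimately have "(\<lambda>n. \<tau> n * e (k n)) \<longlonglongrightarrow> 0" by (rule Lim_null_comparison[rotated])
  with top show ?thesis by (rule that)
qed

section \<open>Entropy\<close>

lemma sets_PiM_borel:
  fixes M :: "'a::second_countable_topology measure"
  assumes "sets M = sets borel"
  shows "sets (Pi\<^sub>M UNIV (\<lambda>_::'n::countable. M)) = sets borel"
  using sets_PiM_cong[OF refl assms] sets_PiM_equal_borel by metis

lemma product_sigma_finite_const:
  "sigma_finite_measure M \<Longrightarrow> product_sigma_finite (\<lambda>_. M)"
  by (simp add: product_sigma_finite_def)

text \<open>Both sides agree on boxes, where Tonelli factorizes the integral. This converts
  densities relative to the product of the marginals into densities relative to the product of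
  \<open>m\<close>.\<close>

lemma PiM_density:
  fixes M :: "'a measure" and r :: "'a \<Rightarrow> ennreal"
  assumes sf: "sigma_finite_measure M" "sigma_finite_measure (density M r)"
    and r[measurable]: "r \<in> borel_measurable M"
  shows "Pi\<^sub>M UNIV (\<lambda>_::'n::finite. density M r) = density (Pi\<^sub>M UNIV (\<lambda>_. M)) (\<lambda>x. \<Prod>i\<in>UNIV. r (x i))"
proof -
  interpret M: product_sigma_finite "\<lambda>_::'n. M" by (rule product_sigma_finite_const) fact
  interpret D: product_sigma_finite "\<lambda>_::'n. density M r" by (rule product_sigma_finite_const) fact
  show ?thesis
  proof (rule D.PiM_eqI[symmetric])
    show "sets (density (Pi\<^sub>M UNIV (\<lambda>_::'n. M)) (\<lambda>x. \<Prod>i\<in>UNIV. r (x i))) = sets (Pi\<^sub>M UNIV (\<lambda>_. density M r))"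
      by (simp add: sets_PiM_cong[OF refl sets_density])
    fix A :: "'n \<Rightarrow> 'a set" assume "\<And>i. i \<in> UNIV \<Longrightarrow> A i \<in> sets (density M r)"
    then have A[measurable]: "A i \<in> sets M" for i by simp
    have "emeasure (density (Pi\<^sub>M UNIV (\<lambda>_. M)) (\<lambda>x. \<Prod>i\<in>UNIV. r (x i))) (Pi\<^sub>E UNIV A)
        = (\<integral>\<^sup>+x. (\<Prod>i\<in>UNIV. r (x i)) * indicator (Pi\<^sub>E UNIV A) x \<partial>Pi\<^sub>M UNIV (\<lambda>_. M))"
      by (rule emeasure_density) (auto intro!: sets_PiM_I_finite)
    also have "\<dots> = (\<integral>\<^sup>+x. (\<Prod>i\<in>UNIV. r (x i) * indicator (A i) (x i)) \<partial>Pi\<^sub>M UNIV (\<lambda>_. M))"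
    proof (rule nn_integral_cong)
      fix x :: "'n \<Rightarrow> 'a"
      have "indicator (Pi\<^sub>E UNIV A) x = (\<Prod>i\<in>UNIV. indicator (A i) (x i) :: ennreal)"
        by (cases "x \<in> Pi\<^sub>E UNIV A") (auto simp: PiE_UNIV_domain Pi_iff indicator_def)
      then show "(\<Prod>i\<in>UNIV. r (x i)) * indicator (Pi\<^sub>E UNIV A) x = (\<Prod>i\<in>UNIV. r (x i) * indicator (A i) (x i))"
        by (simp add: prod.distrib)
    qed
    also have "\<dots> = (\<Prod>i\<in>UNIV. \<integral>\<^sup>+t. r t * indicator (A i) t \<partial>M)"
      by (rule M.product_nn_integral_prod) auto
    also have "\<dots> = (\<Prod>i\<in>UNIV. emeasure (density M r) (A i))"
      by (simp add: emeasure_density)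
    finally show "emeasure (density (Pi\<^sub>M UNIV (\<lambda>_. M)) (\<lambda>x. \<Prod>i\<in>UNIV. r (x i))) (Pi\<^sub>E UNIV A) = \<dots>" .
  qed simp
qed

section \<open>Extended-real integrals and an elementary bound for \<open>u * ln u\<close>\<close>

lemma ereal_integral_cong_AE:
  "AE x in M. f x = g x \<Longrightarrow> ereal_integral M f = ereal_integral M g"
  unfolding ereal_integral_def
  by (intro arg_cong2[where f="(-)"] arg_cong[where f=enn2ereal] nn_integral_cong_AE; elim AE_mp; simp)

lemma ereal_integral_eq_integral:
  assumes "integrable M \<phi>"
  shows "ereal_integral M (\<lambda>x. ereal (\<phi> x)) = ereal (\<integral>x. \<phi> x \<partial>M)"
proof -
  have "(\<integral>\<^sup>+x. ennreal (\<phi> x) \<partial>M) \<noteq> \<infinity>" "(\<integral>\<^sup>+x. ennreal (- \<phi> x) \<partial>M) \<noteq> \<infinity>"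
    using assms by (auto simp: real_integrable_def)
  then show ?thesis
    unfolding ereal_integral_def real_lebesgue_integral_def[OF assms]
    by (cases "\<integral>\<^sup>+x. ennreal (\<phi> x) \<partial>M"; cases "\<integral>\<^sup>+x. ennreal (- \<phi> x) \<partial>M")
      (auto simp: enn2ereal_ennreal)
qed

text \<open>A finite bound on the negative part alone is enough: it excludes
  \<open>\<infinity> - \<infinity>\<close>, and the positive part may be infinite.\<close>

lemma ereal_integral_ge:
  assumes "(\<integral>\<^sup>+x. e2ennreal (- g x) \<partial>M) \<le> ennreal K" "0 \<le> K"
  shows "ereal (- K) \<le> ereal_integral M g"
proof -
  have "enn2ereal (\<integral>\<^sup>+x. e2ennreal (- g x) \<partial>M) \<le> ereal K"
    using assms by (metis enn2ereal_ennreal less_eq_ennreal.rep_eq)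
  then have "- ereal K \<le> - enn2ereal (\<integral>\<^sup>+x. e2ennreal (- g x) \<partial>M)"
    by (simp only: ereal_minus_le_minus)
  also have "\<dots> \<le> enn2ereal (\<integral>\<^sup>+x. e2ennreal (g x) \<partial>M) + - enn2ereal (\<integral>\<^sup>+x. e2ennreal (- g x) \<partial>M)"
    using add_right_mono[OF enn2ereal_nonneg] by fastforce
  finally show ?thesis by (simp add: ereal_integral_def minus_ereal_def)
qed

text \<open>Using \<open>ln v \<le> v - 1\<close> at \<open>v = u\<close> and at
  \<open>v = 1 / u\<close> squeezes \<open>u * ln u\<close> between \<open>u - 1\<close> and
  \<open>u * u - u\<close>.\<close>

lemma abs_mult_ln_le:
  fixes u :: real
  assumes "0 \<le> u" "u \<le> C"
  shows "\<bar>u * ln u\<bar> \<le> 1 + C\<^sup>2"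
proof (cases "u = 0")
  case False
  then have u: "u > 0" using assms by simp
  have "ln u \<le> u - 1" using u by (rule ln_le_minus_one)
  then have "u * ln u \<le> u * (u - 1)" using u by (intro mult_left_mono) auto
  moreover have "- ln u \<le> 1 / u - 1" using ln_le_minus_one[of "1/u"] u by (simp add: ln_div)
  then have "u * (- ln u) \<le> u * (1 / u - 1)" using u by (intro mult_left_mono) auto
  ultimately have "u * ln u \<le> u * u - u" "- (u * ln u) \<le> 1 - u" using u by (auto simp: algebra_simps)
  moreover have "u * u \<le> C\<^sup>2" using assms by (simp add: power2_eq_square mult_mono)
  ultimately show ?thesis using assms zero_le_power2[of C] by (intro abs_leI) linarith+
qed simp

section \<open>Functions of a single coordinate under a coupling\<close>

lemma couplings_component:
  fixes \<gamma> :: "('n::finite \<Rightarrow> 'a::second_countable_topology) measure"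
  assumes g: "\<gamma> \<in> couplings \<mu>" and P: "AE t in \<mu>. P t"
  shows "AE x in \<gamma>. P (x i)"
proof -
  have b: "\<gamma> \<in> borel_prob_measures" and d: "distr \<gamma> borel (\<lambda>x. x i) = \<mu>"
    using g by (auto simp: couplings_def)
  have "(\<lambda>x. x i) \<in> measurable \<gamma> borel"
    using borel_prob_measuresD(1)[OF b] measurable_product_coordinates
    by (metis measurable_cong_sets)
  then show ?thesis using P by (subst (asm) d[symmetric]) (rule AE_distrD)
qed

lemma couplings_integral:
  fixes \<gamma> :: "('n::finite \<Rightarrow> 'a::second_countable_topology) measure"
  assumes g: "\<gamma> \<in> couplings \<mu>"
  shows "\<phi> \<in> borel_measurable borel \<Longrightarrow> (\<integral>\<^sup>+x. \<phi> (x i) \<partial>\<gamma>) = (\<integral>\<^sup>+t. \<phi> t \<partial>\<mu>)"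
    and "\<psi> \<in> borel_measurable borel \<Longrightarrow> integrable \<gamma> (\<lambda>x. \<psi> (x i)) \<longleftrightarrow> integrable \<mu> (\<psi> :: 'a \<Rightarrow> real)"
    and "\<psi> \<in> borel_measurable borel \<Longrightarrow> (\<integral>x. \<psi> (x i) \<partial>\<gamma>) = (\<integral>t. \<psi> t \<partial>\<mu>)"
proof -
  have b: "\<gamma> \<in> borel_prob_measures" and d: "\<mu> = distr \<gamma> borel (\<lambda>x. x i)"
    using g by (auto simp: couplings_def)
  have m: "(\<lambda>x. x i) \<in> measurable \<gamma> borel"
    using borel_prob_measuresD(1)[OF b] measurable_product_coordinates
    by (metis measurable_cong_sets)
  show "(\<integral>\<^sup>+x. \<phi> (x i) \<partial>\<gamma>) = (\<integral>\<^sup>+t. \<phi> t \<partial>\<mu>)" if "\<phi> \<in> borel_measurable borel"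
    unfolding d using that m by (subst nn_integral_distr) auto
  show "integrable \<gamma> (\<lambda>x. \<psi> (x i)) \<longleftrightarrow> integrable \<mu> \<psi>" if "\<psi> \<in> borel_measurable borel"
    unfolding d using that m by (subst integrable_distr_eq) auto
  show "(\<integral>x. \<psi> (x i) \<partial>\<gamma>) = (\<integral>t. \<psi> t \<partial>\<mu>)" if "\<psi> \<in> borel_measurable borel"
    unfolding d using that m by (subst integral_distr) auto
qed

section \<open>Lower bound and finiteness of the entropy\<close>

locale entropy_density =
  fixes m :: "'a::polish_space measure" and \<rho> :: "'a \<Rightarrow> real"
  assumes m_borel: "sets m = sets borel"
    and m_sigma_finite: "sigma_finite_measure m"
    and rho_measurable: "\<rho> \<in> borel_measurable borel"
    and rho_nonneg: "\<And>x. 0 \<le> \<rho> x"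
    and rho_prob: "prob_space (density m (\<lambda>x. ennreal (\<rho> x)))"
    and rho_log_rho: "integrable m (\<lambda>x. \<rho> x * ln (\<rho> x))"
begin

abbreviation "\<mu> \<equiv> density m (\<lambda>x. ennreal (\<rho> x))"

lemma rho_measurable_m [measurable]: "\<rho> \<in> borel_measurable m"
  using rho_measurable measurable_cong_sets[OF m_borel refl] by metis

text \<open>The weight \<open>\<rho>\<close> is absorbed into \<open>\<mu>\<close>.\<close>

lemma integrable_ln_rho: "integrable \<mu> (\<lambda>x. ln (\<rho> x))"
  using rho_log_rho rho_nonneg by (subst integrable_density) auto

text \<open>The negative part of \<open>t * ln t\<close> is dominated by \<open>h\<close>, of
  integral 1, plus \<open>t\<close> times the sum of \<open>|ln \<rho>|\<close> over the
  coordinates. Integrated against the coupling, each summand sees only its own marginal, so the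
  constant is the same for all couplings.\<close>

lemma rel_entropy_bounded_below:
  fixes \<gamma> :: "('n::finite \<Rightarrow> 'a) measure"
  assumes g: "\<gamma> \<in> couplings \<mu>"
  shows "ereal (- (1 + real CARD('n) * (\<integral>t. \<bar>ln (\<rho> t)\<bar> \<partial>\<mu>))) \<le> rel_entropy m \<gamma>"
proof (cases "absolutely_continuous (Pi\<^sub>M UNIV (\<lambda>_::'n. m)) \<gamma>")
  case False
  then show ?thesis by (simp add: rel_entropy_def Let_def)
next
  case ac: True
  define mN where "mN = Pi\<^sub>M UNIV (\<lambda>_::'n. m)"
  define h where "h x = (\<Prod>i\<in>UNIV. \<rho> (x i))" for x :: "'n \<Rightarrow> 'a"
  define t where "t x = enn2real (RN_deriv mN \<gamma> x)" for x
  define L where "L = (\<integral>t. \<bar>ln (\<rho> t)\<bar> \<partial>\<mu>)"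
  have b: "\<gamma> \<in> borel_prob_measures" using g by (simp add: couplings_def)
  note gD = borel_prob_measuresD[OF b]
  have smN: "sets mN = sets borel" unfolding mN_def by (rule sets_PiM_borel[OF m_borel])
  interpret product_sigma_finite "\<lambda>_::'n. m" by (rule product_sigma_finite_const[OF m_sigma_finite])
  interpret mN: sigma_finite_measure mN unfolding mN_def by (rule sigma_finite) simp
  interpret mu: prob_space \<mu> by (rule rho_prob)
  have comp[measurable]: "(\<lambda>x::'n\<Rightarrow>'a. x i) \<in> measurable mN m" for i unfolding mN_def by simp
  have [measurable]: "h \<in> borel_measurable mN" unfolding h_def by measurable
  have hpos: "0 \<le> h x" for x unfolding h_def by (intro prod_nonneg) (simp add: rho_nonneg)
  have [measurable]: "t \<in> borel_measurable mN" unfolding t_def by measurable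
  have dens: "density mN (RN_deriv mN \<gamma>) = \<gamma>"
    using ac smN gD(1) by (intro mN.density_RN_deriv) (auto simp: mN_def)
  have rho_pos: "AE s in \<mu>. \<rho> s \<noteq> 0"
    by (subst AE_density) (auto simp: rho_measurable_m)
  \<comment> \<open>Points with \<open>t > 0\<close> and \<open>h = 0\<close> have to be excluded:
    there the logarithm of \<open>h\<close> would be a default value and the pointwise inequality
    could fail.\<close>
  have "AE x in \<gamma>. h x \<noteq> 0"
  proof -
    have "AE x in \<gamma>. \<forall>i\<in>UNIV. \<rho> (x i) \<noteq> 0"
      by (intro AE_finite_allI couplings_component[OF g rho_pos]) auto
    then show ?thesis by (auto simp: h_def)
  qed
  then have hnz: "AE x in mN. t x > 0 \<longrightarrow> h x \<noteq> 0"
  proof -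
    assume "AE x in \<gamma>. h x \<noteq> 0"
    then have "AE x in density mN (RN_deriv mN \<gamma>). h x \<noteq> 0" by (subst dens)
    then have "AE x in mN. RN_deriv mN \<gamma> x > 0 \<longrightarrow> h x \<noteq> 0" by (subst (asm) AE_density) auto
    then show ?thesis
      by (rule AE_mp) (auto simp: t_def enn2real_positive_iff)
  qed
  have ineq: "AE x in mN. ennreal (- (t x * ln (t x))) \<le> ennreal (h x) + ennreal (t x) * (\<Sum>i\<in>UNIV. ennreal \<bar>ln (\<rho> (x i))\<bar>)"
    using hnz
  proof eventually_elim
    case (elim x)
    have t0: "0 \<le> t x" by (simp add: t_def)
    show ?case
    proof (cases "t x = 0")
      case False
      then have tp: "t x > 0" using t0 by simp
      then have hp: "h x > 0" using elim hpos[of x] by simp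
      \<comment> \<open>This is \<open>ln v \<le> v - 1\<close> at \<open>v = h / t\<close>. After
        multiplication by \<open>t\<close> the term \<open>- t\<close> is dropped further
        down.\<close>
      have "ln (h x / t x) \<le> h x / t x - 1" using tp hp by (intro ln_le_minus_one) simp
      then have "t x * ln (h x / t x) \<le> t x * (h x / t x - 1)" using tp by (intro mult_left_mono) auto
      then have 1: "t x * (ln (h x) - ln (t x)) \<le> h x - t x" using tp hp by (simp add: ln_div algebra_simps)
      have nz: "\<rho> (x i) \<noteq> 0" for i using hp prod_zero[of UNIV "\<lambda>i. \<rho> (x i)"] by (fastforce simp: h_def)
      have "ln (h x) = (\<Sum>i\<in>UNIV. ln (\<rho> (x i)))"
        unfolding h_def using nz rho_nonneg by (subst ln_prod) (auto simp: order_less_le)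
      then have "\<bar>ln (h x)\<bar> \<le> (\<Sum>i\<in>UNIV. \<bar>ln (\<rho> (x i))\<bar>)" by (simp add: sum_abs)
      then have "t x * (- ln (h x)) \<le> t x * (\<Sum>i\<in>UNIV. \<bar>ln (\<rho> (x i))\<bar>)"
        using t0 by (intro mult_left_mono) auto
      with 1 have "- (t x * ln (t x)) \<le> h x + t x * (\<Sum>i\<in>UNIV. \<bar>ln (\<rho> (x i))\<bar>)"
        using t0 by (simp add: algebra_simps)
      then have "ennreal (- (t x * ln (t x))) \<le> ennreal (h x + t x * (\<Sum>i\<in>UNIV. \<bar>ln (\<rho> (x i))\<bar>))"
        by (rule ennreal_leI)
      also have "\<dots> = ennreal (h x) + ennreal (t x) * (\<Sum>i\<in>UNIV. ennreal \<bar>ln (\<rho> (x i))\<bar>)"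
        using t0 hpos[of x] by (simp add: ennreal_plus sum_nonneg ennreal_mult sum_ennreal)
      finally show ?thesis .
    qed simp
  qed
  have inth: "(\<integral>\<^sup>+x. ennreal (h x) \<partial>mN) = 1"
  proof -
    have "(\<integral>\<^sup>+x. ennreal (h x) \<partial>mN) = (\<integral>\<^sup>+x. (\<Prod>i\<in>UNIV. ennreal (\<rho> (x i))) \<partial>mN)"
      unfolding h_def by (simp add: prod_ennreal rho_nonneg)
    also have "\<dots> = (\<Prod>i\<in>(UNIV::'n set). \<integral>\<^sup>+s. ennreal (\<rho> s) \<partial>m)"
      unfolding mN_def by (rule product_nn_integral_prod) auto
    also have "(\<integral>\<^sup>+s. ennreal (\<rho> s) \<partial>m) = 1"
      using mu.emeasure_space_1 by (simp add: emeasure_density nn_integral_indicator cong: nn_integral_cong)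
    finally show ?thesis by simp
  qed
  have "(\<integral>\<^sup>+x. ennreal (- (t x * ln (t x))) \<partial>mN)
      \<le> (\<integral>\<^sup>+x. ennreal (h x) + ennreal (t x) * (\<Sum>i\<in>UNIV. ennreal \<bar>ln (\<rho> (x i))\<bar>) \<partial>mN)"
    by (rule nn_integral_mono_AE[OF ineq])
  also have "\<dots> = 1 + (\<integral>\<^sup>+x. ennreal (t x) * (\<Sum>i\<in>UNIV. ennreal \<bar>ln (\<rho> (x i))\<bar>) \<partial>mN)"
    by (subst nn_integral_add) (auto simp: inth)
  \<comment> \<open>\<open>t\<close> is the real part of the Radon-Nikodym derivative and hence at
    most the derivative, so no finiteness has to be shown; the derivative itself turns the integral
    into one against \<open>\<gamma>\<close>.\<close>
  also have "(\<integral>\<^sup>+x. ennreal (t x) * (\<Sum>i\<in>UNIV. ennreal \<bar>ln (\<rho> (x i))\<bar>) \<partial>mN)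
     \<le> (\<integral>\<^sup>+x. RN_deriv mN \<gamma> x * (\<Sum>i\<in>UNIV. ennreal \<bar>ln (\<rho> (x i))\<bar>) \<partial>mN)"
  proof (intro nn_integral_mono mult_right_mono)
    show "ennreal (t x) \<le> RN_deriv mN \<gamma> x" for x
      unfolding t_def by (cases "RN_deriv mN \<gamma> x") auto
  qed simp
  also have "\<dots> = (\<integral>\<^sup>+x. (\<Sum>i\<in>UNIV. ennreal \<bar>ln (\<rho> (x i))\<bar>) \<partial>\<gamma>)"
    by (subst (2) dens[symmetric], subst nn_integral_density) auto
  also have "\<dots> = (\<Sum>i\<in>(UNIV::'n set). \<integral>\<^sup>+x. ennreal \<bar>ln (\<rho> (x i))\<bar> \<partial>\<gamma>)"
  proof (rule nn_integral_sum)
    fix i :: 'n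
    have "(\<lambda>x::'n\<Rightarrow>'a. ennreal \<bar>ln (\<rho> (x i))\<bar>) \<in> borel_measurable mN" by measurable
    then show "(\<lambda>x. ennreal \<bar>ln (\<rho> (x i))\<bar>) \<in> borel_measurable \<gamma>" using smN gD(1) by (metis measurable_cong_sets)
  qed
  also have "\<dots> = of_nat CARD('n) * (\<integral>\<^sup>+s. ennreal \<bar>ln (\<rho> s)\<bar> \<partial>\<mu>)"
    using rho_measurable by (subst couplings_integral(1)[OF g, of "\<lambda>s. ennreal \<bar>ln (\<rho> s)\<bar>"]) auto
  also have "(\<integral>\<^sup>+s. ennreal \<bar>ln (\<rho> s)\<bar> \<partial>\<mu>) = ennreal L"
    unfolding L_def using integrable_ln_rho by (intro nn_integral_eq_integral) auto
  also have "1 + of_nat CARD('n) * ennreal L = ennreal (1 + real CARD('n) * L)"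
    unfolding L_def by (subst ennreal_plus) (auto simp: ennreal_mult ennreal_of_nat_eq_real_of_nat)
  finally have fin: "(\<integral>\<^sup>+x. ennreal (- (t x * ln (t x))) \<partial>mN) \<le> ennreal (1 + real CARD('n) * L)"
    by (simp add: add_left_mono)
  have "ereal (- (1 + real CARD('n) * L)) \<le> ereal_integral mN (\<lambda>x. ereal (t x * ln (t x)))"
    by (rule ereal_integral_ge) (use fin in \<open>auto simp: L_def\<close>)
  then show ?thesis using ac by (simp add: rel_entropy_def Let_def t_def mN_def L_def)
qed

text \<open>Relative to the product of \<open>m\<close> the density is \<open>h * U\<close>, whose
  logarithm splits into \<open>ln U\<close> and the sum of the \<open>ln (\<rho> (x i))\<close>.
  With \<open>U\<close> bounded, \<open>U * ln U\<close> is bounded and the rest is dominated by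
  integrable functions of single coordinates. No size of the value is recorded, since it will be
  multiplied by a vanishing \<open>\<tau>\<close>.\<close>

lemma rel_entropy_bounded_density:
  fixes \<eta> :: "('n::finite \<Rightarrow> 'a) measure"
  assumes U: "U \<in> borel_measurable borel" and U0: "\<And>x. 0 \<le> U x" and UC: "\<And>x. U x \<le> C"
    and eta: "\<eta> = density (Pi\<^sub>M UNIV (\<lambda>_. \<mu>)) (\<lambda>x. ennreal (U x))"
  shows "\<exists>e. rel_entropy m \<eta> = ereal e"
proof -
  define mN where "mN = Pi\<^sub>M UNIV (\<lambda>_::'n. m)"
  define h where "h x = (\<Prod>i\<in>UNIV. \<rho> (x i))" for x :: "'n \<Rightarrow> 'a"
  define W where "W x = U x * ln (U x) + U x * (\<Sum>i\<in>UNIV. ln (\<rho> (x i)))" for x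
  have smN: "sets mN = sets borel" unfolding mN_def by (rule sets_PiM_borel[OF m_borel])
  interpret mu: prob_space \<mu> by (rule rho_prob)
  interpret product_sigma_finite "\<lambda>_::'n. m" by (rule product_sigma_finite_const[OF m_sigma_finite])
  interpret mN: sigma_finite_measure mN unfolding mN_def by (rule sigma_finite) simp
  have comp[measurable]: "(\<lambda>x::'n\<Rightarrow>'a. x i) \<in> measurable mN m" for i unfolding mN_def by simp
  have [measurable]: "h \<in> borel_measurable mN" unfolding h_def by measurable
  have hpos: "0 \<le> h x" for x unfolding h_def by (intro prod_nonneg) (simp add: rho_nonneg)
  have Um[measurable]: "U \<in> borel_measurable mN" using U smN by (metis measurable_cong_sets)
  have Wm[measurable]: "W \<in> borel_measurable mN" unfolding W_def by measurable
  have muN: "Pi\<^sub>M UNIV (\<lambda>_::'n. \<mu>) = density mN (\<lambda>x. ennreal (h x))"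
    unfolding mN_def h_def
    by (subst PiM_density) (auto simp: m_sigma_finite mu.sigma_finite_measure_axioms prod_ennreal rho_nonneg)
  interpret muN: prob_space "Pi\<^sub>M UNIV (\<lambda>_::'n. \<mu>)" by (intro prob_space_PiM rho_prob)
  have eq: "\<eta> = density mN (\<lambda>x. ennreal (h x * U x))"
    unfolding eta muN by (subst density_density_eq) (auto simp: ennreal_mult hpos U0)
  have ac: "absolutely_continuous mN \<eta>" unfolding eq by (rule absolutely_continuousI_density) measurable
  have RN: "AE x in mN. ennreal (h x * U x) = RN_deriv mN \<eta> x"
    by (rule mN.RN_deriv_unique) (auto simp: eq)
  have C0: "0 \<le> C" using U0 UC order_trans by blast
  \<comment> \<open>Where \<open>h\<close> or \<open>U\<close> is zero both sides vanish, by the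
    convention \<open>0 * ln 0 = 0\<close>.\<close>
  have tlnt: "h x * U x * ln (h x * U x) = h x * W x" for x
  proof (cases "h x = 0 \<or> U x = 0")
    case False
    then have p: "h x > 0" "U x > 0" using hpos[of x] U0[of x] by auto
    have nz: "\<rho> (x i) \<noteq> 0" for i using p prod_zero[of UNIV "\<lambda>i. \<rho> (x i)"] by (fastforce simp: h_def)
    have "ln (h x) = (\<Sum>i\<in>UNIV. ln (\<rho> (x i)))"
      unfolding h_def using nz rho_nonneg by (subst ln_prod) (auto simp: order_less_le)
    then show ?thesis using p by (simp add: W_def ln_mult algebra_simps)
  qed (auto simp: W_def)
  have "integrable (Pi\<^sub>M UNIV (\<lambda>_::'n. \<mu>)) W"
  proof (rule Bochner_Integration.integrable_bound)
    show "integrable (Pi\<^sub>M UNIV (\<lambda>_::'n. \<mu>)) (\<lambda>x. 1 + C\<^sup>2 + C * (\<Sum>i\<in>UNIV. \<bar>ln (\<rho> (x i))\<bar>))"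
    proof (intro Bochner_Integration.integrable_add Bochner_Integration.integrable_mult_right
          Bochner_Integration.integrable_sum)
      fix i :: 'n
      have d: "distr (Pi\<^sub>M UNIV (\<lambda>_::'n. \<mu>)) \<mu> (\<lambda>x. x i) = \<mu>"
        by (rule distr_PiM_component) (auto simp: rho_prob)
      have "integrable (distr (Pi\<^sub>M UNIV (\<lambda>_::'n. \<mu>)) \<mu> (\<lambda>x. x i)) (\<lambda>t. \<bar>ln (\<rho> t)\<bar>)"
        unfolding d using integrable_ln_rho by auto
      then show "integrable (Pi\<^sub>M UNIV (\<lambda>_::'n. \<mu>)) (\<lambda>x. \<bar>ln (\<rho> (x i))\<bar>)"
        by (rule integrable_distr[rotated]) (use comp in \<open>simp add: muN\<close>)
    qed auto
    show "W \<in> borel_measurable (Pi\<^sub>M UNIV (\<lambda>_. \<mu>))" unfolding muN by simp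
    show "AE x in Pi\<^sub>M UNIV (\<lambda>_. \<mu>). norm (W x) \<le> norm (1 + C\<^sup>2 + C * (\<Sum>i\<in>UNIV. \<bar>ln (\<rho> (x i))\<bar>))"
    proof (intro AE_I2)
      fix x
      have "\<bar>W x\<bar> \<le> \<bar>U x * ln (U x)\<bar> + U x * \<bar>\<Sum>i\<in>UNIV. ln (\<rho> (x i))\<bar>"
        unfolding W_def using abs_triangle_ineq[of "U x * ln (U x)" "U x * (\<Sum>i\<in>UNIV. ln (\<rho> (x i)))"] U0[of x] by (simp add: abs_mult)
      also have "\<dots> \<le> (1 + C\<^sup>2) + C * (\<Sum>i\<in>UNIV. \<bar>ln (\<rho> (x i))\<bar>)"
        by (intro add_mono mult_mono abs_mult_ln_le U0 UC sum_abs C0) auto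
      finally show "norm (W x) \<le> norm (1 + C\<^sup>2 + C * (\<Sum>i\<in>UNIV. \<bar>ln (\<rho> (x i))\<bar>))" by simp
    qed
  qed
  then have "integrable mN (\<lambda>x. h x * W x)"
    unfolding muN by (subst (asm) integrable_density) (auto simp: hpos)
  then have int: "integrable mN (\<lambda>x. h x * U x * ln (h x * U x))" by (simp add: tlnt)
  have "rel_entropy m \<eta> = ereal_integral mN (\<lambda>x. ereal (enn2real (RN_deriv mN \<eta> x) * ln (enn2real (RN_deriv mN \<eta> x))))"
    using ac by (simp add: rel_entropy_def mN_def Let_def)
  also have "\<dots> = ereal_integral mN (\<lambda>x. ereal (h x * U x * ln (h x * U x)))"
    by (rule ereal_integral_cong_AE, rule AE_mp[OF RN], rule AE_I2)
      (metis enn2real_ennreal hpos U0 mult_nonneg_nonneg)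
  also have "\<dots> = ereal (\<integral>x. h x * U x * ln (h x * U x) \<partial>mN)"
    by (rule ereal_integral_eq_integral[OF int])
  finally show ?thesis by blast
qed

end

section \<open>Mixtures of product measures\<close>

definition product_density :: "'a measure \<Rightarrow> ('n::finite \<Rightarrow> 'a \<Rightarrow> real) \<Rightarrow> ('n \<Rightarrow> 'a) measure" where
  "product_density M u = density (Pi\<^sub>M UNIV (\<lambda>_. M)) (\<lambda>x. ennreal (\<Prod>i\<in>UNIV. u i (x i)))"

locale borel_prob = prob_space M for M :: "'a::polish_space measure" +
  assumes M_borel: "sets M = sets borel"
begin

lemma M_space [simp]: "space M = UNIV"
  using sets_eq_imp_space_eq[OF M_borel] by simp

lemma M_measurable [simp]: "f \<in> measurable M N \<longleftrightarrow> f \<in> measurable borel N"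
  using measurable_cong_sets[OF M_borel refl] by auto

lemma PiM_M_borel: "sets (Pi\<^sub>M UNIV (\<lambda>_::'n::countable. M)) = sets borel"
  by (rule sets_PiM_borel[OF M_borel])

lemma PiM_M_measurable:
  "f \<in> measurable (Pi\<^sub>M UNIV (\<lambda>_::'n::countable. M)) N \<longleftrightarrow> f \<in> measurable borel N"
  using measurable_cong_sets[OF PiM_M_borel refl] by auto

text \<open>Restricting a coupling to \<open>D\<close> and projecting gives a measure below
  \<open>M\<close>, hence a density relative to \<open>M\<close> that is at most 1 almost
  everywhere. This bound is the source of all bounded densities below. The density is corrected on a
  null set so that bound and support hold at every point.\<close>

lemma marginal_density:
  fixes \<gamma> :: "('n::finite \<Rightarrow> 'a) measure"
  assumes g: "\<gamma> \<in> couplings M" and D: "D \<in> sets borel" and S: "S \<in> sets borel"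
    and DS: "\<And>x. x \<in> D \<Longrightarrow> x i \<in> S"
  shows "\<exists>v. v \<in> borel_measurable borel \<and> (\<forall>t. 0 \<le> v t) \<and> (\<forall>t. v t \<le> 1) \<and> (\<forall>t. t \<notin> S \<longrightarrow> v t = 0) \<and>
    (\<forall>A\<in>sets borel. (\<integral>\<^sup>+t. ennreal (v t) * indicator A t \<partial>M) = ennreal (measure \<gamma> (D \<inter> {x. x i \<in> A})))"
proof -
  have b: "\<gamma> \<in> borel_prob_measures" and d: "M = distr \<gamma> borel (\<lambda>x. x i)"
    using g by (auto simp: couplings_def)
  note gD = borel_prob_measuresD[OF b]
  interpret G: prob_space \<gamma> by (rule gD)
  have comp: "(\<lambda>x. x i) \<in> measurable \<gamma> borel"
    using gD(1) measurable_product_coordinates by (metis measurable_cong_sets)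
  have pre: "{x. x i \<in> A} \<in> sets \<gamma>" if "A \<in> sets borel" for A
    using measurable_sets[OF comp that] by (simp add: vimage_def gD)
  have Dg: "D \<in> sets \<gamma>" using D gD by simp
  define \<kappa> where "\<kappa> = distr (density \<gamma> (indicator D)) borel (\<lambda>x. x i)"
  have ksets: "sets \<kappa> = sets M" by (simp add: \<kappa>_def M_borel)
  have kem: "emeasure \<kappa> A = emeasure \<gamma> (D \<inter> {x. x i \<in> A})" if "A \<in> sets borel" for A
  proof -
    have "emeasure \<kappa> A = emeasure (density \<gamma> (indicator D)) {x. x i \<in> A}"
      unfolding \<kappa>_def using comp that by (subst emeasure_distr) (auto simp: vimage_def gD)
    also have "\<dots> = emeasure \<gamma> (D \<inter> {x. x i \<in> A})"
      using pre[OF that] Dg by (subst emeasure_density) (auto simp: indicator_inter_arith[symmetric])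
    finally show ?thesis .
  qed
  have Mem: "emeasure M A = emeasure \<gamma> {x. x i \<in> A}" if "A \<in> sets borel" for A
    using comp that by (subst d, subst emeasure_distr) (auto simp: vimage_def gD)
  have le: "emeasure \<kappa> A \<le> emeasure M A" if "A \<in> sets borel" for A
    unfolding kem[OF that] Mem[OF that] using pre[OF that] by (intro emeasure_mono) auto
  have ac: "absolutely_continuous M \<kappa>"
    unfolding absolutely_continuous_def
  proof
    fix A assume "A \<in> null_sets M"
    then show "A \<in> null_sets \<kappa>" using le[of A] ksets by (auto simp: null_sets_def M_borel)
  qed
  define v0 where "v0 = RN_deriv M \<kappa>"
  have v0m: "v0 \<in> borel_measurable M" by (simp add: v0_def del: M_measurable)
  then have v0b: "v0 \<in> borel_measurable borel" by simp
  have dens: "density M v0 = \<kappa>" unfolding v0_def by (rule density_RN_deriv[OF ac ksets])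
  \<comment> \<open>On the set \<open>A\<close> where \<open>v0\<close> is at least
    \<open>c = 1 + 1 / (k + 1)\<close> one has \<open>c * M A \<le> \<kappa> A \<le> M A\<close>, so
    \<open>A\<close> is null; letting \<open>k\<close> grow gives \<open>v0 \<le> 1\<close>.\<close>
  have "AE t in M. v0 t < 1 + ennreal (1 / real (Suc k))" for k
  proof -
    define c where "c = 1 + 1 / real (Suc k)"
    have ec: "1 + ennreal (1 / real (Suc k)) = ennreal c" unfolding c_def by (simp flip: ennreal_1 ennreal_plus)
    define A where "A = {t. ennreal c \<le> v0 t}"
    have A: "A \<in> sets borel" unfolding A_def using v0b by measurable
    have "ennreal c * emeasure M A = (\<integral>\<^sup>+t. ennreal c * indicator A t \<partial>M)"
      using A by (simp add: nn_integral_cmult_indicator M_borel)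
    also have "\<dots> \<le> (\<integral>\<^sup>+t. v0 t * indicator A t \<partial>M)"
      by (intro nn_integral_mono) (auto simp: A_def indicator_def)
    also have "\<dots> = emeasure \<kappa> A"
      using A v0m by (subst dens[symmetric], subst emeasure_density) (auto simp: M_borel)
    also have "\<dots> \<le> emeasure M A" by (rule le[OF A])
    finally have "ennreal (c * prob A) \<le> ennreal (prob A)"
      by (simp add: emeasure_eq_measure ennreal_mult' c_def)
    then have "c * prob A \<le> prob A" by (simp add: ennreal_le_iff)
    then have "prob A = 0" using measure_nonneg[of M A] by (auto simp: c_def algebra_simps mult_le_0_iff field_simps)
    then have "A \<in> null_sets M" using A by (auto simp: null_sets_def emeasure_eq_measure M_borel)
    then have "AE t in M. t \<notin> A" by (rule AE_not_in)
    then have "AE t in M. v0 t < ennreal c" by (rule AE_mp) (auto simp: A_def not_le)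
    then show ?thesis unfolding ec .
  qed
  then have "AE t in M. \<forall>k. v0 t < 1 + ennreal (1 / real (Suc k))" by (subst AE_all_countable) auto
  then have le1: "AE t in M. v0 t \<le> 1"
  proof (rule AE_mp, intro AE_I2 impI)
    fix t assume *: "\<forall>k. v0 t < 1 + ennreal (1 / real (Suc k))"
    have "(\<lambda>k. 1 + ennreal (1 / real (Suc k))) \<longlonglongrightarrow> 1 + ennreal 0"
      by (intro tendsto_intros LIMSEQ_Suc lim_1_over_n)
    then show "v0 t \<le> 1" using * by (intro LIMSEQ_le_const[where X="\<lambda>k. 1 + ennreal (1 / real (Suc k))"]) (auto intro: less_imp_le)
  qed
  have "emeasure \<kappa> (- S) = 0"
    unfolding kem[OF borel_comp[OF S]] using DS by (auto intro!: arg_cong[where f="emeasure \<gamma>", of _ "{}", simplified])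
  then have "- S \<in> null_sets (density M v0)" using S by (auto simp: dens null_sets_def ksets M_borel)
  then have off: "AE t in M. t \<notin> S \<longrightarrow> v0 t = 0"
    using v0m by (subst (asm) null_sets_density_iff) auto
  define v where "v t = (if t \<in> S then enn2real (min (v0 t) 1) else 0)" for t
  have vm: "v \<in> borel_measurable borel" unfolding v_def using v0b S by measurable
  have veq: "AE t in M. ennreal (v t) = v0 t"
    using le1 off
  proof eventually_elim
    case (elim t)
    then have "v0 t < top" by (metis ennreal_one_less_top le_less_trans)
    then show ?case using elim by (simp add: v_def min_absorb1 ennreal_enn2real)
  qed
  show ?thesis
  proof (intro exI[of _ v] conjI allI impI ballI)
    show "v t \<le> 1" for t
    proof -
      have "enn2real (min (v0 t) 1) \<le> enn2real 1" by (intro enn2real_mono) auto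
      then show ?thesis by (auto simp: v_def)
    qed
    fix A :: "'a set" assume A: "A \<in> sets borel"
    have "(\<integral>\<^sup>+t. ennreal (v t) * indicator A t \<partial>M) = (\<integral>\<^sup>+t. v0 t * indicator A t \<partial>M)"
      by (rule nn_integral_cong_AE, rule AE_mp[OF veq]) auto
    also have "\<dots> = emeasure \<kappa> A"
      using A v0m by (subst dens[symmetric], subst emeasure_density) (auto simp: M_borel)
    finally show "(\<integral>\<^sup>+t. ennreal (v t) * indicator A t \<partial>M) = ennreal (measure \<gamma> (D \<inter> {x. x i \<in> A}))"
      using kem[OF A] by (simp add: G.emeasure_eq_measure)
  qed (use vm in \<open>auto simp: v_def\<close>)
qed

end

text \<open>Component \<open>j\<close> is a product of probability densities relative to
  \<open>M\<close>, with weight \<open>a j\<close>. For \<open>A = UNIV\<close> the assumption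
  \<open>marginal\<close> also says that the weights add up to 1. Finiteness of \<open>J\<close> and
  the common bound \<open>B\<close> yield a bounded total density.\<close>

locale product_mixture = borel_prob M for M :: "'a::polish_space measure" +
  fixes J :: "'j set" and a :: "'j \<Rightarrow> real" and u :: "'j \<Rightarrow> 'n::finite \<Rightarrow> 'a \<Rightarrow> real" and B :: real
  assumes J_finite: "finite J"
    and a_pos: "\<And>j. j \<in> J \<Longrightarrow> 0 < a j"
    and u_measurable: "\<And>j i. j \<in> J \<Longrightarrow> u j i \<in> borel_measurable borel"
    and u_nonneg: "\<And>j i t. j \<in> J \<Longrightarrow> 0 \<le> u j i t"
    and u_le: "\<And>j i t. j \<in> J \<Longrightarrow> u j i t \<le> B"
    and u_integral: "\<And>j i. j \<in> J \<Longrightarrow> (\<integral>\<^sup>+t. ennreal (u j i t) \<partial>M) = 1"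
    and marginal: "\<And>i A. A \<in> sets borel \<Longrightarrow>
       (\<Sum>j\<in>J. ennreal (a j) * (\<integral>\<^sup>+t. ennreal (u j i t) * indicator A t \<partial>M)) = emeasure M A"
begin

definition U :: "('n \<Rightarrow> 'a) \<Rightarrow> real" where
  "U x = (\<Sum>j\<in>J. a j * (\<Prod>i\<in>UNIV. u j i (x i)))"

definition mix :: "('n \<Rightarrow> 'a) measure" where
  "mix = density (Pi\<^sub>M UNIV (\<lambda>_. M)) (\<lambda>x. ennreal (U x))"

lemma prod_measurable: "j \<in> J \<Longrightarrow> (\<lambda>x. \<Prod>i\<in>UNIV. u j i (x i)) \<in> borel_measurable borel"
  by (intro borel_measurable_prod measurable_compose[OF measurable_product_coordinates] u_measurable)

lemma prod_measurable': "j \<in> J \<Longrightarrow> (\<lambda>x. \<Prod>i\<in>UNIV. u j i (x i)) \<in> borel_measurable (Pi\<^sub>M UNIV (\<lambda>_. M))"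
  using prod_measurable by (simp add: PiM_M_measurable)

lemma prod_nonneg': "j \<in> J \<Longrightarrow> 0 \<le> (\<Prod>i\<in>UNIV. u j i (x i))"
  by (intro prod_nonneg) (simp add: u_nonneg)

lemma U_measurable: "U \<in> borel_measurable borel"
  unfolding U_def by (intro borel_measurable_sum borel_measurable_times prod_measurable) auto

lemma U_nonneg: "0 \<le> U x"
  unfolding U_def by (intro sum_nonneg mult_nonneg_nonneg prod_nonneg') (auto dest: a_pos)

lemma U_le: "U x \<le> (\<Sum>j\<in>J. a j * (\<Prod>i\<in>(UNIV::'n set). B))"
  unfolding U_def by (intro sum_mono mult_left_mono prod_mono) (auto simp: u_nonneg u_le dest: a_pos)

lemma nn_integral_mix:
  assumes "\<phi> \<in> borel_measurable borel"
  shows "(\<integral>\<^sup>+x. \<phi> x \<partial>mix) = (\<Sum>j\<in>J. ennreal (a j) * (\<integral>\<^sup>+x. \<phi> x \<partial>product_density M (u j)))"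
proof -
  let ?P = "Pi\<^sub>M UNIV (\<lambda>_::'n. M)"
  have phi[measurable]: "\<phi> \<in> borel_measurable ?P" using assms by (simp add: PiM_M_measurable)
  have Um[measurable]: "U \<in> borel_measurable ?P" using U_measurable by (simp add: PiM_M_measurable)
  note prod_measurable'[measurable]
  have "(\<integral>\<^sup>+x. \<phi> x \<partial>mix) = (\<integral>\<^sup>+x. ennreal (U x) * \<phi> x \<partial>?P)"
    unfolding mix_def by (rule nn_integral_density) auto
  also have "\<dots> = (\<integral>\<^sup>+x. (\<Sum>j\<in>J. ennreal (a j) * (ennreal (\<Prod>i\<in>UNIV. u j i (x i)) * \<phi> x)) \<partial>?P)"
  proof (rule nn_integral_cong)
    fix x :: "'n \<Rightarrow> 'a"
    have nn: "0 \<le> a j * (\<Prod>i\<in>UNIV. u j i (x i))" if "j \<in> J" for j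
      using that prod_nonneg'[OF that] a_pos[OF that] by (intro mult_nonneg_nonneg) auto
    have "ennreal (U x) = (\<Sum>j\<in>J. ennreal (a j * (\<Prod>i\<in>UNIV. u j i (x i))))"
      unfolding U_def using nn by (subst sum_ennreal) auto
    also have "\<dots> = (\<Sum>j\<in>J. ennreal (a j) * ennreal (\<Prod>i\<in>UNIV. u j i (x i)))"
      using prod_nonneg' a_pos by (intro sum.cong) (auto simp: ennreal_mult less_imp_le)
    finally show "ennreal (U x) * \<phi> x = (\<Sum>j\<in>J. ennreal (a j) * (ennreal (\<Prod>i\<in>UNIV. u j i (x i)) * \<phi> x))"
      by (simp add: sum_distrib_right mult.assoc)
  qed
  also have "\<dots> = (\<Sum>j\<in>J. ennreal (a j) * (\<integral>\<^sup>+x. ennreal (\<Prod>i\<in>UNIV. u j i (x i)) * \<phi> x \<partial>?P))"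
    by (subst nn_integral_sum) (auto intro!: sum.cong nn_integral_cmult)
  also have "\<dots> = (\<Sum>j\<in>J. ennreal (a j) * (\<integral>\<^sup>+x. \<phi> x \<partial>product_density M (u j)))"
    unfolding product_density_def by (intro sum.cong refl arg_cong2[where f="(*)"] nn_integral_density[symmetric]) auto
  finally show ?thesis .
qed

text \<open>By Tonelli, all factors other than the \<open>i\<close>-th integrate to 1.\<close>

lemma product_density_component:
  assumes j: "j \<in> J" and A: "A \<in> sets borel"
  shows "(\<integral>\<^sup>+x. indicator A (x i) \<partial>product_density M (u j)) = (\<integral>\<^sup>+t. ennreal (u j i t) * indicator A t \<partial>M)"
proof -
  interpret P: product_sigma_finite "\<lambda>_::'n. M" by (rule product_sigma_finite_const) unfold_locales
  have im: "(\<lambda>x. indicator A (x i) :: ennreal) \<in> borel_measurable (Pi\<^sub>M UNIV (\<lambda>_::'n. M))"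
    unfolding PiM_M_measurable by (rule measurable_compose[OF measurable_product_coordinates]) (rule borel_measurable_indicator[OF A])
  have "(\<integral>\<^sup>+x. indicator A (x i) \<partial>product_density M (u j))
     = (\<integral>\<^sup>+x. ennreal (\<Prod>k\<in>UNIV. u j k (x k)) * indicator A (x i) \<partial>Pi\<^sub>M UNIV (\<lambda>_::'n. M))"
    unfolding product_density_def
    by (rule nn_integral_density) (use im prod_measurable'[OF j] in auto)
  also have "\<dots> = (\<integral>\<^sup>+x. (\<Prod>k\<in>UNIV. ennreal (u j k (x k)) * (if k = i then indicator A (x k) else 1)) \<partial>Pi\<^sub>M UNIV (\<lambda>_::'n. M))"
    by (intro nn_integral_cong) (simp add: prod.distrib prod_ennreal u_nonneg j prod.delta)
  also have "\<dots> = (\<Prod>k\<in>UNIV. \<integral>\<^sup>+t. ennreal (u j k t) * (if k = i then indicator A t else 1) \<partial>M)"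
    using u_measurable[OF j] A by (intro P.product_nn_integral_prod) auto
  also have "\<dots> = (\<Prod>k\<in>UNIV. if k = i then \<integral>\<^sup>+t. ennreal (u j i t) * indicator A t \<partial>M else 1)"
    by (intro prod.cong) (auto simp: u_integral j)
  finally show ?thesis by (simp add: prod.delta)
qed

lemma product_density_prob: "j \<in> J \<Longrightarrow> product_density M (u j) \<in> borel_prob_measures"
proof -
  assume j: "j \<in> J"
  have "emeasure (product_density M (u j)) (space (product_density M (u j))) = 1"
    using product_density_component[OF j, of UNIV] u_integral[OF j] by simp
  moreover have "sets (product_density M (u j)) = sets borel"
    by (simp add: product_density_def PiM_M_borel)
  ultimately show ?thesis by (auto simp: borel_prob_measures_def intro: prob_spaceI)
qed

lemma mix_borel: "sets mix = sets borel" "space mix = UNIV"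
  by (simp_all add: mix_def PiM_M_borel space_PiM)

lemma mix_component: "A \<in> sets borel \<Longrightarrow> emeasure mix {x. x i \<in> A} = emeasure M A"
proof -
  assume A: "A \<in> sets borel"
  have ind: "(\<lambda>x. indicator A (x i) :: ennreal) \<in> borel_measurable borel"
    by (rule measurable_compose[OF measurable_product_coordinates]) (rule borel_measurable_indicator[OF A])
  have "{x. x i \<in> A} \<in> sets mix"
    using measurable_sets[OF measurable_product_coordinates[of i] A] by (simp add: vimage_def mix_borel)
  then have "emeasure mix {x. x i \<in> A} = (\<integral>\<^sup>+x. indicator A (x i) \<partial>mix)"
    by (simp add: nn_integral_indicator[symmetric] indicator_def del: nn_integral_indicator)
  also have "\<dots> = emeasure M A"
    by (subst nn_integral_mix[OF ind]) (simp add: product_density_component A marginal)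
  finally show ?thesis .
qed

lemma mix_coupling: "mix \<in> couplings M"
proof -
  have "emeasure mix (space mix) = 1"
    using mix_component[of UNIV] emeasure_space_1 by (simp add: mix_borel)
  then have "mix \<in> borel_prob_measures" by (auto simp: borel_prob_measures_def mix_borel intro: prob_spaceI)
  moreover have "distr mix borel (\<lambda>x. x i) = M" for i
  proof (rule measure_eqI)
    fix A assume "A \<in> sets (distr mix borel (\<lambda>x. x i))"
    then have A: "A \<in> sets borel" by simp
    have "(\<lambda>x. x i) \<in> measurable mix borel"
      using mix_borel(1) measurable_product_coordinates by (metis measurable_cong_sets)
    then show "emeasure (distr mix borel (\<lambda>x. x i)) A = emeasure M A"
      using A by (subst emeasure_distr) (auto simp: vimage_def mix_borel mix_component)
  qed (simp add: M_borel)
  ultimately show ?thesis by (simp add: couplings_def)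
qed

text \<open>A component is dominated by the mixture divided by its positive weight, so integrability
  descends to it. The formula follows from the one for nonnegative functions, applied to the
  positive and the negative part.\<close>

lemma
  assumes phi: "\<phi> \<in> borel_measurable borel" and int: "integrable mix (\<phi> :: _ \<Rightarrow> real)"
  shows integrable_component: "j \<in> J \<Longrightarrow> integrable (product_density M (u j)) \<phi>"
    and integral_mix: "(\<integral>x. \<phi> x \<partial>mix) = (\<Sum>j\<in>J. a j * (\<integral>x. \<phi> x \<partial>product_density M (u j)))"
proof -
  have fin: "(\<integral>\<^sup>+x. ennreal (\<psi> x) \<partial>product_density M (u j)) < \<infinity>"
    if "\<psi> \<in> borel_measurable borel" "(\<integral>\<^sup>+x. ennreal (\<psi> x) \<partial>mix) < \<infinity>" "j \<in> J" for \<psi> j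
  proof -
    have "ennreal (a j) * (\<integral>\<^sup>+x. ennreal (\<psi> x) \<partial>product_density M (u j)) \<le> (\<integral>\<^sup>+x. ennreal (\<psi> x) \<partial>mix)"
      using that J_finite by (subst nn_integral_mix) (auto intro!: member_le_sum)
    then have "ennreal (a j) * (\<integral>\<^sup>+x. ennreal (\<psi> x) \<partial>product_density M (u j)) < \<infinity>"
      using that(2) by (rule le_less_trans)
    then show ?thesis using a_pos[OF that(3)] by (auto simp: ennreal_mult_less_top)
  qed
  have pm: "sets (product_density M (u j)) = sets borel" for j
    by (simp add: product_density_def PiM_M_borel)
  have m: "\<phi> \<in> borel_measurable (product_density M (u j))" for j
    using phi pm by (metis measurable_cong_sets)
  have fm: "(\<integral>\<^sup>+x. ennreal (\<phi> x) \<partial>mix) < \<infinity>" "(\<integral>\<^sup>+x. ennreal (- \<phi> x) \<partial>mix) < \<infinity>"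
    using int by (auto simp: real_integrable_def less_top[symmetric])
  have nm: "(\<lambda>x. - \<phi> x) \<in> borel_measurable borel" using phi by simp
  show I: "integrable (product_density M (u j)) \<phi>" if "j \<in> J" for j
    unfolding real_integrable_def using fin[OF phi fm(1) that] fin[OF nm fm(2) that] m by auto
  have sp: "enn2real (\<integral>\<^sup>+x. ennreal (\<psi> x) \<partial>mix) = (\<Sum>j\<in>J. a j * enn2real (\<integral>\<^sup>+x. ennreal (\<psi> x) \<partial>product_density M (u j)))"
    if "\<psi> \<in> borel_measurable borel" "(\<integral>\<^sup>+x. ennreal (\<psi> x) \<partial>mix) < \<infinity>" for \<psi>
    using that fin[OF that] a_pos
    by (subst nn_integral_mix) (auto simp: enn2real_sum enn2real_mult ennreal_mult_less_top less_imp_le intro!: sum.cong)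
  show "(\<integral>x. \<phi> x \<partial>mix) = (\<Sum>j\<in>J. a j * (\<integral>x. \<phi> x \<partial>product_density M (u j)))"
    unfolding real_lebesgue_integral_def[OF int] sp[OF phi fm(1)] sp[OF nm fm(2)]
    by (subst sum_subtractf[symmetric], intro sum.cong refl)
      (simp add: real_lebesgue_integral_def[OF I] right_diff_distrib)
qed

lemma AE_product_density:
  assumes j: "j \<in> J" and S: "\<And>i t. t \<notin> S i \<Longrightarrow> u j i t = 0"
  shows "AE x in product_density M (u j). \<forall>i. x i \<in> S i"
  unfolding product_density_def
proof (subst AE_density)
  show "AE x in Pi\<^sub>M UNIV (\<lambda>_. M). 0 < ennreal (\<Prod>i\<in>UNIV. u j i (x i)) \<longrightarrow> (\<forall>i. x i \<in> S i)"
  proof (intro AE_I2 impI allI, rule ccontr)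
    fix x i assume "0 < ennreal (\<Prod>i\<in>UNIV. u j i (x i))" "x i \<notin> S i"
    then show False using S[of "x i" i] prod_zero[of UNIV "\<lambda>i. u j i (x i)"] by fastforce
  qed
qed (use prod_measurable'[OF j] in simp)

text \<open>If every component has a vanishing factor at \<open>x\<close>, then the total density is
  0 at \<open>x\<close>.\<close>

lemma AE_mix:
  assumes S: "\<And>j i t. j \<in> J \<Longrightarrow> t \<notin> S j i \<Longrightarrow> u j i t = 0"
  shows "AE x in mix. \<exists>j\<in>J. \<forall>i. x i \<in> S j i"
  unfolding mix_def
proof (subst AE_density)
  show "AE x in Pi\<^sub>M UNIV (\<lambda>_. M). 0 < ennreal (U x) \<longrightarrow> (\<exists>j\<in>J. \<forall>i. x i \<in> S j i)"
  proof (intro AE_I2 impI, rule ccontr)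
    fix x assume pos: "0 < ennreal (U x)" and "\<not> (\<exists>j\<in>J. \<forall>i. x i \<in> S j i)"
    then have "\<forall>j\<in>J. \<exists>i. u j i (x i) = 0" using S by blast
    then have "\<forall>j\<in>J. (\<Prod>i\<in>UNIV. u j i (x i)) = 0" by (auto intro!: prod_zero)
    then have "U x = 0" unfolding U_def by (intro sum.neutral) auto
    then show False using pos by simp
  qed
qed (use U_measurable in \<open>simp add: PiM_M_measurable\<close>)

lemma integral_product_density_le:
  assumes j: "j \<in> J" and S: "\<And>i t. t \<notin> S i \<Longrightarrow> u j i t = 0"
    and int: "integrable (product_density M (u j)) \<phi>" and le: "\<And>x. (\<And>i. x i \<in> S i) \<Longrightarrow> \<phi> x \<le> (b::real)"
  shows "(\<integral>x. \<phi> x \<partial>product_density M (u j)) \<le> b"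
proof -
  interpret P: prob_space "product_density M (u j)"
    by (rule borel_prob_measuresD(3)[OF product_density_prob[OF j]])
  have "(\<integral>x. \<phi> x \<partial>product_density M (u j)) \<le> (\<integral>x. b \<partial>product_density M (u j))"
  proof (rule integral_mono_AE[OF int])
    show "AE x in product_density M (u j). \<phi> x \<le> b"
      using AE_product_density[OF j S] by (rule AE_mp) (auto intro: le)
  qed simp
  then show ?thesis by (simp add: P.prob_space)
qed

end

section \<open>The swap\<close>

text \<open>Cells below \<open>K\<close> are kept; those below \<open>K0\<close> may donate tuples.
  A member of \<open>Kp\<close> names one donor cell per coordinate, and \<open>T \<kappa> i\<close>
  is meant as the set of values that may replace coordinate \<open>i\<close> in every tuple of the
  box \<open>W (\<kappa> i)\<close>. By \<open>reserve\<close> no donor is exhausted, even if it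
  serves all coordinates of all the remaining mass.\<close>

locale swap_data = borel_prob M for M :: "'a::polish_space measure" +
  fixes \<gamma> :: "('n::finite \<Rightarrow> 'a) measure" and K K0 :: nat
    and W :: "nat \<Rightarrow> 'n \<Rightarrow> 'a set" and D :: "nat \<Rightarrow> ('n \<Rightarrow> 'a) set"
    and Kp :: "('n \<Rightarrow> nat) set" and T :: "('n \<Rightarrow> nat) \<Rightarrow> 'n \<Rightarrow> 'a set"
  assumes coupling: "\<gamma> \<in> couplings M"
    and W_borel: "\<And>k i. W k i \<in> sets borel"
    and D_borel: "\<And>k. D k \<in> sets borel"
    and D_disjoint: "disjoint_family D"
    and D_W: "\<And>k x i. x \<in> D k \<Longrightarrow> x i \<in> W k i"
    and K0_le: "K0 \<le> K"
    and Kp_lt: "\<And>\<kappa> i. \<kappa> \<in> Kp \<Longrightarrow> \<kappa> i < K0"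
    and Kp_pos: "\<And>\<kappa> i. \<kappa> \<in> Kp \<Longrightarrow> 0 < measure \<gamma> (D (\<kappa> i))"
    and T_borel: "\<And>\<kappa> i. T \<kappa> i \<in> sets borel"
    and cover: "\<And>x. \<exists>\<kappa>\<in>Kp. \<forall>i. x i \<in> T \<kappa> i"
    and reserve: "\<And>k. k < K0 \<Longrightarrow> 0 < measure \<gamma> (D k) \<Longrightarrow>
       real CARD('n) * measure \<gamma> (- (\<Union>k<K. D k)) < measure \<gamma> (D k)"
begin

definition p :: "nat \<Rightarrow> real" where "p k = measure \<gamma> (D k)"
definition R :: "('n \<Rightarrow> 'a) set" where "R = - (\<Union>k<K. D k)"
definition F :: "('n \<Rightarrow> nat) \<Rightarrow> ('n \<Rightarrow> 'a) set" where "F \<kappa> = {x. \<forall>i. x i \<in> T \<kappa> i}"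
text \<open>The sets \<open>F \<kappa>\<close> overlap. Each point of \<open>R\<close> is assigned
  to the admissible \<open>\<kappa>\<close> of least code, which turns the cover into a
  partition.\<close>

definition E :: "('n \<Rightarrow> nat) \<Rightarrow> ('n \<Rightarrow> 'a) set" where
  "E \<kappa> = (R \<inter> F \<kappa>) - (\<Union>\<kappa>'\<in>{\<kappa>'\<in>Kp. to_nat \<kappa>' < to_nat \<kappa>}. F \<kappa>')"
definition e :: "('n \<Rightarrow> nat) \<Rightarrow> real" where "e \<kappa> = measure \<gamma> (E \<kappa>)"
text \<open>Null cells and null pieces are left out of \<open>JD\<close> and \<open>JE\<close>
  because the marginals are going to be divided by their masses.\<close>

definition JD :: "nat set" where "JD = {k. k < K \<and> 0 < p k}"
definition JE :: "('n \<Rightarrow> nat) set" where "JE = {\<kappa>\<in>Kp. 0 < e \<kappa>}"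
text \<open>The mass withdrawn from cell \<open>k\<close>: a unit of \<open>E \<kappa>\<close>
  consumes one tuple per coordinate, and a cell named by several coordinates is charged several
  times.\<close>

definition q :: "nat \<Rightarrow> real" where "q k = (\<Sum>\<kappa>\<in>JE. e \<kappa> * real (card {i. \<kappa> i = k}))"
text \<open>The two alternatives support the two kinds of new tuples: a donor tuple with one
  coordinate replaced, and the tuple of the replaced coordinates. Boxes occur instead of cells
  because a product of marginals may charge points outside the cell.\<close>

definition swapped :: "('n \<Rightarrow> 'a) set" where
  "swapped = {x. \<exists>\<kappa>\<in>Kp. (\<exists>i. x i \<in> T \<kappa> i \<and> (\<forall>j. j \<noteq> i \<longrightarrow> x j \<in> W (\<kappa> i) j)) \<or> (\<forall>i. x i \<in> W (\<kappa> i) i)}"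

section \<open>Partition of the leftover set and balance of masses\<close>

lemma gamma_prob: "\<gamma> \<in> borel_prob_measures"
  using coupling by (simp add: couplings_def)

sublocale G: prob_space \<gamma>
  by (rule borel_prob_measuresD(3)[OF gamma_prob])

lemma gamma_borel: "sets \<gamma> = sets borel" "space \<gamma> = UNIV"
  using borel_prob_measuresD[OF gamma_prob] by auto

lemma Kp_finite: "finite Kp"
proof (rule finite_subset)
  show "Kp \<subseteq> Pi\<^sub>E UNIV (\<lambda>_. {..<K0})" using Kp_lt by auto
qed (simp add: finite_PiE)

lemma JD_finite: "finite JD" and JE_finite: "finite JE"
  using Kp_finite by (auto simp: JD_def JE_def)

lemma pre_borel: "A \<in> sets borel \<Longrightarrow> {x. x i \<in> A} \<in> sets (borel :: ('n \<Rightarrow> 'a) measure)"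
  using measurable_sets[OF measurable_product_coordinates[of i], of A] by (simp add: vimage_def)

lemma F_borel: "F \<kappa> \<in> sets borel"
proof -
  have "F \<kappa> = (\<Inter>i. {x. x i \<in> T \<kappa> i})" by (auto simp: F_def)
  then show ?thesis by (auto intro!: sets.finite_INT pre_borel T_borel)
qed

lemma R_borel: "R \<in> sets borel"
  unfolding R_def using D_borel by (intro borel_comp sets.finite_UN) auto

lemma E_borel: "E \<kappa> \<in> sets borel"
  unfolding E_def using R_borel F_borel Kp_finite by (intro sets.Diff sets.Int sets.finite_UN) auto

lemma E_disjoint: "\<kappa> \<in> Kp \<Longrightarrow> \<kappa>' \<in> Kp \<Longrightarrow> \<kappa> \<noteq> \<kappa>' \<Longrightarrow> E \<kappa> \<inter> E \<kappa>' = {}"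
proof (induction "to_nat \<kappa>" "to_nat \<kappa>'" arbitrary: \<kappa> \<kappa>' rule: linorder_wlog)
  case le
  then have "to_nat \<kappa> < to_nat \<kappa>'" using inj_to_nat by (metis le_neq_implies_less to_nat_split)
  then show ?case using le by (auto simp: E_def)
next
  case sym
  then show ?case by (metis inf_commute)
qed

lemma E_union: "(\<Union>\<kappa>\<in>Kp. E \<kappa>) = R"
proof
  show "R \<subseteq> (\<Union>\<kappa>\<in>Kp. E \<kappa>)"
  proof
    fix x assume x: "x \<in> R"
    have ex: "\<exists>n. \<exists>\<kappa>\<in>Kp. x \<in> F \<kappa> \<and> to_nat \<kappa> = n" using cover[of x] by (auto simp: F_def)
    define n where "n = (LEAST n. \<exists>\<kappa>\<in>Kp. x \<in> F \<kappa> \<and> to_nat \<kappa> = n)"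
    from LeastI_ex[OF ex] obtain \<kappa> where k: "\<kappa> \<in> Kp" "x \<in> F \<kappa>" "to_nat \<kappa> = n"
      unfolding n_def by blast
    have "x \<notin> F \<kappa>'" if "\<kappa>' \<in> Kp" "to_nat \<kappa>' < n" for \<kappa>'
      using not_less_Least[of "to_nat \<kappa>'" "\<lambda>n. \<exists>\<kappa>\<in>Kp. x \<in> F \<kappa> \<and> to_nat \<kappa> = n"] that unfolding n_def by blast
    then show "x \<in> (\<Union>\<kappa>\<in>Kp. E \<kappa>)" using x k by (auto simp: E_def)
  qed
qed (auto simp: E_def)

lemma measure_split:
  assumes X: "X \<in> sets borel"
  shows "measure \<gamma> X = (\<Sum>k\<in>JD. measure \<gamma> (D k \<inter> X)) + (\<Sum>\<kappa>\<in>JE. measure \<gamma> (E \<kappa> \<inter> X))"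
proof -
  have XD: "(\<Union>k<K. D k \<inter> X) \<in> sets \<gamma>" and XR: "R \<inter> X \<in> sets \<gamma>"
    using X D_borel R_borel by (auto simp: gamma_borel)
  have "X = (\<Union>k<K. D k \<inter> X) \<union> (R \<inter> X)" "(\<Union>k<K. D k \<inter> X) \<inter> (R \<inter> X) = {}" by (auto simp: R_def)
  then have "measure \<gamma> X = measure \<gamma> (\<Union>k<K. D k \<inter> X) + measure \<gamma> (R \<inter> X)"
    using G.finite_measure_Union[OF XD XR] by metis
  also have "measure \<gamma> (\<Union>k<K. D k \<inter> X) = (\<Sum>k<K. measure \<gamma> (D k \<inter> X))"
    using X D_borel D_disjoint
    by (intro G.finite_measure_finite_Union) (auto simp: gamma_borel disjoint_family_on_def)
  also have "\<dots> = (\<Sum>k\<in>JD. measure \<gamma> (D k \<inter> X))"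
  proof (rule sum.mono_neutral_right)
    show "\<forall>k\<in>{..<K} - JD. measure \<gamma> (D k \<inter> X) = 0"
    proof
      fix k assume "k \<in> {..<K} - JD"
      then have "p k = 0" using measure_nonneg[of \<gamma> "D k"] by (auto simp: JD_def p_def not_less)
      then show "measure \<gamma> (D k \<inter> X) = 0"
        using G.finite_measure_mono[of "D k \<inter> X" "D k"] D_borel by (auto simp: p_def gamma_borel intro: antisym)
    qed
  qed (auto simp: JD_def)
  also have "R \<inter> X = (\<Union>\<kappa>\<in>Kp. E \<kappa> \<inter> X)" using E_union by auto
  also have "measure \<gamma> \<dots> = (\<Sum>\<kappa>\<in>Kp. measure \<gamma> (E \<kappa> \<inter> X))"
    using X E_borel E_disjoint Kp_finite
    by (intro G.finite_measure_finite_Union) (auto simp: gamma_borel disjoint_family_on_def)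
  also have "\<dots> = (\<Sum>\<kappa>\<in>JE. measure \<gamma> (E \<kappa> \<inter> X))"
  proof (rule sum.mono_neutral_right[OF Kp_finite])
    show "\<forall>\<kappa>\<in>Kp - JE. measure \<gamma> (E \<kappa> \<inter> X) = 0"
    proof
      fix \<kappa> assume "\<kappa> \<in> Kp - JE"
      then have "e \<kappa> = 0" using measure_nonneg[of \<gamma> "E \<kappa>"] by (auto simp: JE_def e_def not_less)
      then show "measure \<gamma> (E \<kappa> \<inter> X) = 0"
        using G.finite_measure_mono[of "E \<kappa> \<inter> X" "E \<kappa>"] E_borel by (auto simp: e_def gamma_borel intro: antisym)
    qed
  qed (auto simp: JE_def)
  finally show ?thesis .
qed

lemma sum_e: "(\<Sum>\<kappa>\<in>JE. e \<kappa>) = measure \<gamma> R"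
proof -
  have D: "(\<Sum>k\<in>JD. measure \<gamma> (D k \<inter> R)) = 0"
    by (intro sum.neutral) (auto simp: R_def JD_def intro!: arg_cong[where f="measure \<gamma>", of _ "{}", simplified])
  have "(\<Sum>\<kappa>\<in>JE. measure \<gamma> (E \<kappa> \<inter> R)) = (\<Sum>\<kappa>\<in>JE. e \<kappa>)"
    by (intro sum.cong) (auto simp: e_def E_def intro!: arg_cong[where f="measure \<gamma>"])
  then show ?thesis using measure_split[OF R_borel] D by simp
qed

lemma Kp_JD: "\<kappa> \<in> Kp \<Longrightarrow> \<kappa> i \<in> JD"
  using Kp_lt Kp_pos K0_le by (auto simp: JD_def p_def intro: less_le_trans)

text \<open>Double counting: the cells with their multiplicities in \<open>q\<close> are the
  coordinates grouped by the value of \<open>\<kappa> i\<close>. With the cell marginals in place of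
  \<open>g\<close> this is the cancellation that preserves the marginals.\<close>

lemma sum_q:
  fixes g :: "nat \<Rightarrow> real"
  shows "(\<Sum>k\<in>JD. q k * g k) = (\<Sum>\<kappa>\<in>JE. e \<kappa> * (\<Sum>i\<in>UNIV. g (\<kappa> i)))"
proof -
  have "(\<Sum>k\<in>JD. q k * g k) = (\<Sum>k\<in>JD. \<Sum>\<kappa>\<in>JE. e \<kappa> * (real (card {i. \<kappa> i = k}) * g k))"
    by (simp add: q_def sum_distrib_right mult.assoc)
  also have "\<dots> = (\<Sum>\<kappa>\<in>JE. e \<kappa> * (\<Sum>k\<in>JD. real (card {i. \<kappa> i = k}) * g k))"
    by (subst sum.swap) (simp add: sum_distrib_left)
  also have "\<dots> = (\<Sum>\<kappa>\<in>JE. e \<kappa> * (\<Sum>i\<in>UNIV. g (\<kappa> i)))"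
  proof (intro sum.cong refl arg_cong2[where f="(*)"])
    fix \<kappa> assume "\<kappa> \<in> JE"
    then have sub: "\<kappa> ` UNIV \<subseteq> JD" using Kp_JD by (auto simp: JE_def)
    have "(\<Sum>i\<in>UNIV. g (\<kappa> i)) = (\<Sum>k\<in>JD. \<Sum>i\<in>{i\<in>UNIV. \<kappa> i = k}. g (\<kappa> i))"
      by (rule sum.group[symmetric]) (use sub JD_finite in auto)
    also have "\<dots> = (\<Sum>k\<in>JD. real (card {i. \<kappa> i = k}) * g k)"
      by (intro sum.cong) auto
    finally show "(\<Sum>k\<in>JD. real (card {i. \<kappa> i = k}) * g k) = (\<Sum>i\<in>UNIV. g (\<kappa> i))" by simp
  qed
  finally show ?thesis .
qed

lemma q_nonneg: "0 \<le> q k"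
  unfolding q_def by (intro sum_nonneg) (auto simp: e_def)

lemma sum_q_total: "(\<Sum>k\<in>JD. q k) = real CARD('n) * measure \<gamma> R"
  using sum_q[of "\<lambda>_. 1"] by (simp add: mult.commute[of _ "real CARD('n)"] flip: sum_distrib_left sum_e)

lemma q_eq_0: "K0 \<le> k \<Longrightarrow> q k = 0"
proof -
  assume k: "K0 \<le> k"
  have "{i. \<kappa> i = k} = {}" if "\<kappa> \<in> JE" for \<kappa>
  proof -
    have "\<kappa> i < k" for i using Kp_lt[of \<kappa> i] that k by (auto simp: JE_def)
    then show ?thesis by (metis (mono_tags, lifting) empty_Collect_eq less_irrefl)
  qed
  then show ?thesis by (simp add: q_def)
qed

text \<open>By \<open>reserve\<close> even the total withdrawal, \<open>N\<close> times the mass of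
  \<open>R\<close>, is below the mass of each donor; cells from \<open>K0\<close> on give nothing.
  Strictness keeps the weights \<open>p k - q k\<close> positive.\<close>

lemma q_less: "k \<in> JD \<Longrightarrow> q k < p k"
proof (cases "k < K0")
  case True
  assume k: "k \<in> JD"
  have "q k \<le> (\<Sum>k\<in>JD. q k)" using k JD_finite q_nonneg by (intro member_le_sum) auto
  also have "\<dots> < p k"
    unfolding sum_q_total p_def R_def using reserve[OF True] k by (auto simp only: JD_def p_def)
  finally show ?thesis .
qed (auto simp: q_eq_0 JD_def)

text \<open>\<open>z k + \<omega>\<close> bounds \<open>\<phi>\<close> on box \<open>k\<close>,
  \<open>b\<close> is the price of taking mass from a donor, and \<open>Q\<close> that of a new
  tuple; per unit of leftover mass, \<open>N\<close> tuples are withdrawn and \<open>N + 1\<close>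
  created. The function \<open>\<phi>\<close> is quantified inside because one plan has to serve the
  cost and all Lipschitz test functions.\<close>

definition swap_estimate :: "('n \<Rightarrow> 'a) measure \<Rightarrow> bool" where
  "swap_estimate \<eta> \<longleftrightarrow> (\<forall>\<phi> z \<omega> b Q. \<phi> \<in> borel_measurable borel \<longrightarrow> integrable \<eta> \<phi> \<longrightarrow>
      (\<forall>k x. k < K \<longrightarrow> 0 < measure \<gamma> (D k) \<longrightarrow> (\<forall>i. x i \<in> W k i) \<longrightarrow> \<phi> x \<le> z k + \<omega>) \<longrightarrow>
      (\<forall>k. k < K0 \<longrightarrow> 0 < measure \<gamma> (D k) \<longrightarrow> - z k \<le> b) \<longrightarrow>
      (\<forall>x\<in>swapped. \<phi> x \<le> Q) \<longrightarrow> 0 \<le> \<omega> \<longrightarrow>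
      (\<integral>x. \<phi> x \<partial>\<eta>) \<le> (\<Sum>k<K. measure \<gamma> (D k) * z k) + \<omega>
         + real CARD('n) * measure \<gamma> (- (\<Union>k<K. D k)) * b
         + (real CARD('n) + 1) * measure \<gamma> (- (\<Union>k<K. D k)) * Q)"

text \<open>The cells \<open>D k\<close> with \<open>k < K\<close> are replaced by the products of their marginals. The remaining
  mass \<open>R\<close> is removed by a swap: a point \<open>x \<in> E \<kappa>\<close> and one tuple \<open>y\<^sup>i\<close> from each cell
  \<open>D (\<kappa> i)\<close> are exchanged for the tuples \<open>y\<^sup>i\<close> with coordinate \<open>i\<close> replaced by \<open>x i\<close>, together with
  the tuple of the orphaned coordinates \<open>y\<^sup>i i\<close>. The exchange preserves every marginal.
  In the index type, \<open>Inr (\<kappa>, Some i)\<close> stands for the former tuples and \<open>Inr (\<kappa>, None)\<close> for the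
  latter.\<close>

lemma swap_plan:
  "\<exists>\<eta> U C. \<eta> \<in> couplings M \<and> U \<in> borel_measurable borel \<and> (\<forall>x. 0 \<le> U x \<and> U x \<le> C) \<and>
    \<eta> = density (Pi\<^sub>M UNIV (\<lambda>_. M)) (\<lambda>x. ennreal (U x)) \<and>
    (AE x in \<eta>. (\<exists>k<K. 0 < measure \<gamma> (D k) \<and> (\<forall>i. x i \<in> W k i)) \<or> x \<in> swapped) \<and>
    swap_estimate \<eta>"
proof -
  define marg where "marg X S i v \<longleftrightarrow> v \<in> borel_measurable borel \<and> (\<forall>t. 0 \<le> v t) \<and> (\<forall>t. v t \<le> 1) \<and> (\<forall>t. t \<notin> S \<longrightarrow> v t = 0)
     \<and> (\<forall>A\<in>sets borel. (\<integral>\<^sup>+t. ennreal (v t) * indicator A t \<partial>M) = ennreal (measure \<gamma> (X \<inter> {x. x i \<in> A})))"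
    for X S i and v :: "'a \<Rightarrow> real"
  have "\<exists>v. marg (D k) (W k i) i v" for k i
    unfolding marg_def by (rule marginal_density[OF coupling D_borel W_borel]) (rule D_W)
  then have "\<exists>v. \<forall>k i. marg (D k) (W k i) i (v k i)" by metis
  then obtain v where "\<And>k i. marg (D k) (W k i) i (v k i)" by blast
  then have v:  "\<And>k i. v k i \<in> borel_measurable borel" "\<And>k i t. 0 \<le> v k i t" "\<And>k i t. v k i t \<le> 1"
    "\<And>k i t. t \<notin> W k i \<Longrightarrow> v k i t = 0"
    "\<And>k i A. A \<in> sets borel \<Longrightarrow> (\<integral>\<^sup>+t. ennreal (v k i t) * indicator A t \<partial>M) = ennreal (measure \<gamma> (D k \<inter> {x. x i \<in> A}))"
    unfolding marg_def by auto
  have ET: "x i \<in> T \<kappa> i" if "x \<in> E \<kappa>" for x i \<kappa> using that by (auto simp: E_def F_def)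
  have "\<exists>v. marg (E \<kappa>) (T \<kappa> i) i v" for \<kappa> i
    unfolding marg_def by (rule marginal_density[OF coupling E_borel T_borel]) (rule ET)
  then have "\<exists>v. \<forall>\<kappa> i. marg (E \<kappa>) (T \<kappa> i) i (v \<kappa> i)" by metis
  then obtain vE where "\<And>\<kappa> i. marg (E \<kappa>) (T \<kappa> i) i (vE \<kappa> i)" by blast
  then have vE:  "\<And>\<kappa> i. vE \<kappa> i \<in> borel_measurable borel" "\<And>\<kappa> i t. 0 \<le> vE \<kappa> i t" "\<And>\<kappa> i t. vE \<kappa> i t \<le> 1"
    "\<And>\<kappa> i t. t \<notin> T \<kappa> i \<Longrightarrow> vE \<kappa> i t = 0"
    "\<And>\<kappa> i A. A \<in> sets borel \<Longrightarrow> (\<integral>\<^sup>+t. ennreal (vE \<kappa> i t) * indicator A t \<partial>M) = ennreal (measure \<gamma> (E \<kappa> \<inter> {x. x i \<in> A}))"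
    unfolding marg_def by auto
  have p0: "0 < p k" if "k \<in> JD" for k using that by (simp add: JD_def)
  have e0: "0 < e \<kappa>" if "\<kappa> \<in> JE" for \<kappa> using that by (simp add: JE_def)
  have JEK: "\<kappa> i \<in> JD" if "\<kappa> \<in> JE" for \<kappa> i using that Kp_JD by (simp add: JE_def)
  define J :: "(nat + ('n \<Rightarrow> nat) \<times> 'n option) set" where "J = JD <+> (JE \<times> UNIV)"
  \<comment> \<open>Cell \<open>k\<close> keeps what the swap leaves of it; each of the
    \<open>N + 1\<close> kinds of tuples belonging to \<open>\<kappa>\<close> gets mass
    \<open>e \<kappa>\<close>.\<close>
  define a where "a = case_sum (\<lambda>k. p k - q k) (\<lambda>(\<kappa>, _ :: 'n option). e \<kappa>)"
  define u where "u = case_sum (\<lambda>k i t. v k i t / p k)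
     (\<lambda>(\<kappa>, s) i t. case s of None \<Rightarrow> v (\<kappa> i) i t / p (\<kappa> i)
        | Some l \<Rightarrow> if i = l then vE \<kappa> i t / e \<kappa> else v (\<kappa> l) i t / p (\<kappa> l))"
  \<comment> \<open>Any common bound for the reciprocal masses would do, as the unnormalized
    marginal densities are at most 1.\<close>
  define B where "B = (\<Sum>k\<in>JD. 1 / p k) + (\<Sum>\<kappa>\<in>JE. 1 / e \<kappa>)"
  define I where "I k i A = measure \<gamma> (D k \<inter> {x. x i \<in> A}) / p k" for k i A
  \<comment> \<open>\<open>r j i A\<close> is the mass of \<open>A\<close> under the
    \<open>i\<close>-th marginal of component \<open>j\<close>, as a real number so that the
    cancellation below can use subtraction.\<close>
  define r where "r = case_sum (\<lambda>k i A. I k i A)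
     (\<lambda>(\<kappa>, s) i A. case s of None \<Rightarrow> I (\<kappa> i) i A
        | Some l \<Rightarrow> if i = l then measure \<gamma> (E \<kappa> \<inter> {x. x i \<in> A}) / e \<kappa> else I (\<kappa> l) i A)"
  have Jcases [consumes 1, case_names cell orphan swap]: P if "j \<in> J" "\<And>k. j = Inl k \<Longrightarrow> k \<in> JD \<Longrightarrow> P"
    "\<And>\<kappa>. j = Inr (\<kappa>, None) \<Longrightarrow> \<kappa> \<in> JE \<Longrightarrow> P"
    "\<And>\<kappa> l. j = Inr (\<kappa>, Some l) \<Longrightarrow> \<kappa> \<in> JE \<Longrightarrow> P" for j P
  proof (cases j)
    case (Inl k)
    then show ?thesis using that(1) by (intro that(2)) (auto simp: J_def)
  next
    case (Inr w)
    obtain \<kappa> s where w: "w = (\<kappa>, s)" by (cases w)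
    have "\<kappa> \<in> JE" using that(1) Inr w by (auto simp: J_def)
    then show ?thesis using that(3,4) Inr w by (cases s) blast+
  qed
  have sumJ: "(\<Sum>j\<in>J. g j) = (\<Sum>k\<in>JD. g (Inl k)) + (\<Sum>\<kappa>\<in>JE. g (Inr (\<kappa>, None)) + (\<Sum>l\<in>UNIV. g (Inr (\<kappa>, Some l))))"
    for g :: "_ \<Rightarrow> real"
  proof -
    have "(\<Sum>j\<in>J. g j) = (\<Sum>k\<in>JD. g (Inl k)) + (\<Sum>w\<in>JE \<times> UNIV. g (Inr w))"
      unfolding J_def by (subst sum.Plus) (auto simp: JD_finite JE_finite)
    also have "(\<Sum>w\<in>JE \<times> UNIV. g (Inr w)) = (\<Sum>\<kappa>\<in>JE. \<Sum>s\<in>UNIV. g (Inr (\<kappa>, s)))"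
      by (simp add: sum.cartesian_product)
    also have "\<dots> = (\<Sum>\<kappa>\<in>JE. g (Inr (\<kappa>, None)) + (\<Sum>l\<in>UNIV. g (Inr (\<kappa>, Some l))))"
      by (simp add: UNIV_option_conv sum.reindex)
    finally show ?thesis .
  qed
  have B1: "1 / p k \<le> B" if "k \<in> JD" for k
  proof -
    have "1 / p k \<le> (\<Sum>k\<in>JD. 1 / p k)" using that JD_finite p0 by (intro member_le_sum) (auto intro: less_imp_le)
    moreover have "0 \<le> (\<Sum>\<kappa>\<in>JE. 1 / e \<kappa>)" using e0 by (intro sum_nonneg) (auto intro: less_imp_le)
    ultimately show ?thesis by (simp add: B_def)
  qed
  have B2: "1 / e \<kappa> \<le> B" if "\<kappa> \<in> JE" for \<kappa>
  proof -
    have "1 / e \<kappa> \<le> (\<Sum>\<kappa>\<in>JE. 1 / e \<kappa>)" using that JE_finite e0 by (intro member_le_sum) (auto intro: less_imp_le)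
    moreover have "0 \<le> (\<Sum>k\<in>JD. 1 / p k)" using p0 by (intro sum_nonneg) (auto intro: less_imp_le)
    ultimately show ?thesis by (simp add: B_def)
  qed
  have vB: "v k i t / p k \<le> B" if "k \<in> JD" for k i t
    using v(3)[of k i t] p0[OF that] B1[OF that] by (meson divide_right_mono less_imp_le order_trans)
  have vEB: "vE \<kappa> i t / e \<kappa> \<le> B" if "\<kappa> \<in> JE" for \<kappa> i t
    using vE(3)[of \<kappa> i t] e0[OF that] B2[OF that] by (meson divide_right_mono less_imp_le order_trans)
  have nd: "(\<integral>\<^sup>+t. ennreal (w t / c) * indicator A t \<partial>M) = ennreal (x / c)"
    if "0 < c" "w \<in> borel_measurable borel" "\<And>t. 0 \<le> w t" "A \<in> sets borel" "0 \<le> x"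
      "(\<integral>\<^sup>+t. ennreal (w t) * indicator A t \<partial>M) = ennreal x" for w c A x
  proof -
    have "(\<integral>\<^sup>+t. ennreal (w t / c) * indicator A t \<partial>M) = (\<integral>\<^sup>+t. ennreal (1 / c) * (ennreal (w t) * indicator A t) \<partial>M)"
      using that by (intro nn_integral_cong) (simp add: mult.assoc[symmetric] ennreal_mult[symmetric])
    also have "\<dots> = ennreal (1 / c) * ennreal x"
      using that by (subst nn_integral_cmult) (auto simp: that(6) intro!: borel_measurable_times_ennreal)
    finally show ?thesis using that by (simp add: ennreal_mult[symmetric])
  qed
  have ur: "(\<integral>\<^sup>+t. ennreal (u j i t) * indicator A t \<partial>M) = ennreal (r j i A)" if j: "j \<in> J" and A: "A \<in> sets borel" for j i A
  proof -
    have vr: "(\<integral>\<^sup>+t. ennreal (v k i t / p k) * indicator A t \<partial>M) = ennreal (I k i A)" if "k \<in> JD" for k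
      unfolding I_def using p0[OF that] v A by (intro nd) auto
    have vEr: "(\<integral>\<^sup>+t. ennreal (vE \<kappa> i t / e \<kappa>) * indicator A t \<partial>M) = ennreal (measure \<gamma> (E \<kappa> \<inter> {x. x i \<in> A}) / e \<kappa>)" if "\<kappa> \<in> JE" for \<kappa>
      using e0[OF that] vE A by (intro nd) auto
    show ?thesis using j by (cases rule: Jcases) (auto simp: u_def r_def vr vEr JEK)
  qed
  have a0: "0 < a j" if "j \<in> J" for j
    using that by (cases rule: Jcases) (auto simp: a_def q_less e0)
  have r0: "0 \<le> r j i A" if "j \<in> J" for j i A
    using that by (cases rule: Jcases) (auto simp: r_def I_def less_imp_le p0 e0 JEK)
  have rU: "r j i UNIV = 1" if "j \<in> J" for j i
    using that
  proof (cases rule: Jcases)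
    case (cell k) then show ?thesis using p0[of k] by (simp add: r_def I_def p_def)
  next
    case (orphan \<kappa>) then show ?thesis using p0[OF JEK[of \<kappa> i]] by (simp add: r_def I_def p_def)
  next
    case (swap \<kappa> l) then show ?thesis using p0[OF JEK[of \<kappa> l]] e0[of \<kappa>] by (simp add: r_def I_def p_def e_def)
  qed
  have marg: "(\<Sum>j\<in>J. a j * r j i A) = measure M A" if A: "A \<in> sets borel" for i A
  proof -
    \<comment> \<open>Coordinate \<open>i\<close> is missing from the donor tuple with
      \<open>l = i\<close>, where the remaining point has taken its place, and reappears in the
      orphan tuple. So the \<open>N + 1\<close> tuples together have the \<open>i\<close>-th
      marginal of the intact donor tuples plus that of \<open>E \<kappa>\<close>.\<close>
    have inner: "e \<kappa> * I (\<kappa> i) i A + (\<Sum>l\<in>UNIV. e \<kappa> * (if i = l then measure \<gamma> (E \<kappa> \<inter> {x. x i \<in> A}) / e \<kappa> else I (\<kappa> l) i A))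
       = e \<kappa> * (\<Sum>l\<in>UNIV. I (\<kappa> l) i A) + measure \<gamma> (E \<kappa> \<inter> {x. x i \<in> A})" if "\<kappa> \<in> JE" for \<kappa>
    proof -
      have "(\<Sum>l\<in>UNIV. if i = l then measure \<gamma> (E \<kappa> \<inter> {x. x i \<in> A}) / e \<kappa> else I (\<kappa> l) i A)
         = measure \<gamma> (E \<kappa> \<inter> {x. x i \<in> A}) / e \<kappa> + (\<Sum>l\<in>UNIV - {i}. I (\<kappa> l) i A)"
        by (subst sum.remove[of _ i]) (auto intro!: sum.cong)
      moreover have "(\<Sum>l\<in>UNIV. I (\<kappa> l) i A) = I (\<kappa> i) i A + (\<Sum>l\<in>UNIV - {i}. I (\<kappa> l) i A)"
        by (subst sum.remove[of _ i]) auto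
      ultimately show ?thesis using e0[OF that] by (simp add: sum_distrib_left[symmetric] algebra_simps)
    qed
    have "(\<Sum>j\<in>J. a j * r j i A) = (\<Sum>k\<in>JD. (p k - q k) * I k i A)
       + (\<Sum>\<kappa>\<in>JE. e \<kappa> * (\<Sum>l\<in>UNIV. I (\<kappa> l) i A) + measure \<gamma> (E \<kappa> \<inter> {x. x i \<in> A}))"
      unfolding sumJ using inner by (simp add: a_def r_def)
    also have "\<dots> = (\<Sum>k\<in>JD. p k * I k i A) - (\<Sum>k\<in>JD. q k * I k i A)
       + (\<Sum>\<kappa>\<in>JE. e \<kappa> * (\<Sum>l\<in>UNIV. I (\<kappa> l) i A)) + (\<Sum>\<kappa>\<in>JE. measure \<gamma> (E \<kappa> \<inter> {x. x i \<in> A}))"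
      by (simp add: left_diff_distrib sum_subtractf sum.distrib)
    \<comment> \<open>The loss of the donors cancels against the intact donor tuples by
      \<open>sum_q\<close>; what is left is the partition of \<open>\<gamma>\<close> itself.\<close>
    also have "\<dots> = (\<Sum>k\<in>JD. measure \<gamma> (D k \<inter> {x. x i \<in> A})) + (\<Sum>\<kappa>\<in>JE. measure \<gamma> (E \<kappa> \<inter> {x. x i \<in> A}))"
      unfolding sum_q using p0 by (simp add: I_def less_imp_neq[symmetric])
    also have "\<dots> = measure \<gamma> {x. x i \<in> A}" by (rule measure_split[OF pre_borel[OF A], symmetric])
    also have "\<dots> = measure M A"
    proof -
      have "M = distr \<gamma> borel (\<lambda>x. x i)" using coupling by (simp add: couplings_def)
      moreover have "(\<lambda>x. x i) \<in> measurable \<gamma> borel"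
        using gamma_borel(1) measurable_product_coordinates by (metis measurable_cong_sets)
      ultimately show ?thesis using A measure_distr[of "\<lambda>x. x i" \<gamma> borel A]
        by (simp add: vimage_def gamma_borel)
    qed
    finally show ?thesis .
  qed
  interpret PM: product_mixture M J a u B
  proof
    show "finite J" unfolding J_def by (intro finite_Plus finite_cartesian_product JD_finite JE_finite finite)
    show "u j i \<in> borel_measurable borel" if "j \<in> J" for j i
      using that v(1) vE(1) by (cases rule: Jcases) (auto simp: u_def)
    show "0 \<le> u j i t" if "j \<in> J" for j i t
      using that by (cases rule: Jcases) (auto simp: u_def v(2) vE(2) less_imp_le p0 e0 JEK)
    show "u j i t \<le> B" if "j \<in> J" for j i t
      using that by (cases rule: Jcases) (auto simp: u_def vB vEB JEK)
    show "(\<integral>\<^sup>+t. ennreal (u j i t) \<partial>M) = 1" if "j \<in> J" for j i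
      using ur[OF that, of UNIV i] rU[OF that] by simp
    show "(\<Sum>j\<in>J. ennreal (a j) * (\<integral>\<^sup>+t. ennreal (u j i t) * indicator A t \<partial>M)) = emeasure M A"
      if A: "A \<in> sets borel" for i A
    proof -
      have "(\<Sum>j\<in>J. ennreal (a j) * (\<integral>\<^sup>+t. ennreal (u j i t) * indicator A t \<partial>M)) = (\<Sum>j\<in>J. ennreal (a j * r j i A))"
        using a0 r0 by (intro sum.cong) (auto simp: ur A ennreal_mult less_imp_le)
      also have "\<dots> = ennreal (\<Sum>j\<in>J. a j * r j i A)"
        using a0 r0 by (intro sum_ennreal) (auto intro!: mult_nonneg_nonneg less_imp_le[of 0 "a _"])
      finally show ?thesis by (simp add: marg[OF A] emeasure_eq_measure)
    qed
  qed (rule a0)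
  define S where "S = case_sum W (\<lambda>(\<kappa>, s) i. case s of None \<Rightarrow> W (\<kappa> i) i
        | Some l \<Rightarrow> if i = l then T \<kappa> i else W (\<kappa> l) i)"
  have uS: "u j i t = 0" if "j \<in> J" "t \<notin> S j i" for j i t
    using that v(4) vE(4) by (cases rule: Jcases) (auto simp: u_def S_def split: if_splits)
  have S_swap: "x \<in> swapped" if x: "\<And>i. x i \<in> S (Inr (\<kappa>, s)) i" and k: "\<kappa> \<in> JE" for x \<kappa> s
  proof (cases s)
    case None
    then show ?thesis using x k by (auto simp: swapped_def S_def JE_def)
  next
    case (Some l)
    have "x l \<in> T \<kappa> l" using x[of l] Some by (simp add: S_def)
    moreover have "x j \<in> W (\<kappa> l) j" if "j \<noteq> l" for j using x[of j] Some that by (simp add: S_def)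
    ultimately show ?thesis using k by (auto simp: swapped_def JE_def)
  qed
  show ?thesis
  proof (intro exI[of _ PM.mix] exI[of _ PM.U] exI[of _ "\<Sum>j\<in>J. a j * (\<Prod>i\<in>(UNIV::'n set). B)"] conjI allI)
    show "PM.mix \<in> couplings M" by (rule PM.mix_coupling)
    show "PM.U \<in> borel_measurable borel" by (rule PM.U_measurable)
    show "0 \<le> PM.U x" for x by (rule PM.U_nonneg)
    show "PM.U x \<le> (\<Sum>j\<in>J. a j * (\<Prod>i\<in>(UNIV::'n set). B))" for x by (rule PM.U_le)
    show "PM.mix = density (Pi\<^sub>M UNIV (\<lambda>_. M)) (\<lambda>x. ennreal (PM.U x))" by (rule PM.mix_def)
    show "AE x in PM.mix. (\<exists>k<K. 0 < measure \<gamma> (D k) \<and> (\<forall>i. x i \<in> W k i)) \<or> x \<in> swapped"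
    proof (rule AE_mp[OF PM.AE_mix[of S]], rule uS, assumption, assumption, intro AE_I2 impI)
      fix x assume "\<exists>j\<in>J. \<forall>i. x i \<in> S j i"
      then obtain j where j: "j \<in> J" "\<And>i. x i \<in> S j i" by blast
      from j(1) show "(\<exists>k<K. 0 < measure \<gamma> (D k) \<and> (\<forall>i. x i \<in> W k i)) \<or> x \<in> swapped"
      proof (cases rule: Jcases)
        case (cell k) then show ?thesis using j(2) by (auto simp: S_def JD_def p_def)
      next
        case (orphan \<kappa>) then show ?thesis using j(2) S_swap[of x \<kappa> None] by auto
      next
        case (swap \<kappa> l) then show ?thesis using j(2) S_swap[of x \<kappa> "Some l"] by auto
      qed
    qed
    show "swap_estimate PM.mix"
      unfolding swap_estimate_def
    proof (intro allI impI)
      fix \<phi> :: "('n \<Rightarrow> 'a) \<Rightarrow> real" and z :: "nat \<Rightarrow> real" and \<omega> b Q :: real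
      assume phi: "\<phi> \<in> borel_measurable borel" "integrable PM.mix \<phi>"
        and zw: "\<forall>k x. k < K \<longrightarrow> 0 < measure \<gamma> (D k) \<longrightarrow> (\<forall>i. x i \<in> W k i) \<longrightarrow> \<phi> x \<le> z k + \<omega>"
        and zb: "\<forall>k. k < K0 \<longrightarrow> 0 < measure \<gamma> (D k) \<longrightarrow> - z k \<le> b"
        and Q: "\<forall>x\<in>swapped. \<phi> x \<le> Q" and w0: "0 \<le> \<omega>"
      have int: "integrable (product_density M (u j)) \<phi>" if "j \<in> J" for j
        by (rule PM.integrable_component[OF phi that])
      have "(\<integral>x. \<phi> x \<partial>PM.mix) = (\<Sum>j\<in>J. a j * (\<integral>x. \<phi> x \<partial>product_density M (u j)))"
        by (rule PM.integral_mix[OF phi])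
      also have "\<dots> \<le> (\<Sum>j\<in>J. a j * (case j of Inl k \<Rightarrow> z k + \<omega> | Inr _ \<Rightarrow> Q))"
      proof (intro sum_mono mult_left_mono)
        fix j assume j: "j \<in> J"
        show "(\<integral>x. \<phi> x \<partial>product_density M (u j)) \<le> (case j of Inl k \<Rightarrow> z k + \<omega> | Inr _ \<Rightarrow> Q)"
        proof (rule PM.integral_product_density_le[OF j _ int[OF j], of "S j"])
          show "u j i t = 0" if "t \<notin> S j i" for i t using uS[OF j that] .
          fix x assume x: "\<And>i. x i \<in> S j i"
          from j show "\<phi> x \<le> (case j of Inl k \<Rightarrow> z k + \<omega> | Inr _ \<Rightarrow> Q)"
          proof (cases rule: Jcases)
            case (cell k) then show ?thesis using x by (auto simp: S_def JD_def p_def intro!: zw[rule_format])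
          next
            case (orphan \<kappa>) then show ?thesis using x S_swap[of x \<kappa> None] Q by auto
          next
            case (swap \<kappa> l) then show ?thesis using x S_swap[of x \<kappa> "Some l"] Q by auto
          qed
        qed
      qed (auto simp: less_imp_le a0)
      also have "\<dots> = (\<Sum>k\<in>JD. (p k - q k) * (z k + \<omega>)) + (\<Sum>\<kappa>\<in>JE. e \<kappa> * (real CARD('n) + 1) * Q)"
        unfolding sumJ by (simp add: a_def algebra_simps)
      also have "(\<Sum>\<kappa>\<in>JE. e \<kappa> * (real CARD('n) + 1) * Q) = (real CARD('n) + 1) * measure \<gamma> R * Q"
        by (simp flip: sum_distrib_right sum_e)
      also have "(\<Sum>k\<in>JD. (p k - q k) * (z k + \<omega>)) \<le> (\<Sum>k\<in>JD. p k * z k + p k * \<omega> + q k * b)"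
      proof (rule sum_mono)
        fix k assume k: "k \<in> JD"
        \<comment> \<open>Withdrawing mass \<open>q k\<close> also removes its contribution
          \<open>q k * z k\<close>, which may be negative. This is what \<open>b\<close> pays for,
          and only donors have \<open>q k\<close> nonzero.\<close>
        have "q k * (- z k) \<le> q k * b"
        proof (cases "k < K0")
          case True
          then show ?thesis using zb[rule_format, of k] k q_nonneg[of k] by (intro mult_left_mono) (auto simp: JD_def p_def)
        qed (simp add: q_eq_0)
        moreover have "0 \<le> q k * \<omega>" using q_nonneg w0 by simp
        ultimately show "(p k - q k) * (z k + \<omega>) \<le> p k * z k + p k * \<omega> + q k * b" by (simp add: algebra_simps)
      qed
      also have "\<dots> = (\<Sum>k\<in>JD. p k * z k) + (\<Sum>k\<in>JD. p k) * \<omega> + real CARD('n) * measure \<gamma> R * b"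
        by (simp add: sum.distrib sum_distrib_right[symmetric] sum_q_total)
      also have "(\<Sum>k\<in>JD. p k) \<le> 1"
      proof -
        have "(\<Sum>k\<in>JD. p k) \<le> measure \<gamma> UNIV"
          using measure_split[of UNIV] by (simp add: p_def sum_nonneg)
        also have "\<dots> \<le> 1" by (rule G.prob_le_1)
        finally show ?thesis .
      qed
      also have "(\<Sum>k\<in>JD. p k * z k) = (\<Sum>k<K. p k * z k)"
        by (rule sum.mono_neutral_left) (auto simp: JD_def p_def not_less intro: antisym)
      finally show "(\<integral>x. \<phi> x \<partial>PM.mix) \<le> (\<Sum>k<K. measure \<gamma> (D k) * z k) + \<omega>
           + real CARD('n) * measure \<gamma> (- (\<Union>k<K. D k)) * b
           + (real CARD('n) + 1) * measure \<gamma> (- (\<Union>k<K. D k)) * Q"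
        using w0 by (simp add: p_def R_def mult_right_mono)
    qed
  qed
qed

end

section \<open>The repulsive cost\<close>

text \<open>The value \<open>B\<close> is filled in for \<open>t \<le> 0\<close> because
  \<open>real_of_ereal\<close> would turn \<open>f 0 = \<infinity>\<close> into 0; it also makes the
  function continuous on the whole line.\<close>

definition cutoff :: "(real \<Rightarrow> ereal) \<Rightarrow> real \<Rightarrow> real \<Rightarrow> real" where
  "cutoff f B t = (if t \<le> 0 then B else min B (real_of_ereal (f t)))"

lemma repulsive_profileD:
  assumes "repulsive_profile f"
  shows "f 0 = \<infinity>"
    and "0 < t \<Longrightarrow> f t = ereal (real_of_ereal (f t))"
    and "0 < s \<Longrightarrow> s \<le> t \<Longrightarrow> real_of_ereal (f t) \<le> real_of_ereal (f s)"
    and "continuous_on {0<..} (\<lambda>t. real_of_ereal (f t))"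
    and "\<exists>d>0. \<forall>t. 0 < t \<and> t < d \<longrightarrow> B < real_of_ereal (f t)"
proof -
  have fin: "\<And>t. 0 < t \<Longrightarrow> \<bar>f t\<bar> \<noteq> \<infinity>" and cont: "continuous_on {0<..} f"
    and mono: "\<And>s t. 0 < s \<Longrightarrow> s \<le> t \<Longrightarrow> f t \<le> f s" and lim: "(f \<longlongrightarrow> \<infinity>) (at_right 0)"
    using assms by (auto simp: repulsive_profile_def)
  show "f 0 = \<infinity>" using assms by (simp add: repulsive_profile_def)
  show eq: "0 < t \<Longrightarrow> f t = ereal (real_of_ereal (f t))" for t
    using fin[of t] by (simp add: ereal_real)
  show "0 < s \<Longrightarrow> s \<le> t \<Longrightarrow> real_of_ereal (f t) \<le> real_of_ereal (f s)"
    using mono[of s t] eq[of s] eq[of t] by (metis ereal_less_eq(3) less_le_trans)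
  show "continuous_on {0<..} (\<lambda>t. real_of_ereal (f t))"
    using cont fin by (subst (asm) continuous_on_iff_real) (auto simp: o_def)
  have "eventually (\<lambda>t. ereal B < f t) (at_right 0)"
    by (rule order_tendstoD(1)[OF lim]) simp
  then obtain d where d: "d > 0" "\<And>t. 0 < t \<Longrightarrow> t < d \<Longrightarrow> ereal B < f t"
    by (auto simp: eventually_at_right_field)
  then show "\<exists>d>0. \<forall>t. 0 < t \<and> t < d \<longrightarrow> B < real_of_ereal (f t)"
    using eq by (metis ereal_less(3) less_ereal.simps(1))
qed

text \<open>By (F2) \<open>f\<close> exceeds \<open>B\<close> near zero, so the function is constant
  on \<open>{..<d}\<close> for some \<open>d > 0\<close> and a minimum of continuous functions on
  the positive half-line; the two open sets cover the line.\<close>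

lemma continuous_cutoff:
  assumes "repulsive_profile f"
  shows "continuous_on UNIV (cutoff f B)"
proof -
  note fD = repulsive_profileD[OF assms]
  obtain d where d: "d > 0" "\<And>t. 0 < t \<Longrightarrow> t < d \<Longrightarrow> B < real_of_ereal (f t)" using fD(5) by blast
  have "continuous_on {..<d} (cutoff f B)"
    by (rule continuous_on_eq[of _ "\<lambda>_. B"]) (use d(2) in \<open>force simp: cutoff_def\<close>)+
  moreover have "continuous_on {0<..} (cutoff f B)"
    by (rule continuous_on_eq[of _ "\<lambda>t. min B (real_of_ereal (f t))"])
      (auto simp: cutoff_def intro!: continuous_on_min fD(4))
  ultimately have "continuous_on ({..<d} \<union> {0<..}) (cutoff f B)" by (intro continuous_on_open_Un) auto
  moreover have "{..<d} \<union> {0<..} = UNIV" using d(1) by auto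
  ultimately show ?thesis by simp
qed

text \<open>For \<open>x \<noteq> z\<close> the negative part of \<open>f (2 * dist x z)\<close>.
  The factor 2 is that of condition (B); it comes from the triangle inequality.\<close>

definition tail :: "(real \<Rightarrow> ereal) \<Rightarrow> 'a::metric_space \<Rightarrow> 'a \<Rightarrow> real" where
  "tail f z x = - cutoff f 0 (2 * dist x z)"

lemma tail_nonneg: "0 \<le> tail f z x"
  by (simp add: tail_def cutoff_def)

lemma continuous_tail:
  assumes "repulsive_profile f"
  shows "continuous_on UNIV (tail f z)"
  unfolding tail_def
  by (intro continuous_intros continuous_on_compose2[OF continuous_cutoff[OF assms]]) auto

text \<open>Monotonicity compares everything with the value \<open>c\<close> of \<open>f\<close> at
  \<open>2 * r0\<close>: inside the ball the tail is at most \<open>|c|\<close>, and outside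
  \<open>f\<close> is at most \<open>c\<close>. The positive part outside must be shown finite
  before (B) is used, because \<open>\<infinity> - \<infinity> = \<infinity>\<close> in
  \<open>ereal\<close>; only then does (B) force the negative part to be finite.\<close>

lemma (in borel_prob) controlled_tail_integrable:
  assumes prof: "repulsive_profile f" and "controlled_tail f M"
  shows "\<exists>z. integrable M (tail f z)"
proof -
  note fD = repulsive_profileD[OF prof]
  obtain z r0 where r0: "r0 > 0"
    and B: "ereal_integral (restrict_space M (- ball z r0)) (\<lambda>x. f (2 * dist x z)) > -\<infinity>"
    using assms(2) by (auto simp: controlled_tail_def)
  define c where "c = real_of_ereal (f (2 * r0))"
  have ball: "- ball z r0 \<in> sets M" by (simp add: M_borel)
  have tm: "tail f z \<in> borel_measurable borel"
    by (intro borel_measurable_continuous_onI continuous_tail prof)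
  have ns: "nn_integral (restrict_space M (- ball z r0)) g = (\<integral>\<^sup>+x. g x * indicator (- ball z r0) x \<partial>M)" for g
    using ball by (subst nn_integral_restrict_space) auto
  have out: "f (2 * dist x z) = ereal (real_of_ereal (f (2 * dist x z)))" "real_of_ereal (f (2 * dist x z)) \<le> c"
    if "x \<in> - ball z r0" for x
    using that r0 by (auto simp: c_def dist_commute intro!: fD(2,3))
  have "(\<integral>\<^sup>+x. e2ennreal (f (2 * dist x z)) * indicator (- ball z r0) x \<partial>M) \<le> (\<integral>\<^sup>+x. ennreal c \<partial>M)"
  proof (rule nn_integral_mono)
    fix x show "e2ennreal (f (2 * dist x z)) * indicator (- ball z r0) x \<le> ennreal c"
    proof (cases "x \<in> - ball z r0")
      case True
      have "e2ennreal (f (2 * dist x z)) \<le> ennreal c"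
        by (subst out(1)[OF True]) (use out(2)[OF True] in \<open>simp add: ennreal_leI\<close>)
      then show ?thesis by (simp only: indicator_simps(1)[OF True] mult_1_right)
    qed simp
  qed
  also have "\<dots> < \<infinity>" by (simp add: emeasure_space_1[unfolded M_space])
  finally have pos: "(\<integral>\<^sup>+x. e2ennreal (f (2 * dist x z)) * indicator (- ball z r0) x \<partial>M) < \<infinity>" .
  have neg: "(\<integral>\<^sup>+x. e2ennreal (- f (2 * dist x z)) * indicator (- ball z r0) x \<partial>M) < \<infinity>"
  proof (rule ccontr)
    assume "\<not> ?thesis"
    then have "(\<integral>\<^sup>+x. e2ennreal (- f (2 * dist x z)) * indicator (- ball z r0) x \<partial>M) = \<infinity>"
      by (simp add: less_top[symmetric])
    then show False using B pos
      by (cases "\<integral>\<^sup>+x. e2ennreal (f (2 * dist x z)) * indicator (- ball z r0) x \<partial>M")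
        (auto simp: ereal_integral_def ns)
  qed
  have "(\<integral>\<^sup>+x. ennreal (tail f z x) \<partial>M)
    \<le> (\<integral>\<^sup>+x. ennreal \<bar>c\<bar> + e2ennreal (- f (2 * dist x z)) * indicator (- ball z r0) x \<partial>M)"
  proof (rule nn_integral_mono)
    fix x show "ennreal (tail f z x) \<le> ennreal \<bar>c\<bar> + e2ennreal (- f (2 * dist x z)) * indicator (- ball z r0) x"
    proof (cases "x \<in> - ball z r0")
      case True
      have "ennreal (tail f z x) \<le> e2ennreal (- f (2 * dist x z))"
        by (subst out(1)[OF True]) (auto simp: tail_def cutoff_def min_def ennreal_neg)
      then show ?thesis by (simp only: indicator_simps(1)[OF True] mult_1_right add_increasing zero_le)
    next
      case False
      have "tail f z x \<le> \<bar>c\<bar>"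
      proof (cases "dist x z = 0")
        case nz: False
        then have "c \<le> real_of_ereal (f (2 * dist x z))"
          unfolding c_def using False by (intro fD(3)) (auto simp: dist_commute)
        then show ?thesis by (auto simp: tail_def cutoff_def min_def)
      qed (simp add: tail_def cutoff_def)
      then show ?thesis using False by (simp add: ennreal_leI)
    qed
  qed
  also have "\<dots> < \<infinity>"
  proof -
    have fm: "(\<lambda>x. e2ennreal (- f (2 * dist x z)) * indicator (- ball z r0) x) \<in> borel_measurable M"
    proof -
      have "(\<lambda>x. ennreal (tail f z x) * indicator (- ball z r0) x) \<in> borel_measurable borel"
        using tm by measurable
      moreover have "e2ennreal (- f (2 * dist x z)) * indicator (- ball z r0) x = ennreal (tail f z x) * indicator (- ball z r0) x" for x
      proof (cases "x \<in> - ball z r0")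
        case True
        have "0 < dist x z" using True r0 by (auto simp: dist_commute)
        then have "e2ennreal (- f (2 * dist x z)) = ennreal (tail f z x)"
          by (subst out(1)[OF True]) (auto simp: tail_def cutoff_def min_def ennreal_neg)
        then show ?thesis by simp
      qed simp
      ultimately show ?thesis by simp
    qed
    show ?thesis using neg
      by (subst nn_integral_add[OF _ fm]) (auto simp: emeasure_space_1[unfolded M_space])
  qed
  finally have "(\<integral>\<^sup>+x. ennreal (tail f z x) \<partial>M) < \<infinity>" .
  then have "integrable M (tail f z)"
    using tm by (intro integrableI_nonneg) (auto simp: tail_nonneg)
  then show ?thesis by blast
qed

locale repulsive_cost = borel_prob M for M :: "'a::polish_space measure" +
  fixes f :: "real \<Rightarrow> ereal" and z0 :: 'a
  assumes profile: "repulsive_profile f"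
    and tail_integrable: "integrable M (tail f z0)"
begin

abbreviation fr :: "real \<Rightarrow> real" where "fr t \<equiv> real_of_ereal (f t)"
abbreviation h :: "'a \<Rightarrow> real" where "h \<equiv> tail f z0"

lemmas fD = repulsive_profileD[OF profile]

lemma h_measurable: "h \<in> borel_measurable borel"
  by (intro borel_measurable_continuous_onI continuous_tail profile)

text \<open>If \<open>x\<close> is the point farther from \<open>z0\<close>, then
  \<open>dist x y \<le> 2 * dist x z0\<close>, and monotonicity gives
  \<open>fr (dist x y) \<ge> fr (2 * dist x z0) \<ge> - h x\<close>. Adding both tails makes the
  bound symmetric.\<close>

lemma fr_lower: "x \<noteq> y \<Longrightarrow> 0 \<le> fr (dist x y) + h x + h y"
proof (induction "dist y z0" "dist x z0" arbitrary: x y rule: linorder_wlog)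
  case le
  have d: "dist x y \<le> 2 * dist x z0" using dist_triangle2[of x y z0] le by simp
  moreover have "0 < dist x y" using le by simp
  ultimately have "fr (2 * dist x z0) \<le> fr (dist x y)" by (intro fD(3))
  moreover have "- h x \<le> fr (2 * dist x z0)"
    using d \<open>0 < dist x y\<close> by (auto simp: tail_def cutoff_def)
  ultimately show ?case using tail_nonneg[of f z0 y] by simp
next
  case sym
  then show ?case by (simp add: dist_commute add.commute add.left_commute)
qed

definition pairs :: "('n::{finite,linorder} \<times> 'n) set" where "pairs = {(i, j). i < j}"
text \<open>Real-valued version of \<open>pair_cost\<close>. The value 0 at tuples with a repeated
  coordinate, where \<open>pair_cost\<close> is \<open>\<infinity>\<close>, is a default; under a
  coupling of finite cost these tuples form a null set.\<close>

definition cost :: "('n::{finite,linorder} \<Rightarrow> 'a) \<Rightarrow> real" where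
  "cost x = (if inj x then \<Sum>(i, j)\<in>pairs. fr (dist (x i) (x j)) else 0)"
definition H :: "('n::{finite,linorder} \<Rightarrow> 'a) \<Rightarrow> real" where
  "H x = (\<Sum>(i, j)\<in>pairs. h (x i) + h (x j))"

lemma pairs_neq: "(i, j) \<in> pairs \<Longrightarrow> inj x \<Longrightarrow> x i \<noteq> x j"
  by (auto simp: pairs_def dest: injD)

lemma pair_cost_eq: "pair_cost f x = (if inj x then ereal (cost x) else \<infinity>)"
proof (cases "inj x")
  case True
  have "pair_cost f x = (\<Sum>(i, j)\<in>pairs. ereal (fr (dist (x i) (x j))))"
    unfolding pair_cost_def pairs_def[symmetric]
    by (intro sum.cong) (auto intro!: fD(2) dest: pairs_neq[OF _ True])
  also have "\<dots> = ereal (cost x)" using True by (simp add: cost_def case_prod_beta)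
  finally show ?thesis using True by simp
next
  case False
  then obtain i j where "i \<noteq> j" "x i = x j" by (auto simp: inj_def)
  then have "\<exists>i j. i < j \<and> x i = x j" by (metis linorder_neqE)
  then have "\<exists>p\<in>pairs. (case p of (i, j) \<Rightarrow> f (dist (x i) (x j))) = \<infinity>"
    using fD(1) by (fastforce simp: pairs_def)
  then have "pair_cost f x = \<infinity>"
    unfolding pair_cost_def pairs_def[symmetric] by (subst sum_Pinfty) simp
  then show ?thesis using False by simp
qed

lemma cost_lower: "inj x \<Longrightarrow> 0 \<le> cost x + H x"
  unfolding cost_def H_def
  by (auto simp flip: sum.distrib intro!: sum_nonneg dest!: pairs_neq dest: fr_lower simp: case_prod_beta add.assoc[symmetric])

lemma H_nonneg: "0 \<le> H x"
  unfolding H_def by (intro sum_nonneg) (auto simp: tail_nonneg)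

lemma open_inj: "open {x::'n::{finite,linorder} \<Rightarrow> 'a. inj x}"
proof -
  have "{x::'n \<Rightarrow> 'a. inj x} = (\<Inter>(i, j)\<in>{(i, j). i \<noteq> j}. {x. x i \<noteq> x j})"
    by (auto simp: inj_def)
  also have "open \<dots>"
    by (intro open_INT) (auto intro!: open_Collect_neq continuous_on_product_coordinates)
  finally show ?thesis .
qed

lemma inj_borel: "{x::'n::{finite,linorder} \<Rightarrow> 'a. inj x} \<in> sets borel"
  by (rule borel_open[OF open_inj])

lemma inj_pred [measurable]: "Measurable.pred borel (inj :: ('n::{finite,linorder} \<Rightarrow> 'a) \<Rightarrow> bool)"
  using inj_borel by (simp add: pred_def)

lemma continuous_cost: "continuous_on {x. inj x} (cost :: ('n::{finite,linorder} \<Rightarrow> 'a) \<Rightarrow> real)"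
proof -
  have "continuous_on {x::'n \<Rightarrow> 'a. inj x} (\<lambda>x. \<Sum>(i, j)\<in>pairs. fr (dist (x i) (x j)))"
    unfolding case_prod_beta
    by (intro continuous_on_sum continuous_on_compose2[OF fD(4)] continuous_on_dist
        continuous_on_subset[OF continuous_on_product_coordinates])
      (auto dest: pairs_neq)
  then show ?thesis by (rule continuous_on_eq) (simp add: cost_def)
qed

lemma cost_measurable: "(cost :: ('n::{finite,linorder} \<Rightarrow> 'a) \<Rightarrow> real) \<in> borel_measurable borel"
proof -
  have eq: "(\<lambda>x. indicator {x. inj x} x *\<^sub>R cost x) = (cost :: ('n \<Rightarrow> 'a) \<Rightarrow> real)"
    by (auto simp: cost_def indicator_def)
  show ?thesis
    by (subst eq[symmetric]) (rule borel_measurable_continuous_on_indicator[OF inj_borel continuous_cost])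
qed

lemma pair_cost_measurable: "(pair_cost f :: ('n::{finite,linorder} \<Rightarrow> 'a) \<Rightarrow> ereal) \<in> borel_measurable borel"
proof -
  show ?thesis unfolding pair_cost_eq[abs_def] using cost_measurable by measurable
qed

section \<open>The transport cost as the integral of a nonnegative function minus a constant\<close>

definition IH :: "'n::{finite,linorder} itself \<Rightarrow> real" where
  "IH _ = (\<Sum>(i, j)\<in>(pairs :: ('n \<times> 'n) set). 2 * (\<integral>t. h t \<partial>M))"

lemma couplingsD:
  fixes \<gamma> :: "('n::finite \<Rightarrow> 'a) measure"
  assumes "\<gamma> \<in> couplings M"
  shows "\<gamma> \<in> borel_prob_measures" "distr \<gamma> borel (\<lambda>x. x i) = M"
    "(\<lambda>x. x i) \<in> measurable \<gamma> borel"
proof -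
  show b: "\<gamma> \<in> borel_prob_measures" "distr \<gamma> borel (\<lambda>x. x i) = M"
    using assms by (auto simp: couplings_def)
  show "(\<lambda>x. x i) \<in> measurable \<gamma> borel"
    using borel_prob_measuresD(1)[OF b(1)] measurable_product_coordinates
    by (metis measurable_cong_sets)
qed

text \<open>Every summand depends on one coordinate only, so the coupling enters through its
  marginals alone. The constant \<open>IH\<close> takes the index type as an argument because it
  counts the pairs.\<close>

lemma H_integral:
  fixes \<gamma> :: "('n::{finite,linorder} \<Rightarrow> 'a) measure"
  assumes g: "\<gamma> \<in> couplings M"
  shows "integrable \<gamma> H" "(\<integral>x. H x \<partial>\<gamma>) = IH TYPE('n)"
proof -
  have hi: "integrable \<gamma> (\<lambda>x. h (x i))" and hv: "(\<integral>x. h (x i) \<partial>\<gamma>) = (\<integral>t. h t \<partial>M)" for i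
    using tail_integrable couplings_integral(2,3)[OF g h_measurable] by auto
  show "integrable \<gamma> H" unfolding H_def case_prod_beta by (intro Bochner_Integration.integrable_sum Bochner_Integration.integrable_add hi)
  have "(\<integral>x. H x \<partial>\<gamma>) = (\<Sum>p\<in>pairs. \<integral>x. h (x (fst p)) + h (x (snd p)) \<partial>\<gamma>)"
    unfolding H_def case_prod_beta by (intro Bochner_Integration.integral_sum Bochner_Integration.integrable_add hi)
  also have "\<dots> = IH TYPE('n)"
    unfolding IH_def case_prod_beta by (intro sum.cong) (simp_all add: hi hv)
  finally show "(\<integral>x. H x \<partial>\<gamma>) = IH TYPE('n)" .
qed

lemma H_measurable: "(H :: ('n::{finite,linorder} \<Rightarrow> 'a) \<Rightarrow> real) \<in> borel_measurable borel"
  unfolding H_def case_prod_beta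
  by (intro borel_measurable_sum borel_measurable_add measurable_compose[OF measurable_product_coordinates h_measurable])

text \<open>Nonnegative by \<open>cost_lower\<close>, so the value in \<open>ennreal\<close> loses
  nothing on injective tuples and Fatou's lemma becomes available.\<close>

definition shifted :: "('n::{finite,linorder} \<Rightarrow> 'a) \<Rightarrow> ennreal" where
  "shifted x = (if inj x then ennreal (cost x + H x) else \<infinity>)"

lemma shifted_measurable: "(shifted :: ('n::{finite,linorder} \<Rightarrow> 'a) \<Rightarrow> ennreal) \<in> borel_measurable borel"
proof -
  show ?thesis unfolding shifted_def[abs_def] using cost_measurable H_measurable by measurable
qed

text \<open>Pointwise, the positive part of the cost plus \<open>H\<close> equals
  \<open>shifted\<close> plus the negative part. The negative part is at most \<open>H\<close>, so
  its integral is finite and can be cancelled, also when the transport cost is infinite.\<close>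

lemma transport_cost_shifted:
  fixes \<gamma> :: "('n::{finite,linorder} \<Rightarrow> 'a) measure"
  assumes g: "\<gamma> \<in> couplings M"
  shows "transport_cost f \<gamma> = enn2ereal (\<integral>\<^sup>+x. shifted x \<partial>\<gamma>) - ereal (IH TYPE('n))"
proof -
  define A where "A = (\<integral>\<^sup>+x. e2ennreal (pair_cost f x) \<partial>\<gamma>)"
  define B where "B = (\<integral>\<^sup>+x. e2ennreal (- pair_cost f x) \<partial>\<gamma>)"
  have pm: "pair_cost f \<in> borel_measurable \<gamma>" "shifted \<in> borel_measurable \<gamma>" "H \<in> borel_measurable \<gamma>"
    using pair_cost_measurable shifted_measurable H_measurable borel_prob_measuresD(1)[OF couplingsD(1)[OF g]]
    by (metis measurable_cong_sets)+
  note pm[measurable]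
  have IH: "(\<integral>\<^sup>+x. ennreal (H x) \<partial>\<gamma>) = ennreal (IH TYPE('n))"
    using H_integral[OF g] H_nonneg by (subst nn_integral_eq_integral) auto
  have IH0: "0 \<le> IH TYPE('n)" unfolding H_integral(2)[OF g, symmetric] by (rule integral_nonneg_AE) (simp add: H_nonneg)
  have pt: "e2ennreal (pair_cost f x) + ennreal (H x) = shifted x + e2ennreal (- pair_cost f x)" for x :: "'n \<Rightarrow> 'a"
  proof (cases "inj x")
    case True
    have "ennreal (cost x) + ennreal (H x) = ennreal (cost x + H x) + ennreal (- cost x)"
    proof (cases "0 \<le> cost x")
      case True then show ?thesis using H_nonneg[of x] by (simp add: ennreal_neg)
    next
      case False
      then show ?thesis using cost_lower[OF True] by (simp add: ennreal_neg ennreal_plus[symmetric] del: ennreal_plus)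
    qed
    then show ?thesis using True by (simp add: pair_cost_eq shifted_def)
  qed (simp add: pair_cost_eq shifted_def)
  have "A + ennreal (IH TYPE('n)) = (\<integral>\<^sup>+x. e2ennreal (pair_cost f x) + ennreal (H x) \<partial>\<gamma>)"
    unfolding A_def IH[symmetric] by (subst nn_integral_add) auto
  also have "\<dots> = (\<integral>\<^sup>+x. shifted x \<partial>\<gamma>) + B"
    unfolding pt B_def by (subst nn_integral_add) auto
  finally have eq: "A + ennreal (IH TYPE('n)) = (\<integral>\<^sup>+x. shifted x \<partial>\<gamma>) + B" .
  have "B \<le> ennreal (IH TYPE('n))"
    unfolding B_def IH[symmetric]
  proof (rule nn_integral_mono)
    fix x :: "'n \<Rightarrow> 'a"
    show "e2ennreal (- pair_cost f x) \<le> ennreal (H x)"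
      using cost_lower[of x] by (auto simp: pair_cost_eq e2ennreal_neg intro!: ennreal_leI)
  qed
  then obtain b where b: "B = ennreal b" "0 \<le> b" by (metis ennreal_cases ennreal_neq_top top.extremum_uniqueI)
  have "transport_cost f \<gamma> = enn2ereal A - enn2ereal B"
    by (simp add: transport_cost_def ereal_integral_def A_def B_def)
  also have "\<dots> = enn2ereal (\<integral>\<^sup>+x. shifted x \<partial>\<gamma>) - ereal (IH TYPE('n))"
  proof (cases A)
    case (real a)
    then obtain s where s: "(\<integral>\<^sup>+x. shifted x \<partial>\<gamma>) = ennreal s" "0 \<le> s"
      using eq IH0 by (cases "\<integral>\<^sup>+x. shifted x \<partial>\<gamma>") (auto simp flip: ennreal_plus)
    have "a + IH TYPE('n) = s + b"
      using eq real s b IH0 by (simp flip: ennreal_plus)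
    then show ?thesis using real s b by (simp add: enn2ereal_ennreal)
  next
    case top
    then have "(\<integral>\<^sup>+x. shifted x \<partial>\<gamma>) = top" using eq b by (cases "\<integral>\<^sup>+x. shifted x \<partial>\<gamma>") (auto simp flip: ennreal_plus)
    then show ?thesis using top b by (simp add: enn2ereal_ennreal)
  qed
  finally show ?thesis .
qed

lemma transport_cost_eq_integral:
  fixes \<gamma> :: "('n::{finite,linorder} \<Rightarrow> 'a) measure"
  assumes "AE x in \<gamma>. inj x" "integrable \<gamma> cost"
  shows "transport_cost f \<gamma> = ereal (\<integral>x. cost x \<partial>\<gamma>)"
  unfolding transport_cost_def
  by (subst ereal_integral_eq_integral[OF assms(2), symmetric], rule ereal_integral_cong_AE)
    (use assms(1) in \<open>auto simp: pair_cost_eq\<close>)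

text \<open>On injective tuples \<open>- H\<close> is an integrable lower bound for the cost, so an
  upper bound is enough.\<close>

lemma cost_integrableI:
  fixes \<gamma> :: "('n::{finite,linorder} \<Rightarrow> 'a) measure"
  assumes g: "\<gamma> \<in> couplings M" and "AE x in \<gamma>. inj x" "AE x in \<gamma>. cost x \<le> C"
  shows "integrable \<gamma> cost"
proof (rule Bochner_Integration.integrable_bound)
  interpret G: prob_space \<gamma> by (rule borel_prob_measuresD(3)[OF couplingsD(1)[OF g]])
  show "integrable \<gamma> (\<lambda>x. \<bar>C\<bar> + H x)" using H_integral(1)[OF g] by simp
  show "cost \<in> borel_measurable \<gamma>"
    using cost_measurable borel_prob_measuresD(1)[OF couplingsD(1)[OF g]] by (metis measurable_cong_sets)
  show "AE x in \<gamma>. norm (cost x) \<le> norm (\<bar>C\<bar> + H x)"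
    using assms(2,3)
  proof eventually_elim
    case (elim x)
    then show ?case using cost_lower[of x] H_nonneg[of x] by simp
  qed
qed

text \<open>The integral of \<open>shifted\<close> is finite, hence \<open>shifted\<close> is finite
  almost everywhere, which forces injectivity; subtracting the integrable \<open>H\<close> leaves
  the cost.\<close>

lemma transport_cost_finite:
  fixes \<gamma> :: "('n::{finite,linorder} \<Rightarrow> 'a) measure"
  assumes g: "\<gamma> \<in> couplings M" and fin: "transport_cost f \<gamma> \<noteq> \<infinity>"
  shows "AE x in \<gamma>. inj x" "integrable \<gamma> cost"
proof -
  have pm: "cost \<in> borel_measurable \<gamma>" "shifted \<in> borel_measurable \<gamma>" "H \<in> borel_measurable \<gamma>"
    using cost_measurable shifted_measurable H_measurable borel_prob_measuresD(1)[OF couplingsD(1)[OF g]]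
    by (metis measurable_cong_sets)+
  note pm[measurable]
  have S: "(\<integral>\<^sup>+x. shifted x \<partial>\<gamma>) \<noteq> \<infinity>"
    using fin unfolding transport_cost_shifted[OF g] by auto
  have "AE x in \<gamma>. shifted x \<noteq> \<infinity>" by (rule nn_integral_PInf_AE[OF pm(2) S])
  then show inj: "AE x in \<gamma>. inj x" by (rule AE_mp) (auto simp: shifted_def)
  have "(\<integral>\<^sup>+x. ennreal (cost x + H x) \<partial>\<gamma>) = (\<integral>\<^sup>+x. shifted x \<partial>\<gamma>)"
    by (rule nn_integral_cong_AE, rule AE_mp[OF inj]) (auto simp: shifted_def)
  then have "integrable \<gamma> (\<lambda>x. cost x + H x)"
    using S inj by (intro integrableI_nonneg) (auto simp: less_top[symmetric] intro: AE_mp[OF inj] cost_lower)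
  from Bochner_Integration.integrable_diff[OF this H_integral(1)[OF g]] show "integrable \<gamma> cost" by simp
qed

text \<open>A bounded continuous minorant of \<open>shifted\<close> takes two truncations: the
  cutoff at \<open>k\<close> removes the singularity on the diagonals, the outer minimum bounds the
  tails.\<close>

definition trunc :: "nat \<Rightarrow> ('n::{finite,linorder} \<Rightarrow> 'a) \<Rightarrow> real" where
  "trunc k x = (\<Sum>(i, j)\<in>pairs. min (real k) (cutoff f (real k) (dist (x i) (x j)) + h (x i) + h (x j)))"

lemma trunc_continuous: "continuous_on UNIV (trunc k :: ('n::{finite,linorder} \<Rightarrow> 'a) \<Rightarrow> real)"
  unfolding trunc_def case_prod_beta
  by (intro continuous_on_sum continuous_on_min continuous_on_add continuous_on_const
     continuous_on_compose2[OF continuous_cutoff[OF profile]] continuous_on_compose2[OF continuous_tail[OF profile]]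
     continuous_on_dist continuous_on_product_coordinates) auto

lemma trunc_term:
  "0 \<le> min (real k) (cutoff f (real k) (dist a b) + h a + h b)"
  "a \<noteq> b \<Longrightarrow> min (real k) (cutoff f (real k) (dist a b) + h a + h b) \<le> fr (dist a b) + h a + h b"
  "a = b \<Longrightarrow> min (real k) (cutoff f (real k) (dist a b) + h a + h b) = real k"
  using fr_lower[of a b] tail_nonneg[of f z0 a] tail_nonneg[of f z0 b]
  by (cases "a = b"; auto simp: cutoff_def)+

lemma trunc_bounds: "0 \<le> trunc k x" "\<bar>trunc k (x :: 'n::{finite,linorder} \<Rightarrow> 'a)\<bar> \<le> real (card (pairs :: ('n \<times> 'n) set)) * real k"
proof -
  show 0: "0 \<le> trunc k x" unfolding trunc_def case_prod_beta by (intro sum_nonneg trunc_term(1))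
  have "trunc k x \<le> (\<Sum>p\<in>(pairs :: ('n \<times> 'n) set). real k)"
    unfolding trunc_def case_prod_beta by (intro sum_mono) simp
  then show "\<bar>trunc k x\<bar> \<le> real (card (pairs :: ('n \<times> 'n) set)) * real k" using 0 by simp
qed

lemma trunc_le_shifted: "ennreal (trunc k x) \<le> shifted x"
proof (cases "inj x")
  case True
  have "trunc k x \<le> cost x + H x"
    unfolding trunc_def cost_def H_def using True
    by (auto simp flip: sum.distrib simp: case_prod_beta add.assoc[symmetric] intro!: sum_mono trunc_term(2) dest: pairs_neq)
  then show ?thesis using True by (simp add: shifted_def ennreal_leI)
qed (simp add: shifted_def)

text \<open>At an injective tuple both truncations are inactive from some \<open>k\<close> on. At
  any other tuple one coinciding pair already contributes \<open>k\<close>, and the remaining terms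
  are nonnegative.\<close>

lemma trunc_tendsto: "(\<lambda>k. ennreal (trunc k x)) \<longlonglongrightarrow> shifted (x :: 'n::{finite,linorder} \<Rightarrow> 'a)"
proof (cases "inj x")
  case True
  have "eventually (\<lambda>k. trunc k x = cost x + H x) sequentially"
  proof -
    have "eventually (\<lambda>k. \<forall>p\<in>(pairs :: ('n \<times> 'n) set).
        \<bar>fr (dist (x (fst p)) (x (snd p)))\<bar> + h (x (fst p)) + h (x (snd p)) \<le> real k) sequentially"
      using filterlim_real_sequentially[unfolded filterlim_at_top]
      by (intro eventually_ball_finite) auto
    then show ?thesis
    proof eventually_elim
      case (elim k)
      have "min (real k) (cutoff f (real k) (dist (x i) (x j)) + h (x i) + h (x j)) = fr (dist (x i) (x j)) + (h (x i) + h (x j))"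
        if "(i, j) \<in> pairs" for i j
      proof -
        define a where "a = fr (dist (x i) (x j))"
        have "\<bar>a\<bar> + h (x i) + h (x j) \<le> real k" using elim[rule_format, OF that] by (simp only: a_def fst_conv snd_conv)
        moreover have "cutoff f (real k) (dist (x i) (x j)) = min (real k) a"
          using pairs_neq[OF that True] by (simp add: cutoff_def a_def)
        moreover have "0 \<le> h (x i)" "0 \<le> h (x j)" by (rule tail_nonneg)+
        ultimately show ?thesis unfolding a_def[symmetric] by linarith
      qed
      then show ?case
        unfolding trunc_def cost_def H_def using True by (auto simp flip: sum.distrib intro!: sum.cong)
    qed
  qed
  then have "(\<lambda>k. trunc k x) \<longlonglongrightarrow> cost x + H x" by (rule tendsto_eventually)
  then show ?thesis using True by (simp add: shifted_def tendsto_ennrealI)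
next
  case False
  then obtain i j where ij: "i < j" "x i = x j" by (auto simp: inj_def) (metis linorder_neqE)
  have "real k \<le> trunc k x" for k
  proof -
    have "(case (i, j) of (i, j) \<Rightarrow> min (real k) (cutoff f (real k) (dist (x i) (x j)) + h (x i) + h (x j))) \<le> trunc k x"
      unfolding trunc_def using ij trunc_term(1)
      by (intro member_le_sum) (auto simp: pairs_def)
    then show ?thesis using trunc_term(3)[of "x i" "x j" k] ij by simp
  qed
  then have "filterlim (\<lambda>k. trunc k x) at_top sequentially"
    by (intro filterlim_at_top_mono[OF filterlim_real_sequentially]) auto
  then show ?thesis using False by (simp add: shifted_def ennreal_tendsto_top_eq_at_top)
qed

text \<open>Fatou yields one \<open>k\<close> for which the integral of \<open>trunc k\<close>
  against \<open>\<gamma>\<close> exceeds the shifted level \<open>w\<close>; \<open>trunc k\<close>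
  is an admissible test function and lies below \<open>shifted\<close>. The implication in the
  conclusion allows for members of the sequence that are not couplings.\<close>

lemma transport_cost_lsc:
  fixes \<gamma> :: "('n::{finite,linorder} \<Rightarrow> 'a) measure"
  assumes g: "\<gamma> \<in> couplings M" and conv: "narrowly_converges \<gamma>s \<gamma>" and y: "y < transport_cost f \<gamma>"
  shows "eventually (\<lambda>n. \<gamma>s n \<in> couplings M \<longrightarrow> y < transport_cost f (\<gamma>s n)) sequentially"
proof -
  let ?I = "IH TYPE('n)"
  define w where "w = y + ereal ?I"
  have shift: "y < s - ereal ?I \<longleftrightarrow> w < s" for s
    unfolding w_def by (cases y; cases s) auto
  have bd: "bounded (range (trunc k :: ('n \<Rightarrow> 'a) \<Rightarrow> real))" for k
    using trunc_bounds(2) by (intro boundedI) auto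
  have int: "(\<integral>\<^sup>+x. ennreal (trunc k x) \<partial>\<kappa>) = ennreal (\<integral>x. trunc k x \<partial>\<kappa>)" "0 \<le> (\<integral>x. trunc k x \<partial>\<kappa>)"
    if k: "\<kappa> \<in> couplings M" for k and \<kappa> :: "('n \<Rightarrow> 'a) measure"
  proof -
    interpret K: prob_space \<kappa> by (rule borel_prob_measuresD(3)[OF couplingsD(1)[OF k]])
    have "trunc k \<in> borel_measurable \<kappa>"
      using borel_measurable_continuous_onI[OF trunc_continuous] borel_prob_measuresD(1)[OF couplingsD(1)[OF k]]
      by (metis measurable_cong_sets)
    then have "integrable \<kappa> (trunc k)"
      using trunc_bounds(2) by (intro K.integrable_const_bound) auto
    then show "(\<integral>\<^sup>+x. ennreal (trunc k x) \<partial>\<kappa>) = ennreal (\<integral>x. trunc k x \<partial>\<kappa>)"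
      using trunc_bounds(1) by (intro nn_integral_eq_integral) auto
    show "0 \<le> (\<integral>x. trunc k x \<partial>\<kappa>)" by (rule integral_nonneg_AE) (simp add: trunc_bounds(1))
  qed
  have wS: "w < enn2ereal (\<integral>\<^sup>+x. shifted x \<partial>\<gamma>)"
    using y unfolding transport_cost_shifted[OF g] shift .
  have "\<exists>k. w < ereal (\<integral>x. trunc k x \<partial>\<gamma>)"
  \<comment> \<open>The passage to \<open>ennreal\<close> requires a nonnegative level; a negative
    one lies below the integral of any \<open>trunc k\<close>, here \<open>k = 0\<close>.\<close>
  proof (cases "0 \<le> w")
    case True
    have tm: "(\<lambda>x. ennreal (trunc k x)) \<in> borel_measurable \<gamma>" for k
    proof -
      have "trunc k \<in> borel_measurable \<gamma>"
        using borel_measurable_continuous_onI[OF trunc_continuous, of k]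
          measurable_cong_sets[OF borel_prob_measuresD(1)[OF couplingsD(1)[OF g]] refl] by blast
      then show ?thesis by simp
    qed
    have "e2ennreal w < (\<integral>\<^sup>+x. shifted x \<partial>\<gamma>)"
      using wS True by (simp add: less_ennreal.rep_eq enn2ereal_e2ennreal)
    also have "\<dots> = (\<integral>\<^sup>+x. liminf (\<lambda>k. ennreal (trunc k x)) \<partial>\<gamma>)"
      by (intro nn_integral_cong lim_imp_Liminf[symmetric] trunc_tendsto) simp
    also have "\<dots> \<le> liminf (\<lambda>k. \<integral>\<^sup>+x. ennreal (trunc k x) \<partial>\<gamma>)"
      by (rule nn_integral_liminf[OF tm])
    finally have "eventually (\<lambda>k. e2ennreal w < (\<integral>\<^sup>+x. ennreal (trunc k x) \<partial>\<gamma>)) sequentially"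
      by (rule less_LiminfD)
    then obtain k where "e2ennreal w < (\<integral>\<^sup>+x. ennreal (trunc k x) \<partial>\<gamma>)"
      using eventually_happens by force
    then have "w < ereal (\<integral>x. trunc k x \<partial>\<gamma>)"
      unfolding int(1)[OF g] less_ennreal.rep_eq using True int(2)[OF g]
      by (simp add: enn2ereal_e2ennreal enn2ereal_ennreal)
    then show ?thesis ..
  next
    case False
    then have "w < ereal (\<integral>x. trunc 0 x \<partial>\<gamma>)"
      using int(2)[OF g, of 0] by (metis ereal_less_eq(5) leI le_less_trans not_le)
    then show ?thesis ..
  qed
  then obtain k where k: "w < ereal (\<integral>x. trunc k x \<partial>\<gamma>)" ..
  have "(\<lambda>n. \<integral>x. trunc k x \<partial>\<gamma>s n) \<longlonglongrightarrow> (\<integral>x. trunc k x \<partial>\<gamma>)"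
    using conv[unfolded narrowly_converges_def, rule_format, of "trunc k"] trunc_continuous bd by blast
  then have "(\<lambda>n. ereal (\<integral>x. trunc k x \<partial>\<gamma>s n)) \<longlonglongrightarrow> ereal (\<integral>x. trunc k x \<partial>\<gamma>)" by simp
  from order_tendstoD(1)[OF this k] show ?thesis
  proof (eventually_elim, intro impI)
    fix n assume n: "w < ereal (\<integral>x. trunc k x \<partial>\<gamma>s n)" and c: "\<gamma>s n \<in> couplings M"
    note n
    also have "ereal (\<integral>x. trunc k x \<partial>\<gamma>s n) = enn2ereal (\<integral>\<^sup>+x. ennreal (trunc k x) \<partial>\<gamma>s n)"
      using int[OF c] by (simp add: enn2ereal_ennreal)
    also have "\<dots> \<le> enn2ereal (\<integral>\<^sup>+x. shifted x \<partial>\<gamma>s n)"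
      unfolding less_eq_ennreal.rep_eq[symmetric] by (intro nn_integral_mono trunc_le_shifted)
    finally show "y < transport_cost f (\<gamma>s n)" unfolding transport_cost_shifted[OF c] shift .
  qed
qed

end

section \<open>Approximation by bounded densities\<close>

text \<open>\<open>2 * (N - 1) * s\<close> will bound the total mass of the sets to be avoided in
  the selection of tuples. It is below \<open>2 / (N * (N - 1))\<close>, and
  \<open>2 \<le> N * (N - 1)\<close>.\<close>

lemma (in borel_prob) small_concentrationD:
  assumes "small_concentration N M" and N: "2 \<le> N"
  shows "\<exists>r>0. \<exists>s. 2 * (real N - 1) * s < 1 \<and> (\<forall>x. measure M (ball x r) \<le> s)"
proof -
  obtain L where lim: "((\<lambda>r. SUP x. measure M (ball x r)) \<longlongrightarrow> L) (at_right 0)"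
    and L: "L < 1 / (real N * (real N - 1)\<^sup>2)"
    using assms by (auto simp: small_concentration_def)
  obtain s where s: "L < s" "s < 1 / (real N * (real N - 1)\<^sup>2)" using dense[OF L] by blast
  have "eventually (\<lambda>r. (SUP x. measure M (ball x r)) < s) (at_right 0)"
    by (rule order_tendstoD(2)[OF lim s(1)])
  then obtain r0 where r0: "r0 > 0" "\<And>r. 0 < r \<Longrightarrow> r < r0 \<Longrightarrow> (SUP x. measure M (ball x r)) < s"
    by (auto simp: eventually_at_right_field)
  define r where "r = r0 / 2"
  have r: "r > 0" "r < r0" using r0 by (auto simp: r_def)
  have "measure M (ball x r) \<le> s" for x
  proof -
    have "measure M (ball x r) \<le> (SUP x. measure M (ball x r))"
      by (rule cSUP_upper) (auto intro!: bdd_aboveI[of _ 1])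
    with r0(2)[OF r] show ?thesis by simp
  qed
  moreover have "2 * (real N - 1) * s < 1"
  proof -
    have N1: "real N - 1 \<ge> 1" using N by simp
    have "2 * (real N - 1) * s < 2 * (real N - 1) * (1 / (real N * (real N - 1)\<^sup>2))"
      using s N1 by (intro mult_strict_left_mono) auto
    also have "\<dots> = 2 / (real N * (real N - 1))"
    proof -
      have "2 * a * (1 / (n * a\<^sup>2)) = 2 / (n * a)" if "1 \<le> a" for a n :: real
        using that by (simp add: power2_eq_square)
      then show ?thesis using N1 .
    qed
    also have "\<dots> \<le> 1"
    proof -
      have "2 * 1 \<le> real N * (real N - 1)" using N N1 by (intro mult_mono) auto
      then show ?thesis using N1 by (simp add: divide_le_eq_1)
    qed
    finally show ?thesis .
  qed
  ultimately show ?thesis using r by blast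
qed

text \<open>The tuples \<open>y i\<close> are chosen one after the other; each of them has to avoid at most
  \<open>2 (N - 1)\<close> sets, each the preimage of a ball under a coordinate.\<close>

lemma (in borel_prob) separated_selection:
  fixes \<gamma> :: "('n::finite \<Rightarrow> 'a) measure" and x :: "'n \<Rightarrow> 'a"
  assumes g: "\<gamma> \<in> couplings M" and Q: "Q \<in> sets borel"
    and s: "\<And>x. measure M (ball x r) \<le> s" "2 * (real CARD('n) - 1) * s < measure \<gamma> Q"
  shows "\<exists>y :: 'n \<Rightarrow> 'n \<Rightarrow> 'a. \<forall>i. y i \<in> Q \<and> (\<forall>j. j \<noteq> i \<longrightarrow> r \<le> dist (x i) (y i j))
     \<and> (\<forall>i'. i' \<noteq> i \<longrightarrow> r \<le> dist (y i i) (y i' i'))"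
proof -
  have b: "\<gamma> \<in> borel_prob_measures" and d: "\<And>i. distr \<gamma> borel (\<lambda>x. x i) = M"
    using g by (auto simp: couplings_def)
  note gD = borel_prob_measuresD[OF b]
  interpret G: prob_space \<gamma> by (rule gD)
  have comp: "(\<lambda>x. x i) \<in> measurable \<gamma> borel" for i
    using gD(1) measurable_product_coordinates by (metis measurable_cong_sets)
  have pre: "{y. y i \<in> ball a r} \<in> sets \<gamma>" "measure \<gamma> {y. y i \<in> ball a r} \<le> s" for i a
  proof -
    show "{y. y i \<in> ball a r} \<in> sets \<gamma>"
      using measurable_sets[OF comp[of i], of "ball a r"] by (simp add: vimage_def gD)
    have "measure M (ball a r) = measure \<gamma> {y. y i \<in> ball a r}"
      by (subst d[of i, symmetric], subst measure_distr[OF comp]) (auto simp: vimage_def gD)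
    then show "measure \<gamma> {y. y i \<in> ball a r} \<le> s" using s(1)[of a] by simp
  qed
  have "\<exists>y :: 'n \<Rightarrow> 'n \<Rightarrow> 'a. \<forall>i\<in>I. y i \<in> Q \<and> (\<forall>j. j \<noteq> i \<longrightarrow> r \<le> dist (x i) (y i j))
     \<and> (\<forall>i'\<in>I. i' \<noteq> i \<longrightarrow> r \<le> dist (y i i) (y i' i'))" for I
  proof (induction I rule: finite_induct[OF finite])
    case (2 k I)
    then obtain y where y: "\<And>i. i \<in> I \<Longrightarrow> y i \<in> Q" "\<And>i j. i \<in> I \<Longrightarrow> j \<noteq> i \<Longrightarrow> r \<le> dist (x i) (y i j)"
      "\<And>i i'. i \<in> I \<Longrightarrow> i' \<in> I \<Longrightarrow> i' \<noteq> i \<Longrightarrow> r \<le> dist (y i i) (y i' i')" by metis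
    \<comment> \<open>The first union keeps \<open>x k\<close> away from the other coordinates of
      the tuple into which it is inserted; the second keeps the orphaned coordinate
      \<open>w k\<close> away from those already chosen.\<close>
    define Bad where "Bad = (\<Union>j\<in>UNIV - {k}. {w. w j \<in> ball (x k) r}) \<union> (\<Union>i\<in>I. {w. w k \<in> ball (y i i) r})"
    have "measure \<gamma> Bad \<le> measure \<gamma> (\<Union>j\<in>UNIV - {k}. {w. w j \<in> ball (x k) r}) + measure \<gamma> (\<Union>i\<in>I. {w. w k \<in> ball (y i i) r})"
      unfolding Bad_def using pre(1) by (intro measure_Un_le sets.finite_UN) auto
    also have "\<dots> \<le> (\<Sum>j\<in>UNIV - {k}. measure \<gamma> {w. w j \<in> ball (x k) r}) + (\<Sum>i\<in>I. measure \<gamma> {w. w k \<in> ball (y i i) r})"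
      using pre(1) by (intro add_mono measure_UNION_le) auto
    also have "\<dots> \<le> (\<Sum>j\<in>UNIV - {k}. s) + (\<Sum>i\<in>I. s)"
      by (intro add_mono sum_mono pre(2))
    also have "\<dots> = (real CARD('n) - 1) * s + real (card I) * s"
      by (simp add: card_Diff_singleton of_nat_diff)
    also have "\<dots> \<le> (real CARD('n) - 1) * s + (real CARD('n) - 1) * s"
    proof -
      have "card I < CARD('n)" using 2(2) by (intro psubset_card_mono) auto
      moreover have "0 \<le> s" using s(1) measure_nonneg order_trans by metis
      ultimately show ?thesis by (intro add_left_mono mult_right_mono) auto
    qed
    also have "\<dots> < measure \<gamma> Q" using s(2) by (simp add: algebra_simps)
    finally have "measure \<gamma> Bad < measure \<gamma> Q" .
    moreover have "Bad \<in> sets \<gamma>" unfolding Bad_def using pre(1) by (intro sets.Un sets.finite_UN) auto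
    ultimately have "\<not> Q \<subseteq> Bad" using G.finite_measure_mono[of Q Bad] by auto
    then obtain w where w: "w \<in> Q" "w \<notin> Bad" by blast
    have w1: "r \<le> dist (x k) (w j)" if "j \<noteq> k" for j using w(2) that by (auto simp: Bad_def not_less)
    have w2: "r \<le> dist (y i i) (w k)" if "i \<in> I" for i using w(2) that by (auto simp: Bad_def not_less)
    show ?case
    proof (intro exI[of _ "y(k := w)"] ballI conjI allI impI)
      fix i assume i: "i \<in> insert k I"
      show "(y(k := w)) i \<in> Q" using i w(1) y(1) by auto
      show "r \<le> dist (x i) ((y(k := w)) i j)" if "j \<noteq> i" for j using i that w1 y(2) by auto
      show "r \<le> dist ((y(k := w)) i i) ((y(k := w)) i' i')" if "i' \<in> insert k I" "i' \<noteq> i" for i'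
        using i that w2[of i] w2[of i'] y(3) 2(2) by (auto simp: dist_commute)
    qed
  qed simp
  from this[of UNIV] show ?thesis by simp
qed

section \<open>Small boxes, separated tuples and the quantitative approximation\<close>

lemma open_box:
  fixes B :: "'n::finite \<Rightarrow> 'b::topological_space set"
  assumes "\<And>i. open (B i)"
  shows "open {x. \<forall>i. x i \<in> B i}"
proof -
  have "{x. \<forall>i. x i \<in> B i} = (\<Inter>i. (\<lambda>x. x i) -` B i)" by auto
  also have "open \<dots>"
    using assms by (intro open_INT ballI open_vimage continuous_on_product_coordinates) auto
  finally show ?thesis .
qed

context repulsive_cost
begin

text \<open>The smallness in the product metric serves the Lipschitz test functions, that in each
  coordinate keeps the coordinates of swapped tuples apart. As boxes contain injective tuples only
  and the cost hardly varies there, products supported in a box have controlled cost.\<close>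

definition small_cells :: "real \<Rightarrow> (nat \<Rightarrow> 'n::{finite,linorder} \<Rightarrow> 'a set) \<Rightarrow> (nat \<Rightarrow> 'n \<Rightarrow> 'a) \<Rightarrow> bool" where
  "small_cells \<delta> W z \<longleftrightarrow> (\<forall>k i. open (W k i) \<and> z k i \<in> W k i) \<and>
     (\<forall>x. inj x \<longrightarrow> (\<exists>k. \<forall>i. x i \<in> W k i)) \<and>
     (\<forall>k x. (\<forall>i. x i \<in> W k i) \<longrightarrow> inj x \<and> \<bar>cost x - cost (z k)\<bar> < \<delta> \<and> dist x (z k) < \<delta>) \<and>
     (\<forall>k i. \<forall>t\<in>W k i. dist t (z k i) < \<delta>)"

text \<open>Injectivity is an open condition and the cost is continuous there, so every injective
  tuple has a basic open box of this kind; by Lindelof countably many suffice. The tuple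
  \<open>x0\<close> guarantees that there is a box to enumerate.\<close>

lemma small_cells_exist:
  fixes x0 :: "'n::{finite,linorder} \<Rightarrow> 'a" and \<delta> :: real
  assumes ne: "inj x0" and d: "\<delta> > 0"
  shows "\<exists>(W :: nat \<Rightarrow> 'n \<Rightarrow> 'a set) z. small_cells \<delta> W z"
proof -
  define ok where "ok z B \<longleftrightarrow> (\<forall>i. open (B i)) \<and> (\<forall>i. z i \<in> B i) \<and> (\<forall>x. (\<forall>i. x i \<in> B i) \<longrightarrow>
      inj x \<and> \<bar>cost x - cost z\<bar> < \<delta> \<and> dist x z < \<delta>) \<and> (\<forall>i t. t \<in> B i \<longrightarrow> dist t (z i) < \<delta>)"
    for z :: "'n \<Rightarrow> 'a" and B
  have "\<exists>B. ok z B" if z: "inj z" for z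
  proof -
    define U where "U = ({x. inj x} \<inter> cost -` ball (cost z) \<delta>) \<inter> ball z \<delta>"
    have "open U" unfolding U_def
      by (intro open_Int continuous_open_preimage[OF continuous_cost open_inj] open_ball)
    moreover have zU: "z \<in> U" using z d by (simp add: U_def)
    ultimately obtain X where X: "Pi\<^sub>E UNIV X \<subseteq> U" "\<And>i. openin euclidean (X i)" "z \<in> Pi\<^sub>E UNIV X"
      using product_topology_open_contains_basis[of "\<lambda>_. euclidean" UNIV U z] by (auto simp: open_fun_def)
    define B where "B i = X i \<inter> ball (z i) \<delta>" for i
    show ?thesis
    proof (intro exI[of _ B], unfold ok_def, intro conjI allI impI)
      show "open (B i)" for i using X(2)[of i] by (auto simp: B_def)
      show "z i \<in> B i" for i using X(3) d by (auto simp: B_def)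
      show "dist t (z i) < \<delta>" if "t \<in> B i" for i t using that by (simp add: B_def dist_commute)
      fix x assume "\<forall>i. x i \<in> B i"
      then have "x \<in> U" using X(1) by (auto simp: B_def)
      then show "inj x" "\<bar>cost x - cost z\<bar> < \<delta>" "dist x z < \<delta>"
        by (auto simp: U_def dist_real_def dist_commute)
    qed
  qed
  then obtain B where ok: "\<And>z. inj z \<Longrightarrow> ok z (B z)" by metis
  have B: "open (B z i)" "z i \<in> B z i" "\<forall>i. x i \<in> B z i \<Longrightarrow> inj x \<and> \<bar>cost x - cost z\<bar> < \<delta> \<and> dist x z < \<delta>"
    "t \<in> B z i \<Longrightarrow> dist t (z i) < \<delta>" if "inj z" for z x i t
    using ok[OF that] unfolding ok_def by blast+
  define b where "b z = {x. \<forall>i. x i \<in> B z i}" for z :: "'n \<Rightarrow> 'a"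
  have ob: "open S" if "S \<in> b ` {z. inj z}" for S using that B(1) by (auto simp: b_def intro: open_box)
  obtain F' where F': "F' \<subseteq> b ` {z. inj z}" "countable F'" "\<Union>F' = \<Union>(b ` {z. inj z})"
    using Lindelof[OF ob] by blast
  then obtain S where S: "countable S" "S \<subseteq> {z. inj z}" "F' = b ` S"
    using countable_subset_image[of F' b "{z. inj z}"] by blast
  have cov: "\<exists>z\<in>S. x \<in> b z" if "inj x" for x
  proof -
    have "x \<in> \<Union>(b ` {z. inj z})" using that B(2) by (auto simp: b_def)
    then show ?thesis using F'(3) S(3) by auto
  qed
  then have Sne: "S \<noteq> {}" using ne by blast
  define z where "z = from_nat_into S"
  have zS: "z k \<in> S" for k unfolding z_def by (rule from_nat_into[OF Sne])
  then have zi: "inj (z k)" for k using S(2) by blast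
  have range: "range z = S" unfolding z_def by (rule range_from_nat_into[OF Sne S(1)])
  show ?thesis
  proof (intro exI, unfold small_cells_def, intro conjI allI ballI impI)
    show "open (B (z k) i)" "z k i \<in> B (z k) i" for k i by (rule B(1,2)[OF zi])+
    show "\<exists>k. \<forall>i. x i \<in> B (z k) i" if "inj x" for x
      using cov[OF that] range by (auto simp: b_def)
    show "dist t (z k i) < \<delta>" if "t \<in> B (z k) i" for k i t by (rule B(4)[OF zi that])
    fix k x assume "\<forall>i. x i \<in> B (z k) i"
    then have "inj x \<and> \<bar>cost x - cost (z k)\<bar> < \<delta> \<and> dist x (z k) < \<delta>" by (rule B(3)[OF zi])
    then show "inj x" "\<bar>cost x - cost (z k)\<bar> < \<delta>" "dist x (z k) < \<delta>" by auto
  qed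
qed

definition separated :: "real \<Rightarrow> ('n::{finite,linorder} \<Rightarrow> 'a) set" where
  "separated r = {x. \<forall>i j. i \<noteq> j \<longrightarrow> r \<le> dist (x i) (x j)}"

lemma separated_borel: "separated r \<in> sets (borel :: ('n::{finite,linorder} \<Rightarrow> 'a) measure)"
proof -
  have "separated r = (\<Inter>(i, j)\<in>{(i, j). i \<noteq> j}. {x::'n \<Rightarrow> 'a. r \<le> dist (x i) (x j)})"
    by (auto simp: separated_def)
  also have "closed \<dots>"
    by (intro closed_INT) (auto intro!: closed_Collect_le continuous_intros continuous_on_product_coordinates)
  finally show ?thesis by (rule borel_closed)
qed

lemma separated_inj: "0 < r \<Longrightarrow> x \<in> separated r \<Longrightarrow> inj x"
  by (rule injI, rule ccontr) (force simp: separated_def)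

text \<open>By monotonicity no pair costs more than \<open>fr r\<close>, however the tuple arose;
  this bounds the cost of all swapped tuples at once.\<close>

lemma cost_separated_le:
  fixes x :: "'n::{finite,linorder} \<Rightarrow> 'a"
  assumes "0 < r" "x \<in> separated r"
  shows "cost x \<le> real (card (pairs :: ('n \<times> 'n) set)) * \<bar>fr r\<bar>"
proof -
  have "cost x = (\<Sum>(i, j)\<in>pairs. fr (dist (x i) (x j)))"
    using separated_inj[OF assms] by (simp add: cost_def)
  also have "\<dots> \<le> (\<Sum>p\<in>(pairs :: ('n \<times> 'n) set). \<bar>fr r\<bar>)"
  proof (rule sum_mono, clarify)
    fix i j :: 'n assume "(i, j) \<in> pairs"
    then have "r \<le> dist (x i) (x j)" using assms(2) by (auto simp: separated_def pairs_def)
    show "fr (dist (x i) (x j)) \<le> \<bar>fr r\<bar>"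
      by (rule order_trans[OF fD(3)[OF assms(1) \<open>r \<le> dist (x i) (x j)\<close>] abs_ge_self])
  qed
  finally show ?thesis by simp
qed

text \<open>The constants are fixed in the order boxes, \<open>K0\<close>, \<open>bc\<close> and
  \<open>Qc\<close>, and \<open>K\<close> last. By \<open>\<delta> \<le> r / 8\<close>, two points
  in the same coordinate of a box are less than \<open>r / 4\<close> apart, so moving both ends of a
  distance \<open>r\<close> leaves at least \<open>r / 2\<close>. The estimate for \<open>g\<close>
  is one-sided because it can be applied to \<open>- g\<close> as well.\<close>

lemma approximation_aux:
  fixes \<gamma> :: "('n::{finite,linorder} \<Rightarrow> 'a) measure"
  assumes g: "\<gamma> \<in> couplings M" and inj: "AE x in \<gamma>. inj x" and int: "integrable \<gamma> cost"
    and r: "r > 0" and s: "\<And>x. measure M (ball x r) \<le> s" "2 * (real CARD('n) - 1) * s < measure \<gamma> (separated r)"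
    and \<delta>: "0 < \<delta>" "\<delta> \<le> r / 8"
  shows "\<exists>\<eta> U C. \<eta> \<in> couplings M \<and> U \<in> borel_measurable borel \<and> (\<forall>x. 0 \<le> U x \<and> U x \<le> C) \<and>
    \<eta> = density (Pi\<^sub>M UNIV (\<lambda>_. M)) (\<lambda>x. ennreal (U x)) \<and>
    (AE x in \<eta>. inj x) \<and> integrable \<eta> cost \<and> (\<integral>x. cost x \<partial>\<eta>) \<le> (\<integral>x. cost x \<partial>\<gamma>) + 5 * \<delta> \<and>
    (\<forall>g L B. (\<forall>x y. \<bar>g x - g y\<bar> \<le> L * dist x y) \<longrightarrow> (\<forall>x. \<bar>g x\<bar> \<le> B) \<longrightarrow> 0 \<le> L \<longrightarrow>
       (\<integral>x. g x \<partial>\<eta>) \<le> (\<integral>x. g x \<partial>\<gamma>) + (2 * L + 3 * B) * \<delta>)"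
proof -
  have gb: "\<gamma> \<in> borel_prob_measures" using g by (simp add: couplings_def)
  note gD = borel_prob_measuresD[OF gb]
  interpret G: prob_space \<gamma> by (rule gD)
  have "\<not> (AE x in \<gamma>. \<not> inj x)"
  proof
    assume "AE x in \<gamma>. \<not> inj x"
    with inj have "AE x in \<gamma>. False" by eventually_elim auto
    then show False by simp
  qed
  then have "\<exists>x0::'n \<Rightarrow> 'a. inj x0" by (rule contrapos_np) auto
  then obtain x0 :: "'n \<Rightarrow> 'a" where x0: "inj x0" ..
  obtain W :: "nat \<Rightarrow> 'n \<Rightarrow> 'a set" and z :: "nat \<Rightarrow> 'n \<Rightarrow> 'a" where cells: "small_cells \<delta> W z"
    using small_cells_exist[OF x0 \<delta>(1)] by blast
  note c = cells[unfolded small_cells_def]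
  have Wopen: "open (W k i)" and zW: "z k i \<in> W k i" for k i using c[THEN conjunct1] by auto
  have cover: "\<exists>k. \<forall>i. x i \<in> W k i" if "inj x" for x
    using c[THEN conjunct2, THEN conjunct1] that by blast
  have Wx: "inj x \<and> \<bar>cost x - cost (z k)\<bar> < \<delta> \<and> dist x (z k) < \<delta>" if "\<And>i. x i \<in> W k i" for k x
    using c[THEN conjunct2, THEN conjunct2, THEN conjunct1, rule_format] that by blast
  have Winj: "inj x" and Wcost: "\<bar>cost x - cost (z k)\<bar> < \<delta>" and Wdist: "dist x (z k) < \<delta>"
    if "\<And>i. x i \<in> W k i" for k x using Wx[of x k, OF that] by simp_all
  have Wcomp: "dist t (z k i) < \<delta>" if "t \<in> W k i" for k i t
    using c[THEN conjunct2, THEN conjunct2, THEN conjunct2] that by blast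
  define D where "D = disjointed (\<lambda>k. {x. \<forall>i. x i \<in> W k i})"
  define R where "R K = - (\<Union>k<K. D k)" for K :: nat
  have Db: "D k \<in> sets borel" for k
  proof -
    have "{x. \<forall>i. x i \<in> W k i} \<in> sets borel" for k by (rule borel_open[OF open_box]) (rule Wopen)
    then show ?thesis
      using sets.range_disjointed_sets[of "\<lambda>k. {x. \<forall>i. x i \<in> W k i}" borel] unfolding D_def by blast
  qed
  have Ddisj: "disjoint_family D" unfolding D_def by (rule disjoint_family_disjointed)
  have DW: "x i \<in> W k i" if "x \<in> D k" for x k i
    using that disjointed_subset[of "\<lambda>k. {x. \<forall>i. x i \<in> W k i}" k] by (auto simp: D_def)
  have Dcov: "\<exists>k. x \<in> D k" if "inj x" for x
    using cover[OF that] UN_disjointed_eq[of "\<lambda>k. {x. \<forall>i. x i \<in> W k i}"] unfolding D_def by blast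
  have Rb: "R K \<in> sets borel" for K unfolding R_def using Db by (intro borel_comp sets.finite_UN) auto
  \<comment> \<open>The leftover sets shrink to a set without injective tuples, which is
    null.\<close>
  have lim: "(\<lambda>K. \<integral>x. indicator (R K) x * \<phi> x \<partial>\<gamma>) \<longlonglongrightarrow> 0" if p: "integrable \<gamma> \<phi>" for \<phi> :: "_ \<Rightarrow> real"
  proof -
    have "(\<lambda>K. \<integral>x. indicator (R K) x * \<phi> x \<partial>\<gamma>) \<longlonglongrightarrow> (\<integral>x. 0 \<partial>\<gamma>)"
    proof (rule integral_dominated_convergence[where w="\<lambda>x. \<bar>\<phi> x\<bar>"])
      show "AE x in \<gamma>. (\<lambda>K. indicator (R K) x * \<phi> x) \<longlonglongrightarrow> 0"
        using inj
      proof eventually_elim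
        case (elim x)
        obtain k where k: "x \<in> D k" using Dcov[OF elim] by blast
        have "eventually (\<lambda>K. indicator (R K) x * \<phi> x = 0) sequentially"
          using eventually_gt_at_top[of k] by eventually_elim (use k in \<open>auto simp: R_def indicator_def\<close>)
        then show ?case by (rule tendsto_eventually)
      qed
      show "(\<lambda>x. indicator (R K) x * \<phi> x) \<in> borel_measurable \<gamma>" for K
        using p Rb[of K] gD(1) by (intro borel_measurable_times borel_measurable_indicator) auto
    qed (use p in \<open>auto simp: indicator_def\<close>)
    then show ?thesis by simp
  qed
  have limR: "(\<lambda>K. measure \<gamma> (R K)) \<longlonglongrightarrow> 0"
    using lim[of "\<lambda>_. 1"] Rb gD by simp
  define p where "p k = measure \<gamma> (D k)" for k
  \<comment> \<open>Donors need positive mass, so null cells are removed; by \<open>QQm\<close> this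
    costs no mass.\<close>
  define QQ where "QQ K = separated r \<inter> (\<Union>k\<in>{k. k < K \<and> 0 < p k}. D k)" for K :: nat
  have QQb: "QQ K \<in> sets borel" for K
    unfolding QQ_def using Db separated_borel by (intro sets.Int sets.finite_UN) auto
  have QQm: "measure \<gamma> (separated r) \<le> measure \<gamma> (QQ K) + measure \<gamma> (R K)" for K
  proof -
    define Z where "Z = (\<Union>k\<in>{k. k < K \<and> p k = 0}. D k)"
    have Zb: "Z \<in> sets \<gamma>" unfolding Z_def using Db gD(1) by (intro sets.finite_UN) auto
    have "measure \<gamma> Z \<le> (\<Sum>k\<in>{k. k < K \<and> p k = 0}. measure \<gamma> (D k))"
      unfolding Z_def using Db gD(1) by (intro measure_UNION_le) auto
    also have "\<dots> = 0" by (simp add: p_def)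
    finally have Z0: "measure \<gamma> Z \<le> 0" .
    have "0 < p k \<or> p k = 0" for k using measure_nonneg[of \<gamma> "D k"] by (auto simp: p_def less_le)
    then have "separated r \<subseteq> (QQ K \<union> R K) \<union> Z" by (auto simp: QQ_def R_def Z_def)
    then have "measure \<gamma> (separated r) \<le> measure \<gamma> ((QQ K \<union> R K) \<union> Z)"
      using QQb Rb Zb gD(1) by (intro G.finite_measure_mono) auto
    also have "\<dots> \<le> measure \<gamma> (QQ K \<union> R K) + measure \<gamma> Z" using QQb Rb Zb gD(1) by (intro measure_Un_le) auto
    also have "\<dots> \<le> measure \<gamma> (QQ K) + measure \<gamma> (R K) + measure \<gamma> Z"
      using QQb Rb gD(1) by (intro add_right_mono measure_Un_le) auto
    finally show ?thesis using Z0 by simp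
  qed
  have "eventually (\<lambda>K. measure \<gamma> (R K) < measure \<gamma> (separated r) - 2 * (real CARD('n) - 1) * s) sequentially"
    by (rule order_tendstoD(2)[OF limR]) (use s(2) in simp)
  \<comment> \<open>The separated tuples in the first \<open>K0\<close> cells already outweigh the
    sets to be avoided in the selection.\<close>
  then obtain K0 where K0: "measure \<gamma> (R K0) < measure \<gamma> (separated r) - 2 * (real CARD('n) - 1) * s"
    using eventually_happens by force
  have Qm: "2 * (real CARD('n) - 1) * s < measure \<gamma> (QQ K0)" using K0 QQm[of K0] by simp
  \<comment> \<open>The witnesses \<open>y\<close> are remembered only through the cells that
    contain them. As the indices stay below \<open>K0\<close>, finitely many \<open>\<kappa>\<close>
    cover all points.\<close>
  define Kp where "Kp = {\<kappa> :: 'n \<Rightarrow> nat. (\<forall>i. \<kappa> i < K0 \<and> 0 < p (\<kappa> i)) \<and>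
     (\<exists>y. (\<forall>i. y i \<in> separated r \<and> y i \<in> D (\<kappa> i)) \<and> (\<forall>i i'. i' \<noteq> i \<longrightarrow> r \<le> dist (y i i) (y i' i')))}"
  \<comment> \<open>The distance is required for every tuple \<open>w\<close> of the box, since the
    swap combines \<open>x i\<close> with arbitrary tuples of the product of marginals and not with
    the witness.\<close>
  define T where "T \<kappa> i = {t. \<forall>w. (\<forall>j. w j \<in> W (\<kappa> i) j) \<longrightarrow> (\<forall>j. j \<noteq> i \<longrightarrow> r / 2 \<le> dist t (w j))}"
    for \<kappa> :: "'n \<Rightarrow> nat" and i
  have Tb: "T \<kappa> i \<in> sets borel" for \<kappa> i
  proof -
    have "T \<kappa> i = (\<Inter>w\<in>{w. \<forall>j. w j \<in> W (\<kappa> i) j}. \<Inter>j\<in>UNIV - {i}. {t. r / 2 \<le> dist t (w j)})"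
      by (auto simp: T_def)
    also have "closed \<dots>"
      by (intro closed_INT ballI closed_Collect_le continuous_intros)
    finally show ?thesis by (rule borel_closed)
  qed
  have W2: "dist t t' < 2 * \<delta>" if "t \<in> W k i" "t' \<in> W k i" for t t' k i
    using Wcomp[OF that(1)] Wcomp[OF that(2)] dist_triangle2[of t t' "z k i"] by simp
  have perturb: "r / 2 \<le> dist u v" if "r \<le> dist a b" "dist a u < 2 * \<delta>" "dist b v < 2 * \<delta>" for a b u v :: 'a
  proof -
    have "dist a b \<le> dist a u + dist u v + dist v b"
      using dist_triangle[of a b u] dist_triangle[of u b v] by simp
    then show ?thesis using that \<delta>(2) by (simp add: dist_commute)
  qed
  have cov: "\<exists>\<kappa>\<in>Kp. \<forall>i. x i \<in> T \<kappa> i" for x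
  proof -
    obtain y where y: "\<And>i. y i \<in> QQ K0" "\<And>i j. j \<noteq> i \<Longrightarrow> r \<le> dist (x i) (y i j)"
      "\<And>i i'. i' \<noteq> i \<Longrightarrow> r \<le> dist (y i i) (y i' i')"
      using separated_selection[OF g QQb s(1) Qm, of x] by blast
    have "\<forall>i. \<exists>k. k < K0 \<and> 0 < p k \<and> y i \<in> D k" using y(1) by (auto simp: QQ_def)
    then obtain \<kappa> where k: "\<And>i. \<kappa> i < K0" "\<And>i. 0 < p (\<kappa> i)" "\<And>i. y i \<in> D (\<kappa> i)" by metis
    have "\<kappa> \<in> Kp" unfolding Kp_def using k y by (auto simp: QQ_def intro!: exI[of _ y])
    moreover have "x i \<in> T \<kappa> i" for i
      unfolding T_def
    proof (clarify)
      fix w j assume w: "\<forall>j. w j \<in> W (\<kappa> i) j" and j: "j \<noteq> i"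
      show "r / 2 \<le> dist (x i) (w j)"
        by (rule perturb[OF y(2)[OF j]]) (use \<delta>(1) W2[OF DW[OF k(3)]] w in auto)
    qed
    ultimately show ?thesis by blast
  qed
  \<comment> \<open>\<open>bc\<close> and \<open>Qc\<close> do not depend on \<open>K\<close>, so a
    large \<open>K\<close> makes their products with the leftover mass small.\<close>
  define bc where "bc = (\<Sum>k<K0. \<bar>cost (z k)\<bar>)"
  define Qc where "Qc = real (card (pairs :: ('n \<times> 'n) set)) * \<bar>fr (r / 2)\<bar>"
  define N where "N = real CARD('n)"
  have small: "eventually (\<lambda>K. c * measure \<gamma> (R K) < e) sequentially" if "0 < e" for c e
  proof -
    have "(\<lambda>K. c * measure \<gamma> (R K)) \<longlonglongrightarrow> c * 0" by (intro tendsto_intros limR)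
    then show ?thesis by (rule order_tendstoD(2)) (use that in simp)
  qed
  have "eventually (\<lambda>K. K0 \<le> K \<and> (\<forall>k\<in>{k. k < K0 \<and> 0 < p k}. N * measure \<gamma> (R K) < p k) \<and>
      (N * bc) * measure \<gamma> (R K) < \<delta> \<and> ((N + 1) * Qc) * measure \<gamma> (R K) < \<delta> \<and> (N + 1) * measure \<gamma> (R K) < \<delta> \<and>
      \<bar>\<integral>x. indicator (R K) x * cost x \<partial>\<gamma>\<bar> < \<delta>) sequentially"
    using order_tendstoD(2)[OF tendsto_rabs[OF lim[OF int]], of \<delta>] \<delta>(1)
    by (intro eventually_conj eventually_ball_finite ballI small eventually_ge_at_top) auto
  then obtain K where K: "K0 \<le> K" "\<And>k. k < K0 \<Longrightarrow> 0 < p k \<Longrightarrow> N * measure \<gamma> (R K) < p k"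
    "(N * bc) * measure \<gamma> (R K) < \<delta>" "((N + 1) * Qc) * measure \<gamma> (R K) < \<delta>" "(N + 1) * measure \<gamma> (R K) < \<delta>"
    "\<bar>\<integral>x. indicator (R K) x * cost x \<partial>\<gamma>\<bar> < \<delta>"
    using eventually_happens by force
  define \<epsilon> where "\<epsilon> = measure \<gamma> (R K)"
  interpret SD: swap_data M \<gamma> K K0 W D Kp T
  proof
    show "\<gamma> \<in> couplings M" by (rule g)
    show "W k i \<in> sets borel" for k i using Wopen by simp
    show "real CARD('n) * measure \<gamma> (- (\<Union>k<K. D k)) < measure \<gamma> (D k)" if "k < K0" "0 < measure \<gamma> (D k)" for k
      using K(2)[of k] that by (simp add: p_def N_def R_def)
    show "\<exists>\<kappa>\<in>Kp. \<forall>i. x i \<in> T \<kappa> i" for x by (rule cov)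
  qed (use Db Ddisj DW K(1) Tb in \<open>auto simp: Kp_def p_def\<close>)
  have sw: "x \<in> separated (r / 2)" if xs: "x \<in> SD.swapped" for x
  proof -
    obtain \<kappa> where k: "\<kappa> \<in> Kp" and alt: "(\<exists>i. x i \<in> T \<kappa> i \<and> (\<forall>j. j \<noteq> i \<longrightarrow> x j \<in> W (\<kappa> i) j)) \<or> (\<forall>i. x i \<in> W (\<kappa> i) i)"
      using xs unfolding SD.swapped_def mem_Collect_eq by blast
    obtain y where y: "\<And>i. y i \<in> separated r" "\<And>i. y i \<in> D (\<kappa> i)" "\<And>i i'. i' \<noteq> i \<Longrightarrow> r \<le> dist (y i i) (y i' i')"
      using k by (auto simp: Kp_def)
    from alt show ?thesis
    proof
      assume "\<exists>i. x i \<in> T \<kappa> i \<and> (\<forall>j. j \<noteq> i \<longrightarrow> x j \<in> W (\<kappa> i) j)"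
      then obtain i where i: "x i \<in> T \<kappa> i" "\<And>j. j \<noteq> i \<Longrightarrow> x j \<in> W (\<kappa> i) j" by blast
      have A: "r / 2 \<le> dist (x i) (x j)" if "j \<noteq> i" for j
      proof -
        \<comment> \<open>\<open>T\<close> speaks of full tuples of the box, so the replaced
          coordinate is filled with that of the centre.\<close>
        have "\<forall>l. (x(i := z (\<kappa> i) i)) l \<in> W (\<kappa> i) l" using i(2) zW by simp
        then have "r / 2 \<le> dist (x i) ((x(i := z (\<kappa> i) i)) j)" using i(1) that unfolding T_def by blast
        then show ?thesis using that by simp
      qed
      have B: "r / 2 \<le> dist (x j) (x j')" if "j \<noteq> i" "j' \<noteq> i" "j \<noteq> j'" for j j'
      proof (rule perturb)
        show "r \<le> dist (y i j) (y i j')" using y(1)[of i] that by (simp add: separated_def)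
      qed (use that in \<open>auto intro!: W2 DW[OF y(2)] i(2)\<close>)
      show ?thesis
        unfolding separated_def
      proof (clarify)
        fix a b :: 'n assume "a \<noteq> b"
        then show "r / 2 \<le> dist (x a) (x b)"
          using A[of b] A[of a] B[of a b] by (cases "a = i"; cases "b = i") (auto simp: dist_commute)
      qed
    next
      assume a: "\<forall>i. x i \<in> W (\<kappa> i) i"
      show ?thesis
        unfolding separated_def
      proof (clarify)
        fix i j :: 'n assume "i \<noteq> j"
        then show "r / 2 \<le> dist (x i) (x j)"
          using a DW[OF y(2)] by (intro perturb[OF y(3)[of j i]] W2) auto
      qed
    qed
  qed
  have r2: "0 < r / 2" using r by simp
  obtain \<eta> U C where \<eta>: "\<eta> \<in> couplings M" "U \<in> borel_measurable borel" "\<forall>x. 0 \<le> U x \<and> U x \<le> C"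
    "\<eta> = density (Pi\<^sub>M UNIV (\<lambda>_. M)) (\<lambda>x. ennreal (U x))"
    and AE\<eta>: "AE x in \<eta>. (\<exists>k<K. 0 < measure \<gamma> (D k) \<and> (\<forall>i. x i \<in> W k i)) \<or> x \<in> SD.swapped"
    and est: "SD.swap_estimate \<eta>"
    using SD.swap_plan by blast
  \<comment> \<open>One estimate for the cost and for all test functions. One
    \<open>\<omega>\<close> comes from passing to a product inside the box, the other from comparing
    the value at the centre with the average over the cell.\<close>
  have key: "(\<integral>x. \<phi> x \<partial>\<eta>) \<le> (\<integral>x. \<phi> x \<partial>\<gamma>) - (\<integral>x. indicator (R K) x * \<phi> x \<partial>\<gamma>) + 2 * \<omega> + N * \<epsilon> * b + (N + 1) * \<epsilon> * Q"
    if "\<phi> \<in> borel_measurable borel" "integrable \<eta> \<phi>" and ig: "integrable \<gamma> \<phi>"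
      and osc: "\<And>k x. (\<And>i. x i \<in> W k i) \<Longrightarrow> \<bar>\<phi> x - \<phi> (z k)\<bar> \<le> \<omega>"
      and b: "\<And>k. k < K0 \<Longrightarrow> - \<phi> (z k) \<le> b" and Q: "\<And>x. x \<in> SD.swapped \<Longrightarrow> \<phi> x \<le> Q" and w: "0 \<le> \<omega>" for \<phi> \<omega> b Q
  proof -
    have "(\<integral>x. \<phi> x \<partial>\<eta>) \<le> (\<Sum>k<K. measure \<gamma> (D k) * \<phi> (z k)) + \<omega>
         + real CARD('n) * measure \<gamma> (- (\<Union>k<K. D k)) * b
         + (real CARD('n) + 1) * measure \<gamma> (- (\<Union>k<K. D k)) * Q"
    proof (rule est[unfolded SD.swap_estimate_def, rule_format])
      show "\<phi> x \<le> \<phi> (z k) + \<omega>" if "\<And>i. x i \<in> W k i" for k x using osc[OF that] by linarith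
    qed (use that in auto)
    also have "(\<Sum>k<K. measure \<gamma> (D k) * \<phi> (z k)) \<le> (\<integral>x. \<phi> x \<partial>\<gamma>) - (\<integral>x. indicator (R K) x * \<phi> x \<partial>\<gamma>) + \<omega>"
    proof -
      have Dg: "D k \<in> sets \<gamma>" "R K \<in> sets \<gamma>" for k using Db Rb gD(1) by auto
      have i1: "integrable \<gamma> (\<lambda>x. indicator (D k) x * \<phi> x)" "integrable \<gamma> (\<lambda>x. indicator (R K) x * \<phi> x)" for k
        using integrable_mult_indicator[OF Dg(1) ig] integrable_mult_indicator[OF Dg(2) ig] by auto
      have i2: "integrable \<gamma> (\<lambda>x. indicator (D k) x :: real)" for k
        using Dg by (intro integrable_real_indicator) (auto simp: G.emeasure_eq_measure)
      have "(\<Sum>k<K. measure \<gamma> (D k) * \<phi> (z k)) = (\<Sum>k<K. \<integral>x. indicator (D k) x * \<phi> (z k) \<partial>\<gamma>)"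
        using Dg(1) by (intro sum.cong) (auto simp: gD)
      also have "\<dots> \<le> (\<Sum>k<K. \<integral>x. indicator (D k) x * \<phi> x + indicator (D k) x * \<omega> \<partial>\<gamma>)"
      proof (intro sum_mono integral_mono)
        fix k and x :: "'n \<Rightarrow> 'a"
        show "indicator (D k) x * \<phi> (z k) \<le> indicator (D k) x * \<phi> x + indicator (D k) x * \<omega>"
        proof (cases "x \<in> D k")
          case True
          then show ?thesis using osc[of x k] DW[OF True] by (simp add: abs_le_iff)
        qed simp
      qed (use i1 i2 in auto)
      also have "\<dots> = (\<Sum>k<K. \<integral>x. indicator (D k) x * \<phi> x \<partial>\<gamma>) + (\<Sum>k<K. measure \<gamma> (D k)) * \<omega>"
        using i1 i2 Dg by (simp add: sum.distrib sum_distrib_right gD)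
      also have "(\<Sum>k<K. \<integral>x. indicator (D k) x * \<phi> x \<partial>\<gamma>) = (\<integral>x. (\<Sum>k<K. indicator (D k) x * \<phi> x) \<partial>\<gamma>)"
        by (rule Bochner_Integration.integral_sum[symmetric]) (rule i1)
      also have "\<dots> = (\<integral>x. \<phi> x - indicator (R K) x * \<phi> x \<partial>\<gamma>)"
      proof (rule Bochner_Integration.integral_cong[OF refl])
        fix x
        have ind: "(\<Sum>k<K. indicator (D k) x :: real) = indicator (\<Union>k<K. D k) x"
          using Ddisj by (intro indicator_UN_disjoint[symmetric]) (auto simp: disjoint_family_on_def)
        have "(\<Sum>k<K. indicator (D k) x * \<phi> x) = indicator (\<Union>k<K. D k) x * \<phi> x"
          unfolding sum_distrib_right[symmetric] ind ..
        also have "\<dots> = \<phi> x - indicator (R K) x * \<phi> x"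
          by (cases "x \<in> (\<Union>k<K. D k)") (simp_all add: R_def indicator_def)
        finally show "(\<Sum>k<K. indicator (D k) x * \<phi> x) = \<phi> x - indicator (R K) x * \<phi> x" .
      qed
      also have "\<dots> = (\<integral>x. \<phi> x \<partial>\<gamma>) - (\<integral>x. indicator (R K) x * \<phi> x \<partial>\<gamma>)"
        by (rule Bochner_Integration.integral_diff[OF ig i1(2)])
      also have "(\<Sum>k<K. measure \<gamma> (D k)) * \<omega> \<le> 1 * \<omega>"
      proof (rule mult_right_mono[OF _ w])
        have "(\<Sum>k<K. measure \<gamma> (D k)) = measure \<gamma> (\<Union>k<K. D k)"
          using Dg Ddisj by (intro G.finite_measure_finite_Union[symmetric]) (auto simp: disjoint_family_on_def)
        then show "(\<Sum>k<K. measure \<gamma> (D k)) \<le> 1" by simp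
      qed
      finally show ?thesis by simp
    qed
    finally show ?thesis by (simp add: N_def \<epsilon>_def R_def)
  qed
  have \<eta>inj: "AE x in \<eta>. inj x"
    using AE\<eta> by eventually_elim (use Winj separated_inj[OF r2 sw] in blast)
  \<comment> \<open>This crude bound depends on \<open>K\<close> and serves only to make the cost
    integrable against \<open>\<eta>\<close>.\<close>
  have cost\<eta>: "AE x in \<eta>. cost x \<le> (\<Sum>k<K. \<bar>cost (z k)\<bar>) + \<delta> + Qc"
    using AE\<eta>
  proof eventually_elim
    case (elim x)
    have nn: "0 \<le> Qc" "0 \<le> (\<Sum>k<K. \<bar>cost (z k)\<bar>)"
      unfolding Qc_def by (intro mult_nonneg_nonneg abs_ge_zero of_nat_0_le_iff sum_nonneg)+
    show ?case
    proof (cases "x \<in> SD.swapped")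
      case True
      have "cost x \<le> Qc" unfolding Qc_def by (rule cost_separated_le[OF r2 sw[OF True]])
      then show ?thesis using nn \<delta>(1) by linarith
    next
      case False
      then obtain k where k: "k < K" "\<And>i. x i \<in> W k i" using elim by blast
      have "\<bar>cost (z k)\<bar> \<le> (\<Sum>k<K. \<bar>cost (z k)\<bar>)" using k(1) by (intro member_le_sum) auto
      moreover have "\<bar>cost x - cost (z k)\<bar> < \<delta>" using k(2) by (intro Wcost)
      ultimately show ?thesis using nn(1) by linarith
    qed
  qed
  have int\<eta>: "integrable \<eta> cost" by (rule cost_integrableI[OF \<eta>(1) \<eta>inj cost\<eta>])
  have "(\<integral>x. cost x \<partial>\<eta>) \<le> (\<integral>x. cost x \<partial>\<gamma>) - (\<integral>x. indicator (R K) x * cost x \<partial>\<gamma>) + 2 * \<delta> + N * \<epsilon> * bc + (N + 1) * \<epsilon> * Qc"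
  proof (rule key[OF cost_measurable int\<eta> int])
    show "\<bar>cost x - cost (z k)\<bar> \<le> \<delta>" if "\<And>i. x i \<in> W k i" for k x using Wcost[OF that] by simp
    show "- cost (z k) \<le> bc" if "k < K0" for k
    proof -
      have "\<bar>cost (z k)\<bar> \<le> bc" unfolding bc_def using that by (intro member_le_sum) auto
      then show ?thesis by simp
    qed
    show "cost x \<le> Qc" if "x \<in> SD.swapped" for x
      unfolding Qc_def by (rule cost_separated_le[OF r2 sw[OF that]])
  qed (use \<delta> in simp)
  \<comment> \<open>Two of the five \<open>\<delta>\<close> come from the oscillation, one from the
    cost of \<open>\<gamma>\<close> on the leftover set, one from the withdrawal and one from the
    new tuples.\<close>
  also have "\<dots> \<le> (\<integral>x. cost x \<partial>\<gamma>) + 5 * \<delta>"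
    using K(3,4,6) by (simp add: \<epsilon>_def mult.commute mult.left_commute abs_less_iff)
  finally have costle: "(\<integral>x. cost x \<partial>\<eta>) \<le> (\<integral>x. cost x \<partial>\<gamma>) + 5 * \<delta>" .
  have lip: "(\<integral>x. g x \<partial>\<eta>) \<le> (\<integral>x. g x \<partial>\<gamma>) + (2 * L + 3 * B) * \<delta>"
    if L: "\<And>x y. \<bar>g x - g y\<bar> \<le> L * dist x y" and B: "\<And>x. \<bar>g x\<bar> \<le> B" and L0: "0 \<le> L" for g L B
  proof -
    have B0: "0 \<le> B" using B[of undefined] by simp
    have cont: "continuous_on UNIV g"
      by (rule lipschitz_on_continuous_on[of L], rule lipschitz_onI) (use L L0 in \<open>auto simp: dist_real_def\<close>)
    have gm: "g \<in> borel_measurable borel" by (rule borel_measurable_continuous_onI[OF cont])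
    have integ: "integrable \<kappa> g" if k: "\<kappa> \<in> borel_prob_measures" for \<kappa>
    proof -
      note kD = borel_prob_measuresD[OF k]
      interpret K: prob_space \<kappa> by (rule kD)
      have "g \<in> borel_measurable \<kappa>" using gm kD(1) by (metis measurable_cong_sets)
      then show ?thesis using B by (intro K.integrable_const_bound) auto
    qed
    have ie: "integrable \<eta> g" using \<eta>(1) by (intro integ) (simp add: couplings_def)
    have ig: "integrable \<gamma> g" by (rule integ[OF gb])
    have "(\<integral>x. g x \<partial>\<eta>) \<le> (\<integral>x. g x \<partial>\<gamma>) - (\<integral>x. indicator (R K) x * g x \<partial>\<gamma>) + 2 * (L * \<delta>) + N * \<epsilon> * B + (N + 1) * \<epsilon> * B"
    proof (rule key[OF gm ie ig])
      show "\<bar>g x - g (z k)\<bar> \<le> L * \<delta>" if "\<And>i. x i \<in> W k i" for k x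
        using L[of x "z k"] mult_left_mono[OF less_imp_le[OF Wdist[of x k, OF that]] L0] by simp
      show "- g (z k) \<le> B" for k using B[of "z k"] by simp
      show "g x \<le> B" for x using B[of x] by simp
    qed (use L0 \<delta> in simp)
    moreover have "- (\<integral>x. indicator (R K) x * g x \<partial>\<gamma>) \<le> \<epsilon> * B"
    proof -
      have Rg: "R K \<in> sets \<gamma>" using Rb gD(1) by simp
      then have iR: "integrable \<gamma> (indicator (R K) :: _ \<Rightarrow> real)"
        by (intro integrable_real_indicator) (auto simp: G.emeasure_eq_measure)
      have "(\<integral>x. - (indicator (R K) x * g x) \<partial>\<gamma>) \<le> (\<integral>x. indicator (R K) x * B \<partial>\<gamma>)"
      proof (rule integral_mono)
        show "- (indicator (R K) x * g x) \<le> indicator (R K) x * B" for x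
          using B[of x] by (auto simp: indicator_def)
      qed (use integrable_mult_indicator[OF Rg ig] iR in auto)
      then show ?thesis using Rg by (simp add: \<epsilon>_def gD)
    qed
    \<comment> \<open>New, withdrawn and leftover mass contribute at most
      \<open>\<delta> * B\<close> each, whence the factor 3.\<close>
    moreover have "(N + 1) * \<epsilon> * B \<le> \<delta> * B" "N * \<epsilon> * B \<le> \<delta> * B" "\<epsilon> * B \<le> \<delta> * B"
    proof -
      have e0: "0 \<le> \<epsilon>" "0 \<le> N" by (auto simp: \<epsilon>_def N_def)
      have 1: "(N + 1) * \<epsilon> \<le> \<delta>" using K(5) by (simp add: \<epsilon>_def)
      have "N * \<epsilon> \<le> \<delta>" "\<epsilon> \<le> \<delta>"
        using e0 mult_nonneg_nonneg[OF e0(2,1)] 1 unfolding distrib_right by linarith+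
      with 1 show "(N + 1) * \<epsilon> * B \<le> \<delta> * B" "N * \<epsilon> * B \<le> \<delta> * B" "\<epsilon> * B \<le> \<delta> * B"
        using B0 by (auto intro!: mult_right_mono)
    qed
    ultimately show ?thesis by (simp add: algebra_simps)
  qed
  show ?thesis
    using \<eta> \<eta>inj int\<eta> costle lip by (intro exI[of _ \<eta>] exI[of _ U] exI[of _ C]) blast
qed

end

section \<open>Symmetrization\<close>

lemma continuous_on_perm:
  fixes p :: "'n \<Rightarrow> 'n"
  shows "continuous_on UNIV (\<lambda>x :: 'n \<Rightarrow> 'a::topological_space. x \<circ> p)"
  by (rule continuous_on_coordinatewise_then_product) (simp add: continuous_on_product_coordinates)

context borel_prob
begin

lemma perm_measurable:
  fixes p :: "'n::finite \<Rightarrow> 'n"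
  shows "(\<lambda>x. x \<circ> p) \<in> measurable borel (borel :: ('n \<Rightarrow> 'a) measure)"
  by (rule borel_measurable_continuous_onI[OF continuous_on_perm])

lemma distr_PiM_perm:
  fixes p :: "'n::finite \<Rightarrow> 'n"
  assumes "bij p"
  shows "distr (Pi\<^sub>M UNIV (\<lambda>_. M)) (Pi\<^sub>M UNIV (\<lambda>_. M)) (\<lambda>x. x \<circ> p) = Pi\<^sub>M UNIV (\<lambda>_. M)"
proof -
  have "distr (Pi\<^sub>M UNIV (\<lambda>_. M)) (Pi\<^sub>M UNIV (\<lambda>_. M)) (\<lambda>x. \<lambda>n\<in>UNIV. x (p n)) = Pi\<^sub>M UNIV (\<lambda>_. M)"
    by (rule distr_PiM_reindex[where M="\<lambda>_. M"]) (use assms in \<open>auto simp: bij_is_inj prob_space_axioms\<close>)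
  then show ?thesis by (simp add: comp_def restrict_def)
qed

definition perms :: "('n::finite \<Rightarrow> 'n) set" where "perms = {p. bij p}"

lemma card_perms_pos: "0 < card (perms :: ('n::finite \<Rightarrow> 'n) set)"
proof -
  have "id \<in> (perms :: ('n \<Rightarrow> 'n) set)" by (simp add: perms_def)
  then show ?thesis by (auto simp: card_gt_0_iff)
qed

text \<open>The inverse appears because the image of a density under a permutation is its
  composition with the inverse permutation; this is the density of the average of all these
  images.\<close>

definition symmetrized :: "(('n::finite \<Rightarrow> 'a) \<Rightarrow> real) \<Rightarrow> ('n \<Rightarrow> 'a) \<Rightarrow> real" where
  "symmetrized U x = (\<Sum>p\<in>perms. U (x \<circ> inv p)) / real (card (perms :: ('n \<Rightarrow> 'n) set))"

context
  fixes U :: "('n::finite \<Rightarrow> 'a) \<Rightarrow> real" and C c :: real and \<eta> \<eta>s :: "('n \<Rightarrow> 'a) measure"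
  assumes U: "U \<in> borel_measurable borel" and U0: "\<And>x. 0 \<le> U x" and UC: "\<And>x. U x \<le> C"
    and eta: "\<eta> = density (Pi\<^sub>M UNIV (\<lambda>_. M)) (\<lambda>x. ennreal (U x))"
    and etas: "\<eta>s = density (Pi\<^sub>M UNIV (\<lambda>_. M)) (\<lambda>x. ennreal (symmetrized U x))"
    and coupling: "\<eta> \<in> couplings M"
    and c: "c = real (card (perms :: ('n \<Rightarrow> 'n) set))"
begin

private abbreviation "P \<equiv> Pi\<^sub>M UNIV (\<lambda>_::'n. M)"
lemma c_pos: "0 < c"
  using card_perms_pos[where 'n='n] by (simp add: c)

lemma average_const: "ennreal (1 / c) * (\<Sum>p\<in>(perms::('n \<Rightarrow> 'n) set). x) = x"
proof -
  have "ennreal (1 / c) * (\<Sum>p\<in>(perms::('n \<Rightarrow> 'n) set). x) = ennreal (1 / c) * (ennreal c * x)"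
    by (simp add: c ennreal_of_nat_eq_real_of_nat)
  also have "\<dots> = ennreal (1 / c * c) * x"
    using c_pos by (subst ennreal_mult) (auto simp: mult.assoc)
  finally show ?thesis using c_pos by simp
qed

lemma symmetrized_measurable: "symmetrized U \<in> borel_measurable borel"
  unfolding symmetrized_def
  by (intro borel_measurable_divide borel_measurable_sum measurable_compose[OF perm_measurable U]) auto

lemma symmetrized_nonneg: "0 \<le> symmetrized U x"
  unfolding symmetrized_def by (intro divide_nonneg_nonneg sum_nonneg) (auto simp: U0)

lemma symmetrized_le: "symmetrized U x \<le> C"
proof -
  have "(\<Sum>p\<in>perms. U (x \<circ> inv p)) \<le> (\<Sum>p\<in>(perms :: ('n \<Rightarrow> 'n) set). C)" by (intro sum_mono UC)
  then show ?thesis using card_perms_pos[where 'n='n] by (simp add: symmetrized_def divide_le_eq mult.commute)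
qed

text \<open>The product measure is invariant under permutations, so a substitution moves the
  permutation from the density to the integrand.\<close>

lemma perm_integral:
  fixes p :: "'n \<Rightarrow> 'n"
  assumes p: "bij p"
  shows "\<phi> \<in> borel_measurable borel \<Longrightarrow> (\<integral>\<^sup>+x. ennreal (U (x \<circ> inv p)) * \<phi> x \<partial>P) = (\<integral>\<^sup>+x. \<phi> (x \<circ> p) \<partial>\<eta>)"
    and "\<psi> \<in> borel_measurable borel \<Longrightarrow> (\<integral>x. U (x \<circ> inv p) * \<psi> x \<partial>P) = (\<integral>x. (\<psi> (x \<circ> p) :: real) \<partial>\<eta>)"
proof -
  have ip: "bij (inv p)" using p by (rule bij_imp_bij_inv)
  have pm: "(\<lambda>x. x \<circ> q) \<in> measurable P P" for q :: "'n \<Rightarrow> 'n"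
    using perm_measurable[of q] by (simp add: measurable_cong_sets[OF PiM_M_borel PiM_M_borel])
  have Um: "U \<in> borel_measurable P" using U by (simp add: PiM_M_measurable)
  have id: "(x \<circ> inv p) \<circ> p = x" for x :: "'n \<Rightarrow> 'a"
    using p by (simp add: comp_assoc bij_is_inj)
  show "(\<integral>\<^sup>+x. ennreal (U (x \<circ> inv p)) * \<phi> x \<partial>P) = (\<integral>\<^sup>+x. \<phi> (x \<circ> p) \<partial>\<eta>)" if "\<phi> \<in> borel_measurable borel"
  proof -
    have fm: "(\<lambda>x. \<phi> (x \<circ> p)) \<in> borel_measurable P"
      unfolding PiM_M_measurable by (rule measurable_compose[OF perm_measurable that])
    have "(\<integral>\<^sup>+x. \<phi> (x \<circ> p) \<partial>\<eta>) = (\<integral>\<^sup>+x. ennreal (U x) * \<phi> (x \<circ> p) \<partial>P)"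
      unfolding eta using Um fm by (intro nn_integral_density) auto
    also have "\<dots> = (\<integral>\<^sup>+x. ennreal (U x) * \<phi> (x \<circ> p) \<partial>distr P P (\<lambda>x. x \<circ> inv p))"
      by (simp add: distr_PiM_perm[OF ip])
    also have "\<dots> = (\<integral>\<^sup>+x. ennreal (U (x \<circ> inv p)) * \<phi> ((x \<circ> inv p) \<circ> p) \<partial>P)"
      using Um fm by (intro nn_integral_distr pm) auto
    finally show ?thesis unfolding id ..
  qed
  show "(\<integral>x. U (x \<circ> inv p) * \<psi> x \<partial>P) = (\<integral>x. \<psi> (x \<circ> p) \<partial>\<eta>)" if "\<psi> \<in> borel_measurable borel"
  proof -
    have fm: "(\<lambda>x. \<psi> (x \<circ> p)) \<in> borel_measurable P"
      unfolding PiM_M_measurable by (rule measurable_compose[OF perm_measurable that])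
    have "(\<integral>x. \<psi> (x \<circ> p) \<partial>\<eta>) = (\<integral>x. U x * \<psi> (x \<circ> p) \<partial>P)"
      unfolding eta using Um fm U0 by (subst integral_density) auto
    also have "\<dots> = (\<integral>x. U x * \<psi> (x \<circ> p) \<partial>distr P P (\<lambda>x. x \<circ> inv p))"
      by (simp add: distr_PiM_perm[OF ip])
    also have "\<dots> = (\<integral>x. U (x \<circ> inv p) * \<psi> ((x \<circ> inv p) \<circ> p) \<partial>P)"
      using Um fm by (intro integral_distr pm) auto
    finally show ?thesis unfolding id ..
  qed
qed

lemma symmetrized_nn_integral:
  assumes "\<phi> \<in> borel_measurable borel"
  shows "(\<integral>\<^sup>+x. \<phi> x \<partial>\<eta>s) = ennreal (1 / c) * (\<Sum>p\<in>perms. \<integral>\<^sup>+x. \<phi> (x \<circ> p) \<partial>\<eta>)"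
proof -
  have fm: "\<phi> \<in> borel_measurable P" using assms by (simp add: PiM_M_measurable)
  have sm: "symmetrized U \<in> borel_measurable P" using symmetrized_measurable by (simp add: PiM_M_measurable)
  have um: "(\<lambda>x. U (x \<circ> inv p)) \<in> borel_measurable P" for p
    unfolding PiM_M_measurable by (rule measurable_compose[OF perm_measurable U])
  have "(\<integral>\<^sup>+x. \<phi> x \<partial>\<eta>s) = (\<integral>\<^sup>+x. ennreal (symmetrized U x) * \<phi> x \<partial>P)"
    unfolding etas using sm fm by (intro nn_integral_density) auto
  also have "\<dots> = (\<integral>\<^sup>+x. ennreal (1 / c) * (\<Sum>p\<in>perms. ennreal (U (x \<circ> inv p)) * \<phi> x) \<partial>P)"
  proof (rule nn_integral_cong)
    fix x
    have "ennreal (symmetrized U x) = ennreal (1 / c) * ennreal (\<Sum>p\<in>perms. U (x \<circ> inv p))"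
      unfolding symmetrized_def c by (subst ennreal_mult[symmetric]) (auto simp: U0 sum_nonneg)
    also have "ennreal (\<Sum>p\<in>perms. U (x \<circ> inv p)) = (\<Sum>p\<in>perms. ennreal (U (x \<circ> inv p)))"
      by (rule sum_ennreal[symmetric]) (rule U0)
    finally show "ennreal (symmetrized U x) * \<phi> x = ennreal (1 / c) * (\<Sum>p\<in>perms. ennreal (U (x \<circ> inv p)) * \<phi> x)"
      by (simp only: sum_distrib_right mult.assoc)
  qed
  also have "\<dots> = ennreal (1 / c) * (\<Sum>p\<in>perms. \<integral>\<^sup>+x. ennreal (U (x \<circ> inv p)) * \<phi> x \<partial>P)"
    using um fm by (subst nn_integral_cmult) (auto intro!: borel_measurable_sum simp: nn_integral_sum)
  also have "\<dots> = ennreal (1 / c) * (\<Sum>p\<in>perms. \<integral>\<^sup>+x. \<phi> (x \<circ> p) \<partial>\<eta>)"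
    by (intro arg_cong2[where f="(*)"] sum.cong refl perm_integral(1)[OF _ assms]) (simp add: perms_def)
  finally show ?thesis .
qed

lemma symmetrized_integral:
  assumes gm: "g \<in> borel_measurable borel" and gB: "\<And>x. \<bar>g x\<bar> \<le> (B::real)"
  shows "(\<integral>x. g x \<partial>\<eta>s) = (\<Sum>p\<in>perms. \<integral>x. g (x \<circ> p) \<partial>\<eta>) / c"
proof -
  interpret P: prob_space P by (intro prob_space_PiM prob_space_axioms)
  have fm: "g \<in> borel_measurable P" using gm by (simp add: PiM_M_measurable)
  have sm: "symmetrized U \<in> borel_measurable P" using symmetrized_measurable by (simp add: PiM_M_measurable)
  have um: "(\<lambda>x. U (x \<circ> inv p)) \<in> borel_measurable P" for p
    unfolding PiM_M_measurable by (rule measurable_compose[OF perm_measurable U])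
  have "(\<integral>x. g x \<partial>\<eta>s) = (\<integral>x. symmetrized U x * g x \<partial>P)"
    unfolding etas using sm fm symmetrized_nonneg by (subst integral_density) auto
  also have "\<dots> = (\<integral>x. (\<Sum>p\<in>perms. U (x \<circ> inv p) * g x) / c \<partial>P)"
    by (simp add: symmetrized_def c sum_distrib_right)
  also have "\<dots> = (\<Sum>p\<in>perms. \<integral>x. U (x \<circ> inv p) * g x \<partial>P) / c"
  proof (subst Bochner_Integration.integral_divide_zero, subst Bochner_Integration.integral_sum)
    fix p
    show "integrable P (\<lambda>x. U (x \<circ> inv p) * g x)"
    proof (rule P.integrable_const_bound[where B="C * B"])
      show "AE x in P. norm (U (x \<circ> inv p) * g x) \<le> C * B"
      proof (intro AE_I2)
        fix x
        have "\<bar>U (x \<circ> inv p)\<bar> * \<bar>g x\<bar> \<le> C * B"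
          using U0[of "x \<circ> inv p"] UC[of "x \<circ> inv p"] gB by (intro mult_mono) auto
        then show "norm (U (x \<circ> inv p) * g x) \<le> C * B" by (simp add: abs_mult)
      qed
    qed (use um fm in auto)
  qed auto
  also have "\<dots> = (\<Sum>p\<in>perms. \<integral>x. g (x \<circ> p) \<partial>\<eta>) / c"
    by (intro arg_cong2[where f="(/)"] sum.cong refl perm_integral(2)[OF _ gm]) (simp add: perms_def)
  finally show ?thesis .
qed

lemma symmetrized_invariant_integral:
  assumes m: "\<phi> \<in> borel_measurable borel" and inv: "\<And>x p. bij p \<Longrightarrow> \<phi> (x \<circ> p) = \<phi> x"
  shows "(\<integral>\<^sup>+x. \<phi> x \<partial>\<eta>s) = (\<integral>\<^sup>+x. \<phi> x \<partial>\<eta>)"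
proof -
  have "(\<integral>\<^sup>+x. \<phi> x \<partial>\<eta>s) = ennreal (1 / c) * (\<Sum>p\<in>(perms::('n \<Rightarrow> 'n) set). \<integral>\<^sup>+x. \<phi> x \<partial>\<eta>)"
    unfolding symmetrized_nn_integral[OF m]
    by (intro arg_cong2[where f="(*)"] sum.cong nn_integral_cong refl) (simp add: inv perms_def)
  then show ?thesis unfolding average_const .
qed

text \<open>The \<open>i\<close>-th marginal of the image under \<open>p\<close> is the
  \<open>p i\<close>-th marginal of \<open>\<eta>\<close>, hence \<open>M\<close> for every
  \<open>p\<close>. A further permutation \<open>q\<close> only relabels the average through the
  bijection sending \<open>p\<close> to \<open>p \<circ> q\<close>.\<close>

lemma symmetrized_coupling: "\<eta>s \<in> couplings M \<inter> sym_prob_measures"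
proof -
  have cb: "\<eta> \<in> borel_prob_measures" and cd: "distr \<eta> borel (\<lambda>x. x i) = M" for i
    using coupling by (auto simp: couplings_def)
  note eD = borel_prob_measuresD[OF cb]
  interpret E: prob_space \<eta> by (rule eD)
  have sets: "sets \<eta>s = sets borel" "space \<eta>s = UNIV"
    unfolding etas by (simp_all add: PiM_M_borel space_PiM)
  have em: "emeasure \<eta>s A = ennreal (1 / c) * (\<Sum>p\<in>perms. emeasure \<eta> ((\<lambda>x. x \<circ> p) -` A))"
    if A: "A \<in> sets borel" for A
  proof -
    have "emeasure \<eta>s A = (\<integral>\<^sup>+x. indicator A x \<partial>\<eta>s)" using A by (simp add: sets)
    also have "\<dots> = ennreal (1 / c) * (\<Sum>p\<in>perms. \<integral>\<^sup>+x. indicator A (x \<circ> p) \<partial>\<eta>)"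
      by (rule symmetrized_nn_integral[OF borel_measurable_indicator[OF A]])
    also have "(\<Sum>p\<in>perms. \<integral>\<^sup>+x. indicator A (x \<circ> p) \<partial>\<eta>) = (\<Sum>p\<in>perms. emeasure \<eta> ((\<lambda>x. x \<circ> p) -` A))"
    proof (intro sum.cong refl)
      fix p :: "'n \<Rightarrow> 'n"
      have "(\<lambda>x. x \<circ> p) -` A \<in> sets \<eta>"
        using measurable_sets[OF perm_measurable A, of p] by (simp add: eD)
      then have "emeasure \<eta> ((\<lambda>x. x \<circ> p) -` A) = (\<integral>\<^sup>+x. indicator ((\<lambda>x. x \<circ> p) -` A) x \<partial>\<eta>)" by simp
      then show "(\<integral>\<^sup>+x. indicator A (x \<circ> p) \<partial>\<eta>) = emeasure \<eta> ((\<lambda>x. x \<circ> p) -` A)"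
        by (simp add: indicator_def)
    qed
    finally show ?thesis .
  qed
  have "emeasure \<eta>s (space \<eta>s) = ennreal (1 / c) * (\<Sum>p\<in>(perms::('n \<Rightarrow> 'n) set). 1)"
    using em[of UNIV] E.emeasure_space_1 by (simp add: sets eD)
  then have bp: "\<eta>s \<in> borel_prob_measures"
    unfolding average_const by (auto simp: borel_prob_measures_def sets intro: prob_spaceI)
  have "distr \<eta>s borel (\<lambda>x. x i) = M" for i
  proof (rule measure_eqI)
    fix A assume "A \<in> sets (distr \<eta>s borel (\<lambda>x. x i))"
    then have A: "A \<in> sets borel" by simp
    have m: "(\<lambda>x. x i) \<in> measurable \<eta>s borel" "\<And>j. (\<lambda>x. x j) \<in> measurable \<eta> borel"
      using sets(1) eD(1) measurable_product_coordinates by (metis measurable_cong_sets)+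
    have vA: "(\<lambda>x. x i) -` A \<in> sets (borel :: ('n \<Rightarrow> 'a) measure)"
      using measurable_sets[OF measurable_product_coordinates[of i] A] by simp
    have comp_em: "emeasure \<eta> ((\<lambda>x. x \<circ> p) -` (\<lambda>x. x i) -` A) = emeasure M A" for p
    proof -
      have "emeasure M A = emeasure \<eta> ((\<lambda>x. x (p i)) -` A)"
        using A by (subst cd[of "p i", symmetric], subst emeasure_distr[OF m(2)]) (auto simp: eD)
      then show ?thesis by (simp add: vimage_def)
    qed
    have "emeasure (distr \<eta>s borel (\<lambda>x. x i)) A = emeasure \<eta>s ((\<lambda>x. x i) -` A)"
      using A by (subst emeasure_distr[OF m(1)]) (auto simp: sets)
    also have "\<dots> = ennreal (1 / c) * (\<Sum>p\<in>perms. emeasure \<eta> ((\<lambda>x. x \<circ> p) -` (\<lambda>x. x i) -` A))"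
      by (rule em[OF vA])
    also have "\<dots> = emeasure M A" unfolding comp_em by (rule average_const)
    finally show "emeasure (distr \<eta>s borel (\<lambda>x. x i)) A = emeasure M A" .
  qed (simp add: M_borel)
  then have cp: "\<eta>s \<in> couplings M" using bp by (simp add: couplings_def)
  have "distr \<eta>s borel (\<lambda>x. x \<circ> q) = \<eta>s" if q: "bij q" for q
  proof (rule measure_eqI)
    fix A assume "A \<in> sets (distr \<eta>s borel (\<lambda>x. x \<circ> q))"
    then have A: "A \<in> sets borel" by simp
    have m: "(\<lambda>x. x \<circ> q) \<in> measurable \<eta>s borel"
      using sets(1) perm_measurable by (metis measurable_cong_sets)
    have vA: "(\<lambda>x. x \<circ> q) -` A \<in> sets (borel :: ('n \<Rightarrow> 'a) measure)"
      using measurable_sets[OF perm_measurable[of q] A] by simp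
    have "emeasure (distr \<eta>s borel (\<lambda>x. x \<circ> q)) A = emeasure \<eta>s ((\<lambda>x. x \<circ> q) -` A)"
      using A by (subst emeasure_distr[OF m]) (auto simp: sets)
    also have "\<dots> = ennreal (1 / c) * (\<Sum>p\<in>perms. emeasure \<eta> ((\<lambda>x. x \<circ> p) -` (\<lambda>x. x \<circ> q) -` A))"
      by (rule em[OF vA])
    also have "(\<Sum>p\<in>perms. emeasure \<eta> ((\<lambda>x. x \<circ> p) -` (\<lambda>x. x \<circ> q) -` A)) = (\<Sum>p\<in>perms. emeasure \<eta> ((\<lambda>x. x \<circ> (p \<circ> q)) -` A))"
      by (simp add: vimage_def comp_assoc)
    also have "\<dots> = (\<Sum>p\<in>perms. emeasure \<eta> ((\<lambda>x. x \<circ> p) -` A))"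
    proof (rule sum.reindex_bij_witness[where i="\<lambda>p. p \<circ> inv q" and j="\<lambda>p. p \<circ> q"])
      fix p :: "'n \<Rightarrow> 'n"
      show "(p \<circ> q) \<circ> inv q = p" using q by (simp add: comp_assoc bij_is_surj surj_iff[THEN iffD1])
      show "(p \<circ> inv q) \<circ> q = p" using q by (simp add: comp_assoc bij_is_inj)
      show "p \<circ> q \<in> perms" if "p \<in> perms" using that q by (auto simp: perms_def intro: bij_comp)
      show "p \<circ> inv q \<in> perms" if "p \<in> perms" using that bij_imp_bij_inv[OF q] by (auto simp: perms_def intro: bij_comp)
    qed simp
    also have "ennreal (1 / c) * \<dots> = emeasure \<eta>s A" by (rule em[OF A, symmetric])
    finally show "emeasure (distr \<eta>s borel (\<lambda>x. x \<circ> q)) A = emeasure \<eta>s A" .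
  qed (simp add: sets)
  then show ?thesis using cp bp by (simp add: sym_prob_measures_def)
qed

end

text \<open>Integrals of a function of one coordinate converge and take the value prescribed by
  \<open>M\<close> infinitely often. The hypothesis is only \<open>frequently\<close>, so that its
  contrapositive says that a limit outside the couplings forces almost all members outside.\<close>

lemma narrow_limit_coupling:
  fixes \<gamma> :: "('n::finite \<Rightarrow> 'a) measure"
  assumes conv: "narrowly_converges \<gamma>s \<gamma>" and g: "\<gamma> \<in> borel_prob_measures"
    and freq: "frequently (\<lambda>n. \<gamma>s n \<in> couplings M) sequentially"
  shows "\<gamma> \<in> couplings M"
proof -
  have Mb: "M \<in> borel_prob_measures" by (simp add: borel_prob_measures_def M_borel prob_space_axioms)
  have "distr \<gamma> borel (\<lambda>x. x i) = M" for i
  proof (rule borel_prob_measure_eqI[OF _ Mb])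
    have comp: "(\<lambda>x. x i) \<in> measurable \<kappa> borel" if "sets \<kappa> = sets borel" for \<kappa> :: "('n \<Rightarrow> 'a) measure"
      using that measurable_product_coordinates by (metis measurable_cong_sets)
    note gD = borel_prob_measuresD[OF g]
    show "distr \<gamma> borel (\<lambda>x. x i) \<in> borel_prob_measures"
      unfolding borel_prob_measures_def using prob_space.prob_space_distr[OF gD(3) comp[OF gD(1)]] by simp
    fix \<phi> :: "'a \<Rightarrow> real" assume cont: "continuous_on UNIV \<phi>" and bd: "bounded (range \<phi>)"
    have \<phi>m: "\<phi> \<in> borel_measurable borel" by (rule borel_measurable_continuous_onI[OF cont])
    have "continuous_on UNIV (\<lambda>x :: 'n \<Rightarrow> 'a. \<phi> (x i))"
      by (rule continuous_on_compose2[OF cont]) (auto intro: continuous_on_product_coordinates)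
    moreover have "bounded (range (\<lambda>x :: 'n \<Rightarrow> 'a. \<phi> (x i)))" using bd by (rule bounded_subset) auto
    ultimately have lim: "(\<lambda>n. \<integral>x. \<phi> (x i) \<partial>\<gamma>s n) \<longlonglongrightarrow> (\<integral>x. \<phi> (x i) \<partial>\<gamma>)"
      using conv by (simp add: narrowly_converges_def)
    have "(\<integral>x. \<phi> (x i) \<partial>\<gamma>) = (\<integral>t. \<phi> t \<partial>M)"
    proof (rule ccontr)
      assume "(\<integral>x. \<phi> (x i) \<partial>\<gamma>) \<noteq> (\<integral>t. \<phi> t \<partial>M)"
      from tendsto_imp_eventually_ne[OF lim this]
      have "eventually (\<lambda>n. (\<integral>x. \<phi> (x i) \<partial>\<gamma>s n) \<noteq> (\<integral>t. \<phi> t \<partial>M)) sequentially" .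
      from frequently_eventually_conj[OF freq this]
      obtain n where "\<gamma>s n \<in> couplings M" "(\<integral>x. \<phi> (x i) \<partial>\<gamma>s n) \<noteq> (\<integral>t. \<phi> t \<partial>M)"
        using frequently_ex by blast
      then show False using couplings_integral(3)[of "\<gamma>s n" M \<phi> i] \<phi>m by simp
    qed
    then show "(\<integral>t. \<phi> t \<partial>distr \<gamma> borel (\<lambda>x. x i)) = (\<integral>t. \<phi> t \<partial>M)"
      by (subst integral_distr[OF comp[OF gD(1)] \<phi>m])
  qed
  then show ?thesis using g by (simp add: couplings_def)
qed

end

text \<open>A permutation does not preserve the set of pairs with \<open>i < j\<close>, but it
  preserves that of pairs with \<open>i \<noteq> j\<close>, over which a symmetric summand has twice
  the sum.\<close>

lemma sum_pairs_perm:
  fixes G :: "'n::{finite,linorder} \<Rightarrow> 'n \<Rightarrow> real" and p :: "'n \<Rightarrow> 'n"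
  assumes sym: "\<And>i j. G i j = G j i" and p: "bij p"
  shows "(\<Sum>(i, j)\<in>{(i, j). i < j}. G (p i) (p j)) = (\<Sum>(i, j)\<in>{(i, j). i < j}. G i j)"
proof -
  have double: "(\<Sum>(i, j)\<in>{(i, j). i \<noteq> j}. F i j) = 2 * (\<Sum>(i, j)\<in>{(i, j). i < j}. F i j)"
    if "\<And>i j. F i j = F j i" for F :: "'n \<Rightarrow> 'n \<Rightarrow> real"
  proof -
    have "{(i, j). i \<noteq> j} = {(i, j). i < j} \<union> {(i::'n, j). j < i}" by auto
    then have "(\<Sum>(i, j)\<in>{(i, j). i \<noteq> j}. F i j) = (\<Sum>(i, j)\<in>{(i, j). i < j}. F i j) + (\<Sum>(i, j)\<in>{(i, j). j < i}. F i j)"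
      by (simp only:) (rule sum.union_disjoint, auto)
    also have "(\<Sum>(i, j)\<in>{(i, j). j < i}. F i j) = (\<Sum>(i, j)\<in>{(i, j). i < j}. F i j)"
      by (rule sum.reindex_bij_witness[where i=prod.swap and j=prod.swap]) (auto simp: that)
    finally show ?thesis by simp
  qed
  have "(\<Sum>(i, j)\<in>{(i, j). i \<noteq> j}. G (p i) (p j)) = (\<Sum>(i, j)\<in>{(i, j). i \<noteq> j}. G i j)"
    by (rule sum.reindex_bij_witness[where i="map_prod (inv p) (inv p)" and j="map_prod p p"])
      (auto simp: surj_f_inv_f[OF bij_is_surj[OF p]] inv_f_f[OF bij_is_inj[OF p]]
        dest: injD[OF bij_is_inj[OF p]] injD[OF bij_is_inj[OF bij_imp_bij_inv[OF p]]])
  then show ?thesis using double[of G] double[of "\<lambda>i j. G (p i) (p j)"] sym by simp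
qed

context repulsive_cost
begin

lemma pair_cost_perm:
  fixes x :: "'n::{finite,linorder} \<Rightarrow> 'a" and p :: "'n \<Rightarrow> 'n"
  assumes p: "bij p"
  shows "pair_cost f (x \<circ> p) = pair_cost f x"
proof -
  have "inj (x \<circ> p) \<longleftrightarrow> inj x"
    using p by (metis bij_is_inj bij_is_surj comp_assoc comp_id inj_compose inj_on_imageI surj_iff)
  moreover have "(\<Sum>(i, j)\<in>pairs. fr (dist (x (p i)) (x (p j)))) = (\<Sum>(i, j)\<in>pairs. fr (dist (x i) (x j)))"
    unfolding pairs_def by (rule sum_pairs_perm[OF _ p]) (simp add: dist_commute)
  ultimately show ?thesis by (simp add: pair_cost_eq cost_def)
qed

text \<open>The sets of tuples separated by \<open>r / (n + 1)\<close> increase to the injective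
  tuples, which have full mass, so one of them has mass above \<open>2 * (N - 1) * s\<close>.
  Passing to this smaller radius keeps the bound \<open>s\<close> on balls. The two-sided estimate
  comes from using both \<open>g\<close> and \<open>- g\<close>.\<close>

lemma approximation:
  fixes \<gamma> :: "('n::{finite,linorder} \<Rightarrow> 'a) measure"
  assumes g: "\<gamma> \<in> couplings M" and inj: "AE x in \<gamma>. inj x" and int: "integrable \<gamma> cost"
    and r: "r > 0" and s: "\<And>x. measure M (ball x r) \<le> s" "2 * (real CARD('n) - 1) * s < 1"
    and d: "0 < d"
  shows "\<exists>\<eta> U C. \<eta> \<in> couplings M \<and> U \<in> borel_measurable borel \<and> (\<forall>x. 0 \<le> U x \<and> U x \<le> C) \<and>
    \<eta> = density (Pi\<^sub>M UNIV (\<lambda>_. M)) (\<lambda>x. ennreal (U x)) \<and>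
    transport_cost f \<eta> \<le> ereal ((\<integral>x. cost x \<partial>\<gamma>) + 5 * d) \<and>
    (\<forall>g L B. (\<forall>x y. \<bar>g x - g y\<bar> \<le> L * dist x y) \<longrightarrow> (\<forall>x. \<bar>g x\<bar> \<le> B) \<longrightarrow> 0 \<le> L \<longrightarrow>
       \<bar>(\<integral>x. g x \<partial>\<eta>) - (\<integral>x. g x \<partial>\<gamma>)\<bar> \<le> (2 * L + 3 * B) * d)"
proof -
  note gD = borel_prob_measuresD[OF couplingsD(1)[OF g]]
  interpret G: prob_space \<gamma> by (rule gD)
  define A where "A n = (separated (r / real (Suc n)) :: ('n \<Rightarrow> 'a) set)" for n
  have Am: "A n \<in> sets \<gamma>" for n using separated_borel gD(1) by (simp add: A_def)
  have incA: "incseq A"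
  proof (rule incseq_SucI, rule subsetI)
    fix n x assume x: "x \<in> A n"
    have "r / real (Suc (Suc n)) \<le> r / real (Suc n)" using r by (intro divide_left_mono) auto
    then show "x \<in> A (Suc n)" using x unfolding A_def separated_def by (blast intro: order_trans)
  qed
  have UA: "{x. inj x} \<subseteq> (\<Union>n. A n)"
  proof clarify
    fix x :: "'n \<Rightarrow> 'a" assume x: "inj x"
    define S where "S = (\<lambda>(i, j). dist (x i) (x j)) ` {(i, j). i \<noteq> j}"
    have fin: "finite S" by (simp add: S_def)
    have pos: "\<forall>t\<in>S. 0 < t" using x by (auto simp: S_def dest: injD)
    obtain n where n: "\<forall>t\<in>S. r / real (Suc n) \<le> t"
    proof -
      have "eventually (\<lambda>n. \<forall>t\<in>S. r / real (Suc n) < t) sequentially"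
      proof (intro eventually_ball_finite[OF fin] ballI)
        fix t assume "t \<in> S"
        have "(\<lambda>n. r / real (Suc n)) \<longlonglongrightarrow> 0" by (rule LIMSEQ_Suc[OF lim_const_over_n])
        then show "eventually (\<lambda>n. r / real (Suc n) < t) sequentially"
          by (rule order_tendstoD(2)) (use pos \<open>t \<in> S\<close> in blast)
      qed
      then show ?thesis using that eventually_happens by (metis (mono_tags, lifting) less_imp_le trivial_limit_sequentially)
    qed
    then have "x \<in> A n" by (auto simp: A_def separated_def S_def)
    then show "x \<in> (\<Union>n. A n)" by blast
  qed
  have "(\<lambda>n. measure \<gamma> (A n)) \<longlonglongrightarrow> measure \<gamma> (\<Union>n. A n)"
    using Am incA by (intro G.finite_Lim_measure_incseq) auto
  moreover have "measure \<gamma> (\<Union>n. A n) = 1"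
    using inj UA Am by (subst G.prob_eq_1) (auto elim!: eventually_mono)
  ultimately have "(\<lambda>n. measure \<gamma> (A n)) \<longlonglongrightarrow> 1" by simp
  from order_tendstoD(1)[OF this s(2)] obtain n where n: "2 * (real CARD('n) - 1) * s < measure \<gamma> (A n)"
    using eventually_happens by force
  define r' where "r' = r / real (Suc n)"
  have r': "0 < r'" "r' \<le> r" using r by (auto simp: r'_def divide_le_eq)
  define \<delta> where "\<delta> = min d (r' / 8)"
  have \<delta>: "0 < \<delta>" "\<delta> \<le> r' / 8" "\<delta> \<le> d" using r' d by (auto simp: \<delta>_def)
  have s': "measure M (ball x r') \<le> s" for x
  proof -
    have "measure M (ball x r') \<le> measure M (ball x r)"
      using r'(2) by (intro finite_measure_mono subset_ball) (auto simp: M_borel)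
    then show ?thesis using s(1)[of x] by simp
  qed
  obtain \<eta> U C where \<eta>: "\<eta> \<in> couplings M" "U \<in> borel_measurable borel" "\<forall>x. 0 \<le> U x \<and> U x \<le> C"
    "\<eta> = density (Pi\<^sub>M UNIV (\<lambda>_. M)) (\<lambda>x. ennreal (U x))"
    and \<eta>i: "AE x in \<eta>. inj x" "integrable \<eta> cost" "(\<integral>x. cost x \<partial>\<eta>) \<le> (\<integral>x. cost x \<partial>\<gamma>) + 5 * \<delta>"
    and lip: "\<forall>g L B. (\<forall>x y. \<bar>g x - g y\<bar> \<le> L * dist x y) \<longrightarrow> (\<forall>x. \<bar>g x\<bar> \<le> B) \<longrightarrow> 0 \<le> L \<longrightarrow>
       (\<integral>x. g x \<partial>\<eta>) \<le> (\<integral>x. g x \<partial>\<gamma>) + (2 * L + 3 * B) * \<delta>"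
    using approximation_aux[OF g inj int r'(1) s' n[unfolded A_def r'_def[symmetric]] \<delta>(1,2)] by blast
  have "transport_cost f \<eta> \<le> ereal ((\<integral>x. cost x \<partial>\<gamma>) + 5 * d)"
    using \<eta>i(3) \<delta>(3) by (simp add: transport_cost_eq_integral[OF \<eta>i(1,2)])
  moreover have "\<bar>(\<integral>x. g x \<partial>\<eta>) - (\<integral>x. g x \<partial>\<gamma>)\<bar> \<le> (2 * L + 3 * B) * d"
    if L: "\<forall>x y. \<bar>g x - g y\<bar> \<le> L * dist x y" and B: "\<forall>x. \<bar>g x\<bar> \<le> B" and L0: "0 \<le> L"
    for g :: "('n \<Rightarrow> 'a) \<Rightarrow> real" and L B
  proof -
    have B0: "0 \<le> B" using B[rule_format, of undefined] by simp
    have "(\<integral>x. g x \<partial>\<eta>) \<le> (\<integral>x. g x \<partial>\<gamma>) + (2 * L + 3 * B) * \<delta>" using lip L B L0 by blast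
    moreover have "(\<integral>x. - g x \<partial>\<eta>) \<le> (\<integral>x. - g x \<partial>\<gamma>) + (2 * L + 3 * B) * \<delta>"
    proof (rule lip[rule_format])
      show "\<bar>- g x - - g y\<bar> \<le> L * dist x y" for x y using L[rule_format, of x y] by linarith
    qed (use B L0 in auto)
    moreover have "(2 * L + 3 * B) * \<delta> \<le> (2 * L + 3 * B) * d" using B0 L0 \<delta>(3) by (intro mult_left_mono) auto
    ultimately show ?thesis by (simp add: abs_le_iff)
  qed
  ultimately show ?thesis using \<eta> by (intro exI[of _ \<eta>] exI[of _ U] exI[of _ C]) blast
qed

end

section \<open>Gamma-convergence\<close>

lemma sym_prob_measure_integral:
  fixes \<gamma> :: "('n::finite \<Rightarrow> 'a::second_countable_topology) measure"
  assumes g: "\<gamma> \<in> sym_prob_measures" and p: "bij p" and m: "\<phi> \<in> borel_measurable borel"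
  shows "(\<integral>x. (\<phi> (x \<circ> p) :: real) \<partial>\<gamma>) = (\<integral>x. \<phi> x \<partial>\<gamma>)"
proof -
  have b: "\<gamma> \<in> borel_prob_measures" and d: "distr \<gamma> borel (\<lambda>x. x \<circ> p) = \<gamma>"
    using g p by (auto simp: sym_prob_measures_def)
  have "(\<lambda>x. x \<circ> p) \<in> measurable \<gamma> borel"
    using borel_measurable_continuous_onI[OF continuous_on_perm] borel_prob_measuresD(1)[OF b] by (metis measurable_cong_sets)
  then have "(\<integral>x. \<phi> x \<partial>distr \<gamma> borel (\<lambda>x. x \<circ> p)) = (\<integral>x. \<phi> (x \<circ> p) \<partial>\<gamma>)"
    by (rule integral_distr) (rule m)
  then show ?thesis by (simp add: d)
qed

locale entropic_transport =
  entropy_density m \<rho> + repulsive_cost "density m (\<lambda>x. ennreal (\<rho> x))" f z0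
  for m :: "'a::polish_space measure" and \<rho> :: "'a \<Rightarrow> real" and f :: "real \<Rightarrow> ereal" and z0 :: 'a
begin

text \<open>If the limit is no coupling, almost all values are infinite. Otherwise the entropy is at
  least \<open>- K\<close> with the same \<open>K\<close> for all couplings, so its contribution
  vanishes with \<open>\<tau>\<close> in the lower bound and semicontinuity of the cost
  remains.\<close>

lemma Gamma_liminf:
  fixes \<gamma> :: "('n::{finite,linorder} \<Rightarrow> 'a) measure"
  assumes tau_pos: "\<And>n. 0 < \<tau> n" and tau_lim: "\<tau> \<longlonglongrightarrow> 0"
    and g: "\<gamma> \<in> borel_prob_measures" and conv: "narrowly_converges \<gamma>s \<gamma>"
  shows "limit_functional f \<mu> \<gamma> \<le> liminf (\<lambda>n. entropic_functional f m \<mu> (\<tau> n) (\<gamma>s n))"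
proof (subst le_Liminf_iff, intro allI impI)
  fix y assume y: "y < limit_functional f \<mu> \<gamma>"
  show "eventually (\<lambda>n. y < entropic_functional f m \<mu> (\<tau> n) (\<gamma>s n)) sequentially"
  proof (cases "\<gamma> \<in> couplings \<mu>")
    case False
    then have "\<not> frequently (\<lambda>n. \<gamma>s n \<in> couplings \<mu>) sequentially"
      using narrow_limit_coupling[OF conv g] by blast
    then have "eventually (\<lambda>n. \<gamma>s n \<notin> couplings \<mu>) sequentially" by (simp add: frequently_def)
    then show ?thesis
      by eventually_elim (use y in \<open>auto simp: entropic_functional_def dest: less_le_trans\<close>)
  next
    case True
    define K where "K = 1 + real CARD('n) * (\<integral>t. \<bar>ln (\<rho> t)\<bar> \<partial>\<mu>)"
    have yC: "y < transport_cost f \<gamma>" using y True by (simp add: limit_functional_def)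
    \<comment> \<open>Two levels are put above \<open>y\<close>: the cost reaches \<open>a\<close>,
      and the gap \<open>a - b\<close> absorbs \<open>\<tau> n * K\<close>.\<close>
    then obtain a where a: "y < ereal a" "ereal a < transport_cost f \<gamma>" using ereal_dense2 by blast
    then obtain b where b: "y < ereal b" "ereal b < ereal a" using ereal_dense2 by blast
    have "(\<lambda>n. \<tau> n * K) \<longlonglongrightarrow> 0 * K" by (intro tendsto_intros tau_lim)
    then have "eventually (\<lambda>n. \<tau> n * K < a - b) sequentially"
      by (rule order_tendstoD(2)) (use b in simp)
    with transport_cost_lsc[OF True conv a(2)] show ?thesis
    proof eventually_elim
      case (elim n)
      show ?case
      proof (cases "\<gamma>s n \<in> couplings \<mu>")
        case c: True
        have "ereal (- K) \<le> rel_entropy m (\<gamma>s n)" unfolding K_def by (rule rel_entropy_bounded_below[OF c])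
        then have tau: "ereal (\<tau> n) * ereal (- K) \<le> ereal (\<tau> n) * rel_entropy m (\<gamma>s n)"
          using tau_pos[of n] by (intro ereal_mult_left_mono) auto
        have "ereal a \<le> transport_cost f (\<gamma>s n)" using elim c by auto
        from add_mono[OF this tau]
        have "ereal a + ereal (\<tau> n) * ereal (- K) \<le> entropic_functional f m \<mu> (\<tau> n) (\<gamma>s n)"
          by (simp only: entropic_functional_def if_P[OF c])
        moreover have "ereal b \<le> ereal a + ereal (\<tau> n) * ereal (- K)" using elim by simp
        ultimately show ?thesis using b(1) by (meson less_le_trans)
      qed (use y in \<open>auto simp: entropic_functional_def dest: less_le_trans\<close>)
    qed
  qed
qed

text \<open>Symmetrizing keeps the cost, which is permutation invariant, and the narrow limit: as
  \<open>\<gamma>\<close> is symmetric, the integrals of \<open>g\<close> composed with any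
  permutation all tend to that of \<open>g\<close>. The entropies \<open>e n\<close> are finite,
  with no control of their growth.\<close>

lemma symmetric_approximation:
  fixes \<gamma> :: "('n::{finite,linorder} \<Rightarrow> 'a) measure"
  assumes g: "\<gamma> \<in> couplings \<mu>" and gs: "\<gamma> \<in> sym_prob_measures" and fin: "transport_cost f \<gamma> \<noteq> \<infinity>"
    and r: "r > 0" and s: "\<And>x. measure \<mu> (ball x r) \<le> s" "2 * (real CARD('n) - 1) * s < 1"
  obtains \<eta>s :: "nat \<Rightarrow> ('n \<Rightarrow> 'a) measure" and e :: "nat \<Rightarrow> real"
  where "\<And>n. \<eta>s n \<in> couplings \<mu>" "\<And>n. \<eta>s n \<in> sym_prob_measures" "\<And>n. rel_entropy m (\<eta>s n) = ereal (e n)"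
    "\<And>n. transport_cost f (\<eta>s n) \<le> ereal ((\<integral>x. cost x \<partial>\<gamma>) + 5 / real (Suc n))"
    "narrowly_converges \<eta>s \<gamma>"
proof -
  note inj = transport_cost_finite[OF g fin]
  have "\<exists>\<eta> U C. \<eta> \<in> couplings \<mu> \<and> U \<in> borel_measurable borel \<and> (\<forall>x. 0 \<le> U x \<and> U x \<le> C) \<and>
    \<eta> = density (Pi\<^sub>M UNIV (\<lambda>_. \<mu>)) (\<lambda>x. ennreal (U x)) \<and>
    transport_cost f \<eta> \<le> ereal ((\<integral>x. cost x \<partial>\<gamma>) + 5 * (1 / real (Suc n))) \<and>
    (\<forall>g L B. (\<forall>x y. \<bar>g x - g y\<bar> \<le> L * dist x y) \<longrightarrow> (\<forall>x. \<bar>g x\<bar> \<le> B) \<longrightarrow> 0 \<le> L \<longrightarrow>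
       \<bar>(\<integral>x. g x \<partial>\<eta>) - (\<integral>x. g x \<partial>\<gamma>)\<bar> \<le> (2 * L + 3 * B) * (1 / real (Suc n)))" for n
    by (rule approximation[OF g inj r s]) simp
  then obtain \<eta> U C where \<eta>: "\<And>n. \<eta> n \<in> couplings \<mu>" "\<And>n. U n \<in> borel_measurable borel" "\<And>n x. 0 \<le> U n x"
    "\<And>n x. U n x \<le> C n" "\<And>n. \<eta> n = density (Pi\<^sub>M UNIV (\<lambda>_. \<mu>)) (\<lambda>x. ennreal (U n x))"
    and cost: "\<And>n. transport_cost f (\<eta> n) \<le> ereal ((\<integral>x. cost x \<partial>\<gamma>) + 5 * (1 / real (Suc n)))"
    and lip: "\<And>n g L B. (\<And>x y. \<bar>g x - g y\<bar> \<le> L * dist x y) \<Longrightarrow> (\<And>x. \<bar>g x\<bar> \<le> B) \<Longrightarrow> 0 \<le> L \<Longrightarrow>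
       \<bar>(\<integral>x. g x \<partial>\<eta> n) - (\<integral>x. g x \<partial>\<gamma>)\<bar> \<le> (2 * L + 3 * B) * (1 / real (Suc n))"
    by metis
  define \<eta>s where "\<eta>s n = density (Pi\<^sub>M UNIV (\<lambda>_. \<mu>)) (\<lambda>x. ennreal (symmetrized (U n) x))" for n
  have conv: "narrowly_converges \<eta> \<gamma>"
  proof (rule narrowly_converges_Lipschitz)
    show "\<eta> n \<in> borel_prob_measures" "\<gamma> \<in> borel_prob_measures" for n
      using \<eta>(1) g by (auto simp: couplings_def)
    fix g :: "('n \<Rightarrow> 'a) \<Rightarrow> real" and L B
    assume L: "\<And>x y. \<bar>g x - g y\<bar> \<le> L * dist x y" and B: "\<And>x. \<bar>g x\<bar> \<le> B"
    \<comment> \<open>The test functions come with an arbitrary constant, while the estimate asks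
      for a nonnegative one.\<close>
    define L' where "L' = max L 0"
    have L': "\<bar>g x - g y\<bar> \<le> L' * dist x y" for x y
      using L[of x y] mult_right_mono[of L L' "dist x y"] by (simp add: L'_def)
    have "(\<lambda>n. (2 * L' + 3 * B) * (1 / real (Suc n))) \<longlonglongrightarrow> (2 * L' + 3 * B) * 0"
      by (intro tendsto_intros LIMSEQ_Suc lim_1_over_n)
    then have lim0: "(\<lambda>n. (2 * L' + 3 * B) * (1 / real (Suc n))) \<longlonglongrightarrow> 0" by simp
    have "0 \<le> L'" by (simp add: L'_def)
    then have "norm ((\<integral>x. g x \<partial>\<eta> n) - (\<integral>x. g x \<partial>\<gamma>)) \<le> (2 * L' + 3 * B) * (1 / real (Suc n))" for n
      unfolding real_norm_def by (rule lip[OF L' B])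
    then have "(\<lambda>n. (\<integral>x. g x \<partial>\<eta> n) - (\<integral>x. g x \<partial>\<gamma>)) \<longlonglongrightarrow> 0"
      by (intro Lim_null_comparison[OF _ lim0] always_eventually allI)
    then show "(\<lambda>n. \<integral>x. g x \<partial>\<eta> n) \<longlonglongrightarrow> (\<integral>x. g x \<partial>\<gamma>)" by (simp add: LIM_zero_iff)
  qed
  have S: "\<eta>s n \<in> couplings \<mu> \<inter> sym_prob_measures" for n
    by (rule symmetrized_coupling[OF \<eta>(2-5) \<eta>s_def \<eta>(1) refl])
  have sconv: "narrowly_converges \<eta>s \<gamma>"
    unfolding narrowly_converges_def
  proof (intro allI impI)
    fix g :: "('n \<Rightarrow> 'a) \<Rightarrow> real" assume g: "continuous_on UNIV g \<and> bounded (range g)"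
    then obtain B where B: "\<And>x. \<bar>g x\<bar> \<le> B" by (auto simp: bounded_iff)
    have gm: "g \<in> borel_measurable borel" using g by (intro borel_measurable_continuous_onI) simp
    let ?c = "real (card (perms :: ('n \<Rightarrow> 'n) set))"
    have "(\<lambda>n. \<integral>x. g (x \<circ> p) \<partial>\<eta> n) \<longlonglongrightarrow> (\<integral>x. g x \<partial>\<gamma>)" if p: "p \<in> perms" for p
    proof -
      have "continuous_on UNIV (\<lambda>x. g (x \<circ> p))"
        by (rule continuous_on_compose2[OF conjunct1[OF g] continuous_on_perm]) simp
      moreover have "bounded (range (\<lambda>x. g (x \<circ> p)))" using B by (intro boundedI) auto
      ultimately have "(\<lambda>n. \<integral>x. g (x \<circ> p) \<partial>\<eta> n) \<longlonglongrightarrow> (\<integral>x. g (x \<circ> p) \<partial>\<gamma>)"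
        using conv unfolding narrowly_converges_def by blast
      then show ?thesis using sym_prob_measure_integral[OF gs _ gm, of p] p by (simp add: perms_def)
    qed
    then have "(\<lambda>n. (\<Sum>p\<in>perms. \<integral>x. g (x \<circ> p) \<partial>\<eta> n) / ?c) \<longlonglongrightarrow> (\<Sum>p\<in>(perms :: ('n \<Rightarrow> 'n) set). \<integral>x. g x \<partial>\<gamma>) / ?c"
      using card_perms_pos[where 'n='n] by (intro tendsto_divide tendsto_sum tendsto_const) auto
    also have "(\<Sum>p\<in>(perms :: ('n \<Rightarrow> 'n) set). \<integral>x. g x \<partial>\<gamma>) / ?c = (\<integral>x. g x \<partial>\<gamma>)"
      using card_perms_pos[where 'n='n] by (auto simp: card_gt_0_iff)
    finally show "(\<lambda>n. \<integral>x. g x \<partial>\<eta>s n) \<longlonglongrightarrow> (\<integral>x. g x \<partial>\<gamma>)"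
      unfolding symmetrized_integral[OF \<eta>(2-5) \<eta>s_def \<eta>(1) refl gm B] .
  qed
  have tc: "transport_cost f (\<eta>s n) = transport_cost f (\<eta> n)" for n
  proof -
    note pair_cost_measurable[measurable]
    note inv = symmetrized_invariant_integral[OF \<eta>(2-5) \<eta>s_def \<eta>(1) refl]
    have "(\<integral>\<^sup>+x. e2ennreal (pair_cost f x) \<partial>\<eta>s n) = (\<integral>\<^sup>+x. e2ennreal (pair_cost f x) \<partial>\<eta> n)"
      by (rule inv) (measurable, simp add: pair_cost_perm)
    moreover have "(\<integral>\<^sup>+x. e2ennreal (- pair_cost f x) \<partial>\<eta>s n) = (\<integral>\<^sup>+x. e2ennreal (- pair_cost f x) \<partial>\<eta> n)"
      by (rule inv) (measurable, simp add: pair_cost_perm)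
    ultimately show ?thesis by (simp add: transport_cost_def ereal_integral_def)
  qed
  have "\<exists>e. rel_entropy m (\<eta>s n) = ereal e" for n
    by (rule rel_entropy_bounded_density[OF _ _ _ \<eta>s_def])
      (rule symmetrized_measurable[OF \<eta>(2-5) \<eta>s_def \<eta>(1) refl]
        symmetrized_nonneg[OF \<eta>(2-5) \<eta>s_def \<eta>(1) refl]
        symmetrized_le[OF \<eta>(2-5) \<eta>s_def \<eta>(1) refl])+
  then obtain e where "\<And>n. rel_entropy m (\<eta>s n) = ereal (e n)" by metis
  then show ?thesis
    using S sconv cost tc by (intro that[of \<eta>s e]) auto
qed

text \<open>An infinite limit value is met by the constant sequence. Otherwise the approximations
  are traversed at the slow index \<open>k n\<close>, so that their entropies are beaten by
  \<open>\<tau> n\<close>.\<close>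

lemma Gamma_limsup:
  fixes \<gamma> :: "('n::{finite,linorder} \<Rightarrow> 'a) measure"
  assumes N: "CARD('n) \<ge> 2" and A: "small_concentration CARD('n) \<mu>"
    and tau_pos: "\<And>n. 0 < \<tau> n" and tau_lim: "\<tau> \<longlonglongrightarrow> 0" and gs: "\<gamma> \<in> sym_prob_measures"
  shows "\<exists>\<gamma>s. (\<forall>n. \<gamma>s n \<in> sym_prob_measures) \<and> narrowly_converges \<gamma>s \<gamma> \<and>
     limsup (\<lambda>n. entropic_functional f m \<mu> (\<tau> n) (\<gamma>s n)) \<le> limit_functional f \<mu> \<gamma>"
proof (cases "limit_functional f \<mu> \<gamma> = \<infinity>")
  case True
  then show ?thesis using gs by (intro exI[of _ "\<lambda>_. \<gamma>"]) (auto simp: narrowly_converges_def)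
next
  case False
  then have g: "\<gamma> \<in> couplings \<mu>" and fin: "transport_cost f \<gamma> \<noteq> \<infinity>"
    by (auto simp: limit_functional_def split: if_splits)
  obtain r s where r: "r > 0" and s: "2 * (real CARD('n) - 1) * s < 1" "\<And>x. measure \<mu> (ball x r) \<le> s"
    using small_concentrationD[OF A N] by blast
  obtain \<eta>s :: "nat \<Rightarrow> ('n \<Rightarrow> 'a) measure" and e where \<eta>s: "\<And>n. \<eta>s n \<in> couplings \<mu>" "\<And>n. \<eta>s n \<in> sym_prob_measures"
    "\<And>n. rel_entropy m (\<eta>s n) = ereal (e n)"
    "\<And>n. transport_cost f (\<eta>s n) \<le> ereal ((\<integral>x. cost x \<partial>\<gamma>) + 5 / real (Suc n))"
    "narrowly_converges \<eta>s \<gamma>"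
    using symmetric_approximation[OF g gs fin r s(2,1)] by metis
  obtain k where k: "filterlim k at_top sequentially" "(\<lambda>n. \<tau> n * e (k n)) \<longlonglongrightarrow> 0"
    using slow_reparametrization[OF tau_pos tau_lim] by blast
  let ?b = "\<lambda>n. (\<integral>x. cost x \<partial>\<gamma>) + 5 / real (Suc (k n)) + \<tau> n * e (k n)"
  have "(\<lambda>n. 5 / real (Suc n)) \<longlonglongrightarrow> 0" by (rule LIMSEQ_Suc[OF lim_const_over_n])
  then have "(\<lambda>n. 5 / real (Suc (k n))) \<longlonglongrightarrow> 0" by (rule filterlim_compose[OF _ k(1)])
  then have "?b \<longlonglongrightarrow> (\<integral>x. cost x \<partial>\<gamma>) + 0 + 0" by (intro tendsto_add tendsto_const k(2))
  then have blim: "(\<lambda>n. ereal (?b n)) \<longlonglongrightarrow> ereal (\<integral>x. cost x \<partial>\<gamma>)" by simp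
  have "limsup (\<lambda>n. entropic_functional f m \<mu> (\<tau> n) (\<eta>s (k n))) \<le> limsup (\<lambda>n. ereal (?b n))"
  proof (intro Limsup_mono always_eventually allI)
    fix n
    have "entropic_functional f m \<mu> (\<tau> n) (\<eta>s (k n)) = transport_cost f (\<eta>s (k n)) + ereal (\<tau> n * e (k n))"
      by (simp add: entropic_functional_def \<eta>s(1,3))
    also have "\<dots> \<le> ereal ((\<integral>x. cost x \<partial>\<gamma>) + 5 / real (Suc (k n))) + ereal (\<tau> n * e (k n))"
      by (intro add_right_mono \<eta>s(4))
    finally show "entropic_functional f m \<mu> (\<tau> n) (\<eta>s (k n)) \<le> ereal (?b n)" by simp
  qed
  also have "\<dots> = ereal (\<integral>x. cost x \<partial>\<gamma>)" by (rule lim_imp_Limsup[OF _ blim]) simp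
  also have "\<dots> = limit_functional f \<mu> \<gamma>"
    using g by (simp add: limit_functional_def transport_cost_eq_integral[OF transport_cost_finite[OF g fin]])
  finally have "limsup (\<lambda>n. entropic_functional f m \<mu> (\<tau> n) (\<eta>s (k n))) \<le> limit_functional f \<mu> \<gamma>" .
  moreover have "narrowly_converges (\<lambda>n. \<eta>s (k n)) \<gamma>"
    unfolding narrowly_converges_def
  proof (intro allI impI)
    fix g :: "('n \<Rightarrow> 'a) \<Rightarrow> real" assume "continuous_on UNIV g \<and> bounded (range g)"
    then have "(\<lambda>n. \<integral>x. g x \<partial>\<eta>s n) \<longlonglongrightarrow> (\<integral>x. g x \<partial>\<gamma>)" using \<eta>s(5) by (simp add: narrowly_converges_def)
    then show "(\<lambda>n. \<integral>x. g x \<partial>\<eta>s (k n)) \<longlonglongrightarrow> (\<integral>x. g x \<partial>\<gamma>)" by (rule filterlim_compose[OF _ k(1)])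
  qed
  ultimately show ?thesis using \<eta>s(2) by (intro exI[of _ "\<lambda>n. \<eta>s (k n)"]) simp
qed

end

theorem theorem3p1:
  fixes m :: "'a::polish_space measure"
    and \<rho> :: "'a \<Rightarrow> real"
    and f :: "real \<Rightarrow> ereal"
    and \<tau> :: "nat \<Rightarrow> real"
  assumes N: "CARD('n::{finite,linorder}) \<ge> 2"
    and m_borel: "sets m = sets borel"
    and m_sigma_finite: "sigma_finite_measure m"
    and rho_measurable: "\<rho> \<in> borel_measurable borel"
    and rho_nonneg: "\<And>x. 0 \<le> \<rho> x"
    and rho_prob: "prob_space (density m (\<lambda>x. ennreal (\<rho> x)))"
    and rho_log_rho: "integrable m (\<lambda>x. \<rho> x * ln (\<rho> x))"
    and F: "repulsive_profile f"
    and A: "small_concentration CARD('n) (density m (\<lambda>x. ennreal (\<rho> x)))"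
    and B: "controlled_tail f (density m (\<lambda>x. ennreal (\<rho> x)))"
    and tau_pos: "\<And>n. 0 < \<tau> n"
    and tau_decreasing: "decseq \<tau>"
    and tau_tendsto: "\<tau> \<longlonglongrightarrow> 0"
  shows "Gamma_converges_on (sym_prob_measures :: ('n \<Rightarrow> 'a) measure set)
           (\<lambda>n. entropic_functional f m (density m (\<lambda>x. ennreal (\<rho> x))) (\<tau> n))
           (limit_functional f (density m (\<lambda>x. ennreal (\<rho> x))))"
proof -
  interpret ED: entropy_density m \<rho>
    using m_borel m_sigma_finite rho_measurable rho_nonneg rho_prob rho_log_rho by (rule entropy_density.intro)
  interpret BP: borel_prob "density m (\<lambda>x. ennreal (\<rho> x))"
    using rho_prob m_borel by (intro borel_prob.intro borel_prob_axioms.intro) simp_all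
  obtain z0 where z0: "integrable (density m (\<lambda>x. ennreal (\<rho> x))) (tail f z0)"
    using BP.controlled_tail_integrable[OF F B] by blast
  interpret RC: repulsive_cost "density m (\<lambda>x. ennreal (\<rho> x))" f z0
    by standard (rule F, rule z0)
  interpret ET: entropic_transport m \<rho> f z0 by standard
  show ?thesis
    unfolding Gamma_converges_on_def
  proof (intro ballI conjI allI impI)
    fix \<gamma> :: "('n \<Rightarrow> 'a) measure" assume g: "\<gamma> \<in> sym_prob_measures"
    show "limit_functional f (density m (\<lambda>x. ennreal (\<rho> x))) \<gamma>
       \<le> liminf (\<lambda>n. entropic_functional f m (density m (\<lambda>x. ennreal (\<rho> x))) (\<tau> n) (\<gamma>s n))"
      if "(\<forall>n. \<gamma>s n \<in> sym_prob_measures) \<and> narrowly_converges \<gamma>s \<gamma>" for \<gamma>s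
      using that g by (intro ET.Gamma_liminf tau_pos tau_tendsto) (auto simp: sym_prob_measures_def)
    show "\<exists>\<gamma>s. (\<forall>n. \<gamma>s n \<in> sym_prob_measures) \<and> narrowly_converges \<gamma>s \<gamma> \<and>
       limsup (\<lambda>n. entropic_functional f m (density m (\<lambda>x. ennreal (\<rho> x))) (\<tau> n) (\<gamma>s n))
         \<le> limit_functional f (density m (\<lambda>x. ennreal (\<rho> x))) \<gamma>"
      by (rule ET.Gamma_limsup[OF N A tau_pos tau_tendsto g])
  qed
qed

end
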